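(* Let $S$ be a compact metric space, let $\bm\vartheta=(\vartheta_s)_{s\in S}$ be a max-stable process with univariate marginal distribution functions $G_s$, $s\in S$, and let $\bm X^{(1)},\bm X^{(2)},\ldots$ be independent copies of a process $\bm X=(X_s)_{s\in S}$ in $C(S)$ with $\bm X\in\mathcal D(\bm\vartheta)$, with norming functions $c_n\in C^+(S)$, $d_n\in C(S)$, $n\in\mathbb N$. Suppose the univariate marginal distribution functions $F_s(x)=P(X_s\le x)$, $s\in S$, are continuous and strictly monotonically increasing on their support, and satisfy $$F_s(c_n(s)x+d_n(s))^n\to_{n\to\infty}G_s(x),\qquad x\in\mathbb R,$$ uniformly for $s\in S$ and locally uniformly for $x\in\mathbb R$. Put $$\bm U=(U_s)_{s\in S}:=(F_s(X_s))_{s\in S},\qquad \bm\eta=(\eta_s)_{s\in S}:=(\log(G_s(\vartheta_s)))_{s\in S},$$ and let $\|\cdot\|_D$ be the $D$-norm of the standard max-stable process $\bm\eta$. Choose a generator $\bm Z=(Z_s)_{s\in S}$ of $\|\cdot\|_D$ and suppose that $P(\bm Z>0)>0$. Then, for every $f\in E(S)$ with $\inf_{s\in S}G_s(f(s))>0$, $$P\left(\frac{\bm X^{(n)}-d_n}{c_n}>f\,\Big|\,\bm X^{(n)}\text{ is a complete record}\right)\longrightarrow \bar H_D(\psi(f))\qquad(n\to\infty),$$ where $\psi(f)(s)=\log(G_s(f(s)))$, $s\in S$.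
   Context: All operations and relations ($\max$, $>$, $\le$, quotients, ...) between functions are meant pointwise on $S$; in particular $\bm Z>0$ means $Z_s>0$ for all $s\in S$. $C(S)$ is the space of continuous real functions on $S$ with the sup-norm; $C^+(S)=\{f\in C(S): f>0\}$; $\bar C^+(S)=\{f\in C(S): f\ge 0\}$; $E(S)$ is the set of bounded functions $f:S\to\mathbb R$ with only finitely many discontinuities, and $\bar E^-(S)=\{f\in E(S): f\le 0\}$. A max-stable process (MSP) is a process $\bm\vartheta$ with sample paths in $C(S)$ and non-degenerate univariate margins for which there are $a_n\in C^+(S)$, $b_n\in C(S)$ such that $\max_{1\le i\le n}(\bm\vartheta^{(i)}-b_n)/a_n$ has the same distribution as $\bm\vartheta$ for every $n$ ($\bm\vartheta^{(i)}$ iid copies of $\bm\vartheta$). $\bm X\in\mathcal D(\bm\vartheta)$ with norming functions $c_n\in C^+(S)$, $d_n\in C(S)$ means $\max_{1\le i\le n}(\bm X^{(i)}-d_n)/c_n\to\bm\vartheta$ in distribution in $(C(S),\|\cdot\|_\infty)$. A standard max-stable process (SMSP) is an MSP $\bm\eta$ with margins $P(\eta_s\le x)=e^x$ for $x\le 0$, $s\in S$. If $\bm\vartheta$ is an MSP with marginal distribution functions $G_s$, then $(\log G_s(\vartheta_s))_{s\in S}$ is an SMSP. For every SMSP there is a process $\bm Z=(Z_s)_{s\in S}$ with sample paths in $\bar C^+(S)$, $E(Z_s)=1$ for all $s$, $E(\sup_{s}Z_s)<\infty$, such that $P(\bm\eta\le f)=\exp(-\|f\|_D)$ for $f\in\bar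 E^-(S)$, where $\|f\|_D:=E(\sup_{s\in S}|f(s)|Z_s)$, $f\in E(S)$. The norm $\|\cdot\|_D$ is the $D$-norm of $\bm\eta$ and $\bm Z$ is called a generator of it. The dual $D$-norm function is $\wr\!\wr f\wr\!\wr_D:=E(\inf_{s\in S}|f(s)|Z_s)$, $f\in E(S)$; it does not depend on the choice of the generator. For $g\in\bar E^-(S)$, $$\bar H_D(g):=\frac{E\left(\wr\!\wr\max(\bm\eta,g)\wr\!\wr_D\right)}{E\left(\wr\!\wr\bm\eta\wr\!\wr_D\right)},$$ where the expectations are of $\wr\!\wr\cdot\wr\!\wr_D$ evaluated at the random functions $\max(\bm\eta,g)$ and $\bm\eta$. $\bm X^{(n)}$ is a complete record if $\bm X^{(n)}>\max_{1\le i\le n-1}\bm X^{(i)}$. *)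

theory Defs
  imports "HOL-Probability.Probability"
begin

text \<open>
  The index space \<open>S\<close> is a type \<open>'s\<close> of class \<open>metric_space\<close> whose universe is compact; then
  \<open>'s \<Rightarrow>\<^sub>C real\<close> is \<open>C(S)\<close> with the sup-norm, since boundedness of the functions is automatic.
  A process with sample paths in \<open>C(S)\<close> is a random element of \<open>C(S)\<close>, measurable with respect to
  the Borel sets of the sup-norm. For compact metric \<open>S\<close> the latter are generated by the point
  evaluations, so that this is measurability of all coordinates.
\<close>

definition path_process :: "'a measure \<Rightarrow> ('a \<Rightarrow> 's::metric_space \<Rightarrow>\<^sub>C real) \<Rightarrow> bool" where
  "path_process M X \<longleftrightarrow> prob_space M \<and> X \<in> borel_measurable M"

definition margin_cdf ::
    "'a measure \<Rightarrow> ('a \<Rightarrow> 's::metric_space \<Rightarrow>\<^sub>C real) \<Rightarrow> 's \<Rightarrow> real \<Rightarrow> real" where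
  "margin_cdf M X s = cdf (distr M borel (\<lambda>\<omega>. X \<omega> s))"

definition distribution_support :: "real measure \<Rightarrow> real set" where
  "distribution_support \<mu> = {x. \<forall>U. open U \<and> x \<in> U \<longrightarrow> measure \<mu> U > 0}"

definition Cpos :: "('s::metric_space \<Rightarrow>\<^sub>C real) set" where
  "Cpos = {f :: 's \<Rightarrow>\<^sub>C real. \<forall>s. f s > 0}"

definition Cnonneg :: "('s::metric_space \<Rightarrow>\<^sub>C real) set" where
  "Cnonneg = {f :: 's \<Rightarrow>\<^sub>C real. \<forall>s. f s \<ge> 0}"

definition Efun :: "('s::metric_space \<Rightarrow> real) set" where
  "Efun = {f. bounded (range f) \<and> finite {s. \<not> isCont f s}}"

definition Enonpos :: "('s::metric_space \<Rightarrow> real) set" where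
  "Enonpos = {f \<in> Efun. \<forall>s. f s \<le> 0}"

text \<open>
  The function \<open>max\<^bsub>1\<le>i\<le>n\<^esub> (x\<^sub>i - b) / a\<close>. It lies in \<open>C(S)\<close>, so that the abstraction \<open>Bcontfun\<close> is
  meaningful, if \<open>n \<ge> 1\<close>, \<open>a > 0\<close> and \<open>S\<close> is compact; see \<open>apply_normalized_max\<close> below.
\<close>

definition normalized_max ::
    "nat \<Rightarrow> ('s::metric_space \<Rightarrow>\<^sub>C real) \<Rightarrow> ('s \<Rightarrow>\<^sub>C real) \<Rightarrow> (nat \<Rightarrow> 's \<Rightarrow>\<^sub>C real) \<Rightarrow> 's \<Rightarrow>\<^sub>C real" where
  "normalized_max n a b x = Bcontfun (\<lambda>s. MAX i\<in>{1..n}. (x i s - b s) / a s)"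

lemma continuous_on_MAX:
  fixes f :: "'i \<Rightarrow> 's::topological_space \<Rightarrow> real"
  assumes "finite I" "I \<noteq> {}" "\<And>i. i \<in> I \<Longrightarrow> continuous_on A (f i)"
  shows "continuous_on A (\<lambda>s. MAX i\<in>I. f i s)"
  using assms
proof (induction rule: finite_ne_induct)
  case (insert j I)
  then have "continuous_on A (\<lambda>s. max (f j s) (MAX i\<in>I. f i s))"
    by (intro continuous_on_max) auto
  with insert.hyps show ?case by simp
qed simp

lemma apply_normalized_max:
  fixes a b :: "'s::metric_space \<Rightarrow>\<^sub>C real"
  assumes "compact (UNIV :: 's set)" "n \<ge> 1" "a \<in> Cpos"
  shows "normalized_max n a b x s = (MAX i\<in>{1..n}. (x i s - b s) / a s)"
proof -
  let ?h = "\<lambda>s. MAX i\<in>{1..n}. (x i s - b s) / a s"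
  have "a s \<noteq> 0" for s
    using assms(3) by (auto simp: Cpos_def less_le)
  then have "continuous_on UNIV ?h"
    using assms(2) by (intro continuous_on_MAX continuous_intros) auto
  then have "?h \<in> bcontfun"
    using assms(1) by (auto simp: bcontfun_def intro: compact_imp_bounded compact_continuous_image)
  then show ?thesis
    by (simp add: normalized_max_def Bcontfun_inverse)
qed

text \<open>
  The law of the normalized maximum of \<open>n\<close> independent copies of a process with law \<open>\<mu>\<close>, the copies
  being realised as the coordinates on the product space.
\<close>

definition normalized_max_law ::
    "('s::metric_space \<Rightarrow>\<^sub>C real) measure \<Rightarrow> nat \<Rightarrow> ('s \<Rightarrow>\<^sub>C real) \<Rightarrow> ('s \<Rightarrow>\<^sub>C real)
      \<Rightarrow> ('s \<Rightarrow>\<^sub>C real) measure" where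
  "normalized_max_law \<mu> n a b = distr (\<Pi>\<^sub>M i\<in>{1..n}. \<mu>) borel (normalized_max n a b)"

definition max_stable_process :: "'a measure \<Rightarrow> ('a \<Rightarrow> 's::metric_space \<Rightarrow>\<^sub>C real) \<Rightarrow> bool" where
  "max_stable_process N \<theta> \<longleftrightarrow>
     path_process N \<theta> \<and>
     (\<forall>s. \<not> (\<exists>x. AE \<omega> in N. \<theta> \<omega> s = x)) \<and>
     (\<exists>a b :: nat \<Rightarrow> 's \<Rightarrow>\<^sub>C real. \<forall>n\<ge>1. a n \<in> Cpos \<and>
        normalized_max_law (distr N borel \<theta>) n (a n) (b n) = distr N borel \<theta>)"

definition weakly_convergent_to ::
    "(nat \<Rightarrow> 'x::metric_space measure) \<Rightarrow> 'x measure \<Rightarrow> bool" where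
  "weakly_convergent_to \<mu> \<nu> \<longleftrightarrow>
     (\<forall>\<phi> :: 'x \<Rightarrow>\<^sub>C real. (\<lambda>n. \<integral>x. \<phi> x \<partial>\<mu> n) \<longlonglongrightarrow> (\<integral>x. \<phi> x \<partial>\<nu>))"

definition in_max_domain ::
    "'a measure \<Rightarrow> ('a \<Rightarrow> 's::metric_space \<Rightarrow>\<^sub>C real) \<Rightarrow> 'b measure \<Rightarrow> ('b \<Rightarrow> 's \<Rightarrow>\<^sub>C real)
      \<Rightarrow> (nat \<Rightarrow> 's \<Rightarrow>\<^sub>C real) \<Rightarrow> (nat \<Rightarrow> 's \<Rightarrow>\<^sub>C real) \<Rightarrow> bool" where
  "in_max_domain M X N \<theta> c d \<longleftrightarrow>
     (\<forall>n\<ge>1. c n \<in> Cpos) \<and>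
     weakly_convergent_to (\<lambda>n. normalized_max_law (distr M borel X) n (c n) (d n)) (distr N borel \<theta>)"

text \<open>
  \<open>\<psi>(f)(s) = log (G\<^sub>s(f(s)))\<close>. In particular \<open>\<eta> = \<psi>(\<theta>)\<close>, which is kept as a plain function of \<open>\<omega>\<close>
  and \<open>s\<close>: \<open>G\<^sub>s(\<theta>\<^sub>s)\<close> may vanish for some \<open>s\<close> on a null set of \<open>\<omega>\<close>, where \<open>ln 0 = 0\<close>, so that only
  almost all of its paths are known to be in \<open>C(S)\<close>.
\<close>

definition log_margin :: "('s \<Rightarrow> real \<Rightarrow> real) \<Rightarrow> ('s \<Rightarrow> real) \<Rightarrow> 's \<Rightarrow> real" where
  "log_margin G f = (\<lambda>s. ln (G s (f s)))"

definition D_norm :: "'k measure \<Rightarrow> ('k \<Rightarrow> 's::metric_space \<Rightarrow>\<^sub>C real) \<Rightarrow> ('s \<Rightarrow> real) \<Rightarrow> real" where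
  "D_norm K Z f = (\<integral>\<omega>. (SUP s. \<bar>f s\<bar> * Z \<omega> s) \<partial>K)"

definition dual_D_norm ::
    "'k measure \<Rightarrow> ('k \<Rightarrow> 's::metric_space \<Rightarrow>\<^sub>C real) \<Rightarrow> ('s \<Rightarrow> real) \<Rightarrow> real" where
  "dual_D_norm K Z f = (\<integral>\<omega>. (INF s. \<bar>f s\<bar> * Z \<omega> s) \<partial>K)"

definition generator :: "'k measure \<Rightarrow> ('k \<Rightarrow> 's::metric_space \<Rightarrow>\<^sub>C real) \<Rightarrow> bool" where
  "generator K Z \<longleftrightarrow>
     path_process K Z \<and>
     (\<forall>\<omega>\<in>space K. Z \<omega> \<in> Cnonneg) \<and>
     (\<forall>s. has_bochner_integral K (\<lambda>\<omega>. Z \<omega> s) 1) \<and>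
     integrable K (\<lambda>\<omega>. SUP s. Z \<omega> s)"

definition generator_of ::
    "'k measure \<Rightarrow> ('k \<Rightarrow> 's::metric_space \<Rightarrow>\<^sub>C real) \<Rightarrow> 'b measure \<Rightarrow> ('b \<Rightarrow> 's \<Rightarrow> real) \<Rightarrow> bool" where
  "generator_of K Z N \<eta> \<longleftrightarrow>
     generator K Z \<and>
     (\<forall>f\<in>Enonpos. \<P>(\<omega> in N. \<forall>s. \<eta> \<omega> s \<le> f s) = exp (- D_norm K Z f))"

definition H_bar ::
    "'k measure \<Rightarrow> ('k \<Rightarrow> 's::metric_space \<Rightarrow>\<^sub>C real) \<Rightarrow> 'b measure \<Rightarrow> ('b \<Rightarrow> 's \<Rightarrow> real)
      \<Rightarrow> ('s \<Rightarrow> real) \<Rightarrow> real" where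
  "H_bar K Z N \<eta> g =
     (\<integral>\<omega>. dual_D_norm K Z (\<lambda>s. max (\<eta> \<omega> s) (g s)) \<partial>N) / (\<integral>\<omega>. dual_D_norm K Z (\<eta> \<omega>) \<partial>N)"

text \<open>
  \<open>x\<^sub>n > max\<^bsub>1\<le>i\<le>n-1\<^esub> x\<^sub>i\<close> pointwise; \<open>x\<^sub>1\<close> is always a record.
\<close>

definition complete_record :: "(nat \<Rightarrow> 's::metric_space \<Rightarrow>\<^sub>C real) \<Rightarrow> nat \<Rightarrow> bool" where
  "complete_record x n \<longleftrightarrow> (\<forall>s. \<forall>i\<in>{1..<n}. x n s > x i s)"

end

theory Submission
  imports Defs
begin

text \<open>
  Since normalization is increasing, a complete record at time \<open>n\<close> that exceeds \<open>f\<close> means that the normalized path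
  \<open>n\<close> exceeds \<open>max(M, f)\<close>, where \<open>M\<close> is the normalized maximum of the preceding paths, which is independent of it and
  converges in law to \<open>\<theta>\<close>. Everything thus rests on \<open>n P(X > c\<^sub>n h + d\<^sub>n) \<longrightarrow> E(inf \<bar>\<psi>(h)\<bar> Z)\<close> for fixed \<open>h\<close>. On a finite set
  this is inclusion-exclusion applied to \<open>P(\<theta> \<le> h) = exp(- E(sup \<bar>\<psi>(h)\<bar> Z))\<close>; a path that exceeds \<open>h\<close> on a fine net but
  not everywhere would show up in the maximum, which converges in \<open>C(S)\<close>, so such paths are negligible. By monotonicity
  in \<open>h\<close> the convergence is continuous and may be integrated against the law of \<open>M\<close>. Finally the probability of a
  complete record is obtained by truncation: \<open>n\<close> times it is the probability that some path dominates all others.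
\<close>

subsection \<open>Weak convergence\<close>

text \<open>The limit functional \<open>E(inf |\<psi>(h)| Z)\<close> is in general unbounded in
  \<open>h\<close>, since the weights blow up at the lower end points of the margins. Requiring an
  exceedance of a level at a single point of S makes the integrands uniformly bounded, so the
  numerator is a continuous mapping argument, whereas the denominator has no such bound and is
  reached only as a limit of truncations. Discontinuous functions matter on both sides: those in
  E(S) supported by a finite set extract the finite-dimensional laws of \<open>\<theta>\<close> from
  the D-norm, and the discontinuities of \<open>f\<close> have to be put into every finite net. A
  further obstacle is the index: at time \<open>n + 1\<close> the \<open>n\<close> preceding paths
  are normalized with the functions of index \<open>n + 1\<close>. Instead of comparing the norming
  functions, one shows that the new path lies below the old maximum with probability tending to 1,
  so that the two maxima coincide. Finally, the logarithm has the value 0 at 0. Paths meeting a zero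
  of \<open>G\<close> form a null set, and there the dual norm vanishes because one weight is 0, so
  the formulas stay consistent.\<close>

locale weak_limit =
  fixes \<mu> :: "nat \<Rightarrow> 'x::metric_space measure" and \<nu> :: "'x measure"
  assumes weak: "weakly_convergent_to \<mu> \<nu>"
    and prob: "\<forall>\<^sub>F n in sequentially. prob_space (\<mu> n)"
    and sets: "\<And>n. sets (\<mu> n) = sets borel"
    and prob': "prob_space \<nu>" and sets': "sets \<nu> = sets borel"
begin

sublocale nu: prob_space \<nu> by (rule prob')

declare sets [measurable_cong] sets' [measurable_cong]

text \<open>The inf-convolutions \<open>INF n y. \<phi> n y + k * dist x y\<close> over \<open>n \<ge> k\<close> are Lipschitz minorants of all late
  \<open>\<phi> n\<close>, and their limit for \<open>k \<longrightarrow> \<infinity>\<close> dominates \<open>\<psi>\<close>.\<close>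

lemma weak_convergence_liminf:
  fixes \<phi> :: "nat \<Rightarrow> 'x \<Rightarrow> real"
  assumes meas: "\<And>n. \<phi> n \<in> borel_measurable borel"
    and bnd: "\<forall>\<^sub>F n in sequentially. \<forall>x. 0 \<le> \<phi> n x \<and> \<phi> n x \<le> B"
    and meas': "\<psi> \<in> borel_measurable borel" and bnd': "\<And>x. 0 \<le> \<psi> x \<and> \<psi> x \<le> B"
    and lower: "AE x in \<nu>. \<forall>e>0. \<exists>\<delta>>0. \<forall>\<^sub>F n in sequentially. \<forall>y. dist y x < \<delta> \<longrightarrow> \<phi> n y > \<psi> x - e"
    and e: "e > 0"
  shows "\<forall>\<^sub>F n in sequentially. (\<integral>x. \<phi> n x \<partial>\<mu> n) > (\<integral>x. \<psi> x \<partial>\<nu>) - e"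
proof -
  obtain n0 where n0: "\<And>n x. n \<ge> n0 \<Longrightarrow> 0 \<le> \<phi> n x \<and> \<phi> n x \<le> B" 
    using bnd by (auto simp: eventually_sequentially)
  define h where "h k x y n = \<phi> n y + real k * dist x y" for k x y n
  define g where "g k x = (INF p\<in>{n0+k..}\<times>UNIV. h k x (snd p) (fst p))" for k x
  have h0: "h k x (snd p) (fst p) \<ge> 0" if "p \<in> {n0+k..}\<times>UNIV" for k x p
    using n0[of "fst p" "snd p"] that by (auto simp: h_def)
  have bb: "bdd_below ((\<lambda>p. h k x (snd p) (fst p)) ` ({n0+k..}\<times>UNIV))" for k x
    using h0 by (intro bdd_belowI2[of _ 0]) 
  have gle: "g k x \<le> h k x y n" if "n \<ge> n0 + k" for k x y n
    unfolding g_def using cINF_lower[OF bb, of "(n,y)"] that by auto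
  have gge: "a \<le> g k x" if "\<And>y n. n \<ge> n0+k \<Longrightarrow> a \<le> h k x y n" for a k x
    unfolding g_def by (rule cINF_greatest) (use that in auto)
  have g0: "0 \<le> g k x" for k x
    by (rule gge) (use n0 in \<open>auto simp: h_def\<close>)
  have gphi: "g k x \<le> \<phi> n x" if "n \<ge> n0 + k" for k x n
    using gle[OF that, of x x] by (simp add: h_def)
  have gB: "g k x \<le> B" for k x
    using gphi[of k "n0+k" x] n0[of "n0+k" x] by linarith
  have glip: "g k x \<le> g k y + real k * dist x y" for k x y
  proof -
    have "g k x - real k * dist x y \<le> g k y"
    proof (rule gge)
      fix z n assume n: "n \<ge> n0 + k"
      have "real k * dist x z \<le> real k * (dist x y + dist y z)"
        by (intro mult_left_mono dist_triangle) auto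
      then show "g k x - real k * dist x y \<le> h k y z n"
        using gle[OF n, of x z] by (simp add: h_def distrib_left)
    qed
    then show ?thesis by simp
  qed
  have gcont: "continuous_on UNIV (g k)" for k
  proof -
    have "k-lipschitz_on UNIV (g k)"
      by (rule lipschitz_onI) (use glip[of k] in \<open>force simp: dist_real_def dist_commute abs_le_iff algebra_simps\<close>)+
    then show ?thesis by (rule lipschitz_on_continuous_on)
  qed
  then have gmeas [measurable]: "g k \<in> borel_measurable borel" for k
    by (rule borel_measurable_continuous_onI)
  note meas' [measurable] meas [measurable]
  \<comment> \<open>Only a lower bound on the late \<open>\<phi> n\<close> is given, so
    \<open>g k\<close> may exceed \<open>\<psi>\<close> in the limit. Capping it at
    \<open>\<psi>\<close> forces the pointwise limit to be \<open>\<psi>\<close> itself.\<close>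
  have lim: "(\<lambda>k. \<integral>x. min (g k x) (\<psi> x) \<partial>\<nu>) \<longlonglongrightarrow> (\<integral>x. \<psi> x \<partial>\<nu>)"
  proof (rule integral_dominated_convergence[where w="\<lambda>_. B"])
    show "AE x in \<nu>. (\<lambda>k. min (g k x) (\<psi> x)) \<longlonglongrightarrow> \<psi> x"
      using lower
    proof eventually_elim
      case (elim x)
      show ?case
      proof (rule LIMSEQ_I)
        fix r :: real assume r: "r > 0"
        then obtain \<delta> where \<delta>: "\<delta> > 0"
          and "\<forall>\<^sub>F n in sequentially. \<forall>y. dist y x < \<delta> \<longrightarrow> \<phi> n y > \<psi> x - r/2"
          using elim by (meson half_gt_zero)
        then obtain n1 where n1: "\<And>n y. n \<ge> n1 \<Longrightarrow> dist y x < \<delta> \<Longrightarrow> \<phi> n y > \<psi> x - r/2"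
          by (auto simp: eventually_sequentially)
        \<comment> \<open>From this slope on, the penalty for leaving the \<delta>-ball is at least
          \<open>B\<close>, which bounds \<open>\<psi>\<close>.\<close>
        obtain k0 :: nat where k0: "real k0 > B / \<delta>" using reals_Archimedean2 by blast
        have "norm (min (g k x) (\<psi> x) - \<psi> x) < r" if k: "k \<ge> max n1 k0" for k
        proof -
          have "\<psi> x - r/2 \<le> g k x"
          proof (rule gge)
            fix y n assume n: "n0 + k \<le> n"
            show "\<psi> x - r / 2 \<le> h k x y n"
            proof (cases "dist y x < \<delta>")
              case True
              then have "\<psi> x - r/2 < \<phi> n y" using n1 k n by auto
              moreover have "0 \<le> real k * dist x y" by simp
              ultimately show ?thesis unfolding h_def by linarith
            next
              case False
              have "B \<le> real k0 * \<delta>" using k0 \<delta> by (simp add: field_simps)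
              also have "\<dots> \<le> real k * dist x y"
                using False k \<delta> by (intro mult_mono) (auto simp: dist_commute)
              also have "\<dots> \<le> h k x y n" using n0[of n y] n by (simp add: h_def)
              finally show ?thesis using bnd'[of x] r by linarith
            qed
          qed
          then show ?thesis using r by auto
        qed
        then show "\<exists>no. \<forall>k\<ge>no. norm (min (g k x) (\<psi> x) - \<psi> x) < r" by blast
      qed
    qed
    show "AE x in \<nu>. norm (min (g k x) (\<psi> x)) \<le> B" for k
      using g0[of k] gB[of k] bnd' by (intro AE_I2) (auto simp: min_def)
  qed (auto intro!: AE_I2)
  then obtain k where k: "(\<integral>x. min (g k x) (\<psi> x) \<partial>\<nu>) > (\<integral>x. \<psi> x \<partial>\<nu>) - e/2"
    using order_tendstoD(1)[OF lim, of "(\<integral>x. \<psi> x \<partial>\<nu>) - e/2"] e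
    by (auto simp: eventually_sequentially)
  have bcont: "g k \<in> bcontfun"
    using gcont g0[of k] gB[of k] by (auto simp: bcontfun_def bounded_iff intro!: exI[of _ B])
  have "(\<lambda>n. \<integral>x. apply_bcontfun (Bcontfun (g k)) x \<partial>\<mu> n) \<longlonglongrightarrow> (\<integral>x. apply_bcontfun (Bcontfun (g k)) x \<partial>\<nu>)"
    using weak unfolding weakly_convergent_to_def by blast
  then have gl: "(\<lambda>n. \<integral>x. g k x \<partial>\<mu> n) \<longlonglongrightarrow> (\<integral>x. g k x \<partial>\<nu>)"
    by (simp add: Bcontfun_inverse[OF bcont])
  have "(\<integral>x. min (g k x) (\<psi> x) \<partial>\<nu>) \<le> (\<integral>x. g k x \<partial>\<nu>)"
    using g0 gB bnd'
    by (intro integral_mono nu.integrable_const_bound[where B=B] AE_I2) (auto simp: min_def)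
  then have "\<forall>\<^sub>F n in sequentially. (\<integral>x. g k x \<partial>\<mu> n) > (\<integral>x. \<psi> x \<partial>\<nu>) - e"
    using k e by (intro order_tendstoD(1)[OF gl]) linarith
  moreover have "\<forall>\<^sub>F n in sequentially. n \<ge> n0 + k" by (rule eventually_ge_at_top)
  ultimately show ?thesis using prob
  proof eventually_elim
    case (elim n)
    interpret mu: prob_space "\<mu> n" by fact
    have "(\<integral>x. g k x \<partial>\<mu> n) \<le> (\<integral>x. \<phi> n x \<partial>\<mu> n)"
      using g0 gB gphi elim(2) n0[of n]
      by (intro integral_mono mu.integrable_const_bound[where B=B] AE_I2) auto
    then show ?case using elim(1) by linarith
  qed
qed

lemma weak_convergence_limsup:
  fixes \<phi> :: "nat \<Rightarrow> 'x \<Rightarrow> real"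
  assumes meas: "\<And>n. \<phi> n \<in> borel_measurable borel"
    and bnd: "\<forall>\<^sub>F n in sequentially. \<forall>x. 0 \<le> \<phi> n x \<and> \<phi> n x \<le> B"
    and meas': "\<psi> \<in> borel_measurable borel" and bnd': "\<And>x. 0 \<le> \<psi> x \<and> \<psi> x \<le> B"
    and upper: "AE x in \<nu>. \<forall>e>0. \<exists>\<delta>>0. \<forall>\<^sub>F n in sequentially. \<forall>y. dist y x < \<delta> \<longrightarrow> \<phi> n y < \<psi> x + e"
    and e: "e > 0"
  shows "\<forall>\<^sub>F n in sequentially. (\<integral>x. \<phi> n x \<partial>\<mu> n) < (\<integral>x. \<psi> x \<partial>\<nu>) + e"
proof -
  note meas' [measurable] meas [measurable]
  have "\<forall>\<^sub>F n in sequentially. (\<integral>x. B - \<phi> n x \<partial>\<mu> n) > (\<integral>x. B - \<psi> x \<partial>\<nu>) - e"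
  proof (rule weak_convergence_liminf[where B=B])
    show "\<forall>\<^sub>F n in sequentially. \<forall>x. 0 \<le> B - \<phi> n x \<and> B - \<phi> n x \<le> B"
      using bnd by eventually_elim auto
    show "AE x in \<nu>. \<forall>e>0. \<exists>\<delta>>0. \<forall>\<^sub>F n in sequentially. \<forall>y. dist y x < \<delta> \<longrightarrow> B - \<phi> n y > B - \<psi> x - e"
      using upper by eventually_elim (simp add: algebra_simps)
  qed (use bnd' e in auto)
  then show ?thesis using prob bnd
  proof eventually_elim
    case (elim n)
    interpret mu: prob_space "\<mu> n" by fact
    have "integrable (\<mu> n) (\<phi> n)" "integrable \<nu> \<psi>"
      using elim bnd' by (auto intro!: mu.integrable_const_bound[where B=B] nu.integrable_const_bound[where B=B])
    then show ?case using elim(1) by (simp add: mu.prob_space nu.prob_space)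
  qed
qed

text \<open>An extended continuous mapping theorem: the integrands vary with \<open>n\<close> and
  need not be continuous, only converge continuously at almost every point of the limit law. It is
  meant for integrands that are themselves rescaled exceedance probabilities.\<close>

lemma weak_convergence_tendsto:
  fixes \<phi> :: "nat \<Rightarrow> 'x \<Rightarrow> real"
  assumes meas: "\<And>n. \<phi> n \<in> borel_measurable borel"
    and bnd: "\<forall>\<^sub>F n in sequentially. \<forall>x. 0 \<le> \<phi> n x \<and> \<phi> n x \<le> B"
    and meas': "\<psi> \<in> borel_measurable borel" and bnd': "\<And>x. 0 \<le> \<psi> x \<and> \<psi> x \<le> B"
    and close: "AE x in \<nu>. \<forall>e>0. \<exists>\<delta>>0. \<forall>\<^sub>F n in sequentially. \<forall>y. dist y x < \<delta> \<longrightarrow> \<bar>\<phi> n y - \<psi> x\<bar> < e"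
  shows "(\<lambda>n. \<integral>x. \<phi> n x \<partial>\<mu> n) \<longlonglongrightarrow> (\<integral>x. \<psi> x \<partial>\<nu>)"
proof (rule tendstoI)
  fix e :: real assume e: "e > 0"
  have *: "AE x in \<nu>. \<forall>e>0. \<exists>\<delta>>0. \<forall>\<^sub>F n in sequentially. \<forall>y. dist y x < \<delta> \<longrightarrow> P (\<phi> n y) (\<psi> x) e"
    if P: "\<And>a b e :: real. \<bar>a - b\<bar> < e \<Longrightarrow> P a b e" for P
    using close
  proof (eventually_elim, intro allI impI)
    fix x and e :: real
    assume "\<forall>e>0. \<exists>\<delta>>0. \<forall>\<^sub>F n in sequentially. \<forall>y. dist y x < \<delta> \<longrightarrow> \<bar>\<phi> n y - \<psi> x\<bar> < e" "e > 0"
    then obtain \<delta> where d: "\<delta> > 0" "\<forall>\<^sub>F n in sequentially. \<forall>y. dist y x < \<delta> \<longrightarrow> \<bar>\<phi> n y - \<psi> x\<bar> < e" by blast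
    from d(2) have "\<forall>\<^sub>F n in sequentially. \<forall>y. dist y x < \<delta> \<longrightarrow> P (\<phi> n y) (\<psi> x) e"
      by (rule eventually_mono) (blast intro: P)
    with d(1) show "\<exists>\<delta>>0. \<forall>\<^sub>F n in sequentially. \<forall>y. dist y x < \<delta> \<longrightarrow> P (\<phi> n y) (\<psi> x) e" by blast
  qed
  note liminf = weak_convergence_liminf[OF meas bnd meas' bnd' *[of "\<lambda>a b e. a > b - e"] e]
  note limsup = weak_convergence_limsup[OF meas bnd meas' bnd' *[of "\<lambda>a b e. a < b + e"] e]
  show "\<forall>\<^sub>F n in sequentially. dist (\<integral>x. \<phi> n x \<partial>\<mu> n) (\<integral>x. \<psi> x \<partial>\<nu>) < e"
    using liminf limsup by (rule eventually_elim2) (auto simp: dist_real_def abs_diff_less_iff)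
qed

text \<open>The indicator of an open set is lower semicontinuous, which is the hypothesis of
  \<open>weak_convergence_liminf\<close> for a constant sequence of integrands.\<close>

lemma portmanteau_open:
  assumes U: "open U" and e: "e > 0"
  shows "\<forall>\<^sub>F n in sequentially. measure (\<mu> n) U > measure \<nu> U - e"
proof -
  have [measurable]: "U \<in> sets borel" using U by simp
  have "\<forall>\<^sub>F n in sequentially. (\<integral>x. indicator U x \<partial>\<mu> n) > (\<integral>x. (indicator U x :: real) \<partial>\<nu>) - e"
  proof (rule weak_convergence_liminf[where B=1])
    have "\<exists>\<delta>>0. \<forall>y. dist y x < \<delta> \<longrightarrow> indicator U y > (indicator U x :: real) - e" if "e > 0" for x e
    proof (cases "x \<in> U")
      case True
      then obtain \<delta> where "\<delta> > 0" "\<And>y. dist y x < \<delta> \<Longrightarrow> y \<in> U"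
        using U by (auto simp: open_dist)
      with that True show ?thesis by (intro exI[of _ \<delta>]) auto
    next
      case False
      with that show ?thesis by (intro exI[of _ 1]) (auto simp: indicator_def)
    qed
    then show "AE x in \<nu>. \<forall>e>0. \<exists>\<delta>>0. \<forall>\<^sub>F n in sequentially.
        \<forall>y. dist y x < \<delta> \<longrightarrow> indicator U y > (indicator U x :: real) - e"
      by simp
  qed (use e in \<open>auto simp: indicator_def\<close>)
  then show ?thesis
    using sets sets' by (simp add: sets_eq_imp_space_eq[OF sets] sets_eq_imp_space_eq[OF sets'])
qed

lemma portmanteau_closed:
  assumes C: "closed C" and e: "e > 0"
  shows "\<forall>\<^sub>F n in sequentially. measure (\<mu> n) C < measure \<nu> C + e"
proof -
  have "C \<in> sets borel" using C by simp
  note C' = this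
  have "\<forall>\<^sub>F n in sequentially. measure (\<mu> n) (-C) > measure \<nu> (-C) - e"
    using C by (intro portmanteau_open[OF _ e]) auto
  then show ?thesis using prob
  proof eventually_elim
    case (elim n)
    interpret mu: prob_space "\<mu> n" by fact
    have sp: "space (\<mu> n) = UNIV" "space \<nu> = UNIV"
      using sets_eq_imp_space_eq[OF sets[of n]] sets_eq_imp_space_eq[OF sets'] by auto
    have "measure (\<mu> n) (-C) = 1 - measure (\<mu> n) C" "measure \<nu> (-C) = 1 - measure \<nu> C"
      using mu.prob_compl[of C] nu.prob_compl[of C] C' sets sets' sp by (auto simp: Compl_eq_Diff_UNIV)
    then show ?case using elim by linarith
  qed
qed

end

subsection \<open>Continuous functions on a compact space\<close>

lemma compact_UNIV_dense_sequence:
  assumes "compact (UNIV :: 's::metric_space set)"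
  obtains q :: "nat \<Rightarrow> 's::metric_space" where "\<And>s e. e > 0 \<Longrightarrow> \<exists>n. dist s (q n) < e"
proof -
  have "\<forall>e>0. \<exists>k. finite k \<and> (UNIV :: 's set) \<subseteq> (\<Union>x\<in>k. ball x e)"
    using assms by (simp add: compact_eq_totally_bounded)
  then have "\<exists>k. finite k \<and> (UNIV :: 's set) \<subseteq> (\<Union>x\<in>k. ball x (inverse (real (Suc n))))" for n
    by (meson inverse_positive_iff_positive of_nat_0_less_iff zero_less_Suc)
  then obtain F :: "nat \<Rightarrow> 's set"
    where F: "\<And>n. finite (F n)" "\<And>n. UNIV \<subseteq> (\<Union>x\<in>F n. ball x (inverse (real (Suc n))))"
    by metis
  define T where "T = (\<Union>n. F n)"
  have T: "countable T" using F(1) by (auto simp: T_def intro: countable_finite)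
  show thesis
  proof
    fix s :: 's and e :: real assume "e > 0"
    then obtain n where n: "inverse (real (Suc n)) < e" using reals_Archimedean by blast
    obtain t where "t \<in> F n" "dist t s < inverse (real (Suc n))" using F(2)[of n] by (auto simp: subset_eq)
    with n have t: "t \<in> T" "dist s t < e" by (auto simp: T_def dist_commute)
    then obtain n where "from_nat_into T n = t" using T by (metis from_nat_into_surj)
    with t show "\<exists>n. dist s (from_nat_into T n) < e" by auto
  qed
qed

lemma dense_sequence_finite_net:
  fixes q :: "nat \<Rightarrow> 's::metric_space"
  assumes cpt: "compact (UNIV :: 's set)"
    and q: "\<And>s e. e > 0 \<Longrightarrow> \<exists>n. dist s (q n) < e" and r: "r > 0"
  obtains k where "\<And>s. \<exists>i\<le>k. dist s (q i) < r"
proof -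
  have "UNIV \<subseteq> (\<Union>i\<in>UNIV. ball (q i) r)" using q[OF r] by (auto simp: dist_commute)
  then obtain J where J: "finite J" "UNIV \<subseteq> (\<Union>i\<in>J. ball (q i) r)"
    using compactE_image[OF cpt, of UNIV "\<lambda>i. ball (q i) r"] by auto
  have "\<exists>i\<le>Max J. dist s (q i) < r" for s
  proof -
    from J(2) obtain i where "i \<in> J" "dist (q i) s < r" by (auto simp: subset_eq)
    then show ?thesis using J(1) by (auto simp: dist_commute intro!: exI[of _ i])
  qed
  then show thesis by (rule that)
qed

lemma continuous_imp_bcontfun:
  fixes f :: "'s::metric_space \<Rightarrow> real"
  assumes "compact (UNIV :: 's set)" "continuous_on UNIV f"
  shows "f \<in> bcontfun"
  using assms by (auto simp: bcontfun_def intro: compact_imp_bounded compact_continuous_image)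

lemma isCont_apply_bcontfun: "isCont (apply_bcontfun f) s"
  using continuous_on_apply_bcontfun[of UNIV f] continuous_on_eq_continuous_at[OF open_UNIV] by blast

lemma isCont_dist_greater:
  fixes u :: "'s::metric_space \<Rightarrow> real"
  assumes "isCont u s" "r < u s"
  shows "\<exists>d>0. \<forall>t. dist s t < d \<longrightarrow> r < u t"
proof -
  have "\<forall>\<^sub>F t in nhds s. r < u t"
    using assms by (intro order_tendstoD(1)) (auto simp: isCont_def tendsto_at_iff_tendsto_nhds)
  then show ?thesis by (auto simp: eventually_nhds_metric dist_commute)
qed

lemma bcontfun_abs_le: "\<exists>B. \<forall>s. \<bar>apply_bcontfun (f :: 's::metric_space \<Rightarrow>\<^sub>C real) s\<bar> \<le> B"
  using norm_bounded[of f] by (metis real_norm_def)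

lemma bcontfun_eventually_gt:
  fixes x y :: "'s::metric_space \<Rightarrow>\<^sub>C real"
  assumes "compact K" "\<And>s. s \<in> K \<Longrightarrow> f s < x s" "continuous_on K f"
  shows "\<exists>e>0. \<forall>s\<in>K. x s \<ge> f s + e"
proof (cases "K = {}")
  case False
  have "continuous_on K (\<lambda>s. x s - f s)" by (intro continuous_on_diff continuous_on_apply_bcontfun assms)
  then obtain t where t: "t \<in> K" "\<And>s. s \<in> K \<Longrightarrow> x t - f t \<le> x s - f s"
    using continuous_attains_inf[OF assms(1) False] by blast
  show ?thesis
  proof (intro exI conjI ballI)
    show "x t - f t > 0" using t(1) assms(2)[of t] by simp
    show "x s \<ge> f s + (x t - f t)" if "s \<in> K" for s using t(2)[OF that] by linarith
  qed
qed (auto intro: exI[of _ 1])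

text \<open>Upper envelopes of finitely many downward cones with rational heights and integer slope
  suffice. Centred at a fine net, with tips just below the graph of \<open>f\<close>, steep cones
  stay below \<open>f\<close> up to a small error, while the cone of a nearby centre almost reaches
  \<open>f\<close>.\<close>

lemma separable_bcontfun:
  assumes cpt: "compact (UNIV :: 's::metric_space set)"
  obtains D :: "('s::metric_space \<Rightarrow>\<^sub>C real) set"
  where "countable D" "\<And>f e. e > 0 \<Longrightarrow> \<exists>g\<in>D. dist f g < e"
proof -
  obtain q :: "nat \<Rightarrow> 's" where q: "\<And>s e. e > 0 \<Longrightarrow> \<exists>n. dist s (q n) < e"
    using compact_UNIV_dense_sequence[OF cpt] by blast
  define w where "w m v s = (MAX i\<in>{..<length v}. real_of_rat (v ! i) - real m * dist s (q i))"
    for m :: nat and v :: "rat list" and s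
  have wc: "Bcontfun (w m v) s = w m v s" if "v \<noteq> []" for m v s
  proof -
    have "continuous_on UNIV (w m v)"
      unfolding w_def[abs_def] using that by (intro continuous_on_MAX continuous_intros) auto
    then show ?thesis using continuous_imp_bcontfun[OF cpt] by (simp add: Bcontfun_inverse)
  qed
  define D where "D = range (\<lambda>(m, v). Bcontfun (w m v))"
  show thesis
  proof
    show "countable D" by (simp add: D_def)
    fix f :: "'s \<Rightarrow>\<^sub>C real" and e :: real assume e: "e > 0"
    obtain B where B: "\<And>s. \<bar>f s\<bar> \<le> B" using bcontfun_abs_le[of f] by blast
    have "uniformly_continuous_on UNIV (apply_bcontfun f)"
      by (rule compact_uniformly_continuous[OF _ cpt]) simp
    moreover have "e/4 > 0" using e by simp
    ultimately obtain \<delta> where "\<delta> > 0" "\<forall>x\<in>UNIV. \<forall>x'\<in>UNIV. dist x' x < \<delta> \<longrightarrow> dist (f x') (f x) < e/4"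
      unfolding uniformly_continuous_on_def by blast
    then have \<delta>: "\<delta> > 0" "\<And>s t. dist s t < \<delta> \<Longrightarrow> \<bar>f s - f t\<bar> < e/4"
      by (auto simp: dist_real_def)
    \<comment> \<open>The slope is such that at distance \<delta> a cone has dropped by
      \<open>2 * B\<close>, the largest possible oscillation of \<open>f\<close>.\<close>
    obtain m :: nat where "real m > 2 * B / \<delta>" using reals_Archimedean2 by blast
    then have m: "real m * \<delta> \<ge> 2 * B" using \<delta> by (simp add: field_simps)
    \<comment> \<open>Within \<open>r\<close> of its centre a cone loses at most \<open>e/4\<close>,
      and \<open>f\<close> varies by less than \<open>e/4\<close>.\<close>
    define r where "r = min \<delta> (e / (4 * (real m + 1)))"
    have r: "r > 0" using \<delta> e by (auto simp: r_def)
    obtain k where k: "\<And>s. \<exists>i\<le>k. dist s (q i) < r"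
      using dense_sequence_finite_net[OF cpt q r] by blast
    have "\<exists>u::rat. f (q i) - e/4 < of_rat u \<and> of_rat u < f (q i)" for i
      using of_rat_dense[of "f (q i) - e/4" "f (q i)"] e by simp
    then obtain u :: "nat \<Rightarrow> rat" where u: "\<And>i. f (q i) - e/4 < of_rat (u i)" "\<And>i. of_rat (u i) < f (q i)"
      by metis
    define v where "v = map u [0..<Suc k]"
    have v: "length v = Suc k" "v \<noteq> []" "\<And>i. i \<le> k \<Longrightarrow> v ! i = u i" by (auto simp: v_def simp del: upt_Suc)
    have "\<bar>f s - w m v s\<bar> \<le> 3 * e/4" for s
    proof -
      have "w m v s \<le> f s + e/4"
        unfolding w_def
      proof (rule Max.boundedI; clarsimp simp: v(1) lessThan_empty_iff)
        fix i assume i: "i < Suc k"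
        show "real_of_rat (v ! i) - real m * dist s (q i) \<le> f s + e/4"
        proof (cases "dist s (q i) < \<delta>")
          case True
          have "0 \<le> real m * dist s (q i)" by simp
          moreover have "f (q i) < f s + e/4" using \<delta>(2)[OF True] by linarith
          moreover have "real_of_rat (v ! i) = real_of_rat (u i)" using v(3) i by simp
          ultimately show ?thesis using u(2)[of i] by linarith
        next
          case False
          then have "real m * \<delta> \<le> real m * dist s (q i)" by (intro mult_left_mono) auto
          then show ?thesis
            using m u(2)[of i] v(3)[of i] i B[of "q i"] B[of s] e by (simp add: abs_le_iff)
        qed
      qed
      moreover have "w m v s \<ge> f s - 3 * e/4"
      proof -
        obtain i where i: "i \<le> k" "dist s (q i) < r" using k by blast
        have "real m * dist s (q i) \<le> real m * (e / (4 * (real m + 1)))"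
          using i by (intro mult_left_mono) (auto simp: r_def)
        also have "\<dots> \<le> e/4" using e by (simp add: field_simps)
        finally have "real m * dist s (q i) \<le> e/4" .
        moreover have "\<bar>f s - f (q i)\<bar> < e/4" using i by (intro \<delta>(2)) (auto simp: r_def)
        moreover have "real_of_rat (v ! i) = real_of_rat (u i)" using v(3) i by simp
        ultimately have "f s - 3 * e/4 \<le> real_of_rat (v ! i) - real m * dist s (q i)"
          using u(1)[of i] by linarith
        also have "\<dots> \<le> w m v s" unfolding w_def using i v by (intro Max_ge) auto
        finally show ?thesis .
      qed
      ultimately show ?thesis using e by linarith
    qed
    then have "dist f (Bcontfun (w m v)) \<le> 3 * e/4"
      by (intro dist_bound) (simp add: dist_real_def wc v)
    then show "\<exists>g\<in>D. dist f g < e"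
      using e by (intro bexI[of _ "Bcontfun (w m v)"]) (auto simp: D_def)
  qed
qed

text \<open>By separability an open set is a countable union of closed balls, and a closed ball of
  the sup-norm is cut out by countably many coordinates, those at a dense sequence.\<close>

lemma measurable_bcontfunI:
  fixes f :: "'a \<Rightarrow> 's::metric_space \<Rightarrow>\<^sub>C real"
  assumes cpt: "compact (UNIV :: 's set)" and f: "\<And>s. (\<lambda>\<omega>. f \<omega> s) \<in> borel_measurable M"
  shows "f \<in> borel_measurable M"
proof (rule borel_measurableI)
  fix U :: "('s \<Rightarrow>\<^sub>C real) set" assume U: "open U"
  obtain D :: "('s \<Rightarrow>\<^sub>C real) set" where D: "countable D" "\<And>f e. e > 0 \<Longrightarrow> \<exists>g\<in>D. dist f g < e"
    using separable_bcontfun[OF cpt] by blast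
  obtain q :: "nat \<Rightarrow> 's" where q: "\<And>s e. e > 0 \<Longrightarrow> \<exists>n. dist s (q n) < e"
    using compact_UNIV_dense_sequence[OF cpt] by blast
  define J where "J = {(g, n) \<in> D \<times> (UNIV :: nat set). cball g (inverse (Suc n)) \<subseteq> U}"
  have "countable J" 
    by (rule countable_subset[of _ "D \<times> UNIV"]) (use D(1) in \<open>auto simp: J_def\<close>)
  have Ueq: "U = (\<Union>(g,n)\<in>J. cball g (inverse (Suc n)))"
  proof safe
    fix x assume "x \<in> U"
    then obtain e where e: "e > 0" "ball x e \<subseteq> U" using U by (meson openE)
    obtain n where n: "inverse (real (Suc n)) < e/2"
      using reals_Archimedean[of "e/2"] e by auto
    obtain g where g: "g \<in> D" "dist x g < inverse (real (Suc n))"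
      using D(2)[of "inverse (real (Suc n))" x] by auto
    have "cball g (inverse (real (Suc n))) \<subseteq> ball x e"
    proof
      fix y assume "y \<in> cball g (inverse (real (Suc n)))"
      then show "y \<in> ball x e"
        using g(2) n dist_triangle[of x y g] by (simp del: of_nat_Suc)
    qed
    then have "(g, n) \<in> J" using g(1) e(2) by (auto simp: J_def)
    moreover have "x \<in> cball g (inverse (real (Suc n)))" using g(2) by (simp add: dist_commute)
    ultimately show "x \<in> (\<Union>(g,n)\<in>J. cball g (inverse (Suc n)))" by blast
  next
    fix x g n assume "(g, n) \<in> J" "x \<in> cball g (inverse (real (Suc n)))"
    then show "x \<in> U" unfolding J_def by blast
  qed
  have cb: "f -` cball g r \<inter> space M = {\<omega>\<in>space M. \<forall>n. \<bar>g (q n) - f \<omega> (q n)\<bar> \<le> r}" for g r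
  proof safe
    fix \<omega> n assume "f \<omega> \<in> cball g r"
    then show "\<bar>g (q n) - f \<omega> (q n)\<bar> \<le> r"
      using dist_bounded[of g "q n" "f \<omega>"] by (simp add: dist_real_def)
  next
    fix \<omega> assume *: "\<forall>n. \<bar>g (q n) - f \<omega> (q n)\<bar> \<le> r"
    have "\<bar>g s - f \<omega> s\<bar> \<le> r" for s
    proof (rule ccontr)
      assume "\<not> ?thesis"
      moreover have "isCont (\<lambda>s. \<bar>g s - f \<omega> s\<bar>) s"
        by (intro continuous_intros isCont_apply_bcontfun)
      ultimately have "\<exists>e>0. \<forall>t. dist s t < e \<longrightarrow> r < \<bar>g t - f \<omega> t\<bar>"
        by (intro isCont_dist_greater) (auto simp: not_le)
      then obtain e where "e > 0" "\<And>t. dist s t < e \<Longrightarrow> r < \<bar>g t - f \<omega> t\<bar>" by blast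
      with q[of e s] * show False by (meson not_less)
    qed
    then show "\<omega> \<in> f -` cball g r" by (auto simp: dist_real_def intro!: dist_bound)
  qed
  have "f -` U \<inter> space M = (\<Union>(g,n)\<in>J. f -` cball g (inverse (Suc n)) \<inter> space M)"
    by (subst Ueq) auto
  also have "\<dots> \<in> sets M"
    unfolding cb using f by (intro sets.countable_UN'' \<open>countable J\<close>) (auto simp del: of_nat_Suc)
  finally show "f -` U \<inter> space M \<in> sets M" .
qed

section \<open>Evaluations and exceedance sets in C(S)\<close>

lemma continuous_on_eval_bcontfun: "continuous_on A (\<lambda>x :: 's::metric_space \<Rightarrow>\<^sub>C real. apply_bcontfun x s)"
proof -
  have "1-lipschitz_on A (\<lambda>x :: 's \<Rightarrow>\<^sub>C real. apply_bcontfun x s)"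
    by (rule lipschitz_onI) (auto simp: dist_bounded)
  then show ?thesis by (rule lipschitz_on_continuous_on)
qed

lemma borel_measurable_apply_bcontfun [measurable]:
  "(\<lambda>x :: 's::metric_space \<Rightarrow>\<^sub>C real. apply_bcontfun x s) \<in> borel_measurable borel"
  by (rule borel_measurable_continuous_onI) (rule continuous_on_eval_bcontfun)

lemma open_bcontfun_greater:
  fixes f :: "'s::metric_space \<Rightarrow> real"
  assumes "compact K" "continuous_on K f"
  shows "open {x :: 's \<Rightarrow>\<^sub>C real. \<forall>s\<in>K. f s < x s}"
proof (unfold open_dist, safe)
  fix x :: "'s \<Rightarrow>\<^sub>C real" assume "\<forall>s\<in>K. f s < x s"
  then obtain e where e: "e > 0" "\<And>s. s \<in> K \<Longrightarrow> x s \<ge> f s + e"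
    using bcontfun_eventually_gt[OF assms(1) _ assms(2), of x] by auto
  have "f s < y s" if "dist y x < e" "s \<in> K" for y :: "'s \<Rightarrow>\<^sub>C real" and s
    using e(2)[OF that(2)] dist_bounded[of y s x] that(1) by (auto simp: dist_real_def abs_less_iff)
  then show "\<exists>e>0. \<forall>y. dist y x < e \<longrightarrow> y \<in> {x :: 's \<Rightarrow>\<^sub>C real. \<forall>s\<in>K. f s < x s}" using e(1) by blast
qed

lemma open_bcontfun_less:
  fixes f :: "'s::metric_space \<Rightarrow> real"
  assumes "compact K" "continuous_on K f"
  shows "open {x :: 's \<Rightarrow>\<^sub>C real. \<forall>s\<in>K. x s < f s}"
proof -
  have "open (uminus -` {x :: 's \<Rightarrow>\<^sub>C real. \<forall>s\<in>K. - f s < x s})"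
    using assms by (intro open_vimage open_bcontfun_greater continuous_intros)
  also have "uminus -` {x :: 's \<Rightarrow>\<^sub>C real. \<forall>s\<in>K. - f s < x s} = {x. \<forall>s\<in>K. apply_bcontfun x s < f s}"
    by (auto simp: uminus_bcontfun.rep_eq)
  finally show ?thesis .
qed

text \<open>For discontinuous \<open>f\<close> this set need not be open. Away from the finite set
  of discontinuities S is exhausted by countably many compact sets on which \<open>f\<close> is
  continuous; each of them contributes an open condition, and each discontinuity a single
  evaluation.\<close>

lemma sets_bcontfun_greater:
  fixes f :: "'s::metric_space \<Rightarrow> real"
  assumes cpt: "compact (UNIV :: 's set)" and fin: "finite {s. \<not> isCont f s}"
  shows "{x :: 's \<Rightarrow>\<^sub>C real. \<forall>s. f s < x s} \<in> sets borel"
proof -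
  define D where "D = {s. \<not> isCont f s}"
  \<comment> \<open>The guard is needed because \<open>infdist\<close> to the empty set is 0; for
    continuous \<open>f\<close> each \<open>K m\<close> is all of S.\<close>
  define K where "K m = {s. D \<noteq> {} \<longrightarrow> infdist s D \<ge> inverse (real (Suc m))}" for m
  have DK: "s \<in> D \<or> (\<exists>m. s \<in> K m)" for s
  proof (cases "D = {} \<or> s \<in> D")
    case False
    then have "infdist s D > 0"
      using fin by (auto simp: D_def finite_imp_closed intro: infdist_pos_not_in_closed)
    then obtain m where "inverse (real (Suc m)) < infdist s D" using reals_Archimedean by blast
    then show ?thesis by (auto simp: K_def intro: less_imp_le)
  qed (auto simp: K_def)
  have KD: "K m \<inter> D = {}" for m by (auto simp: K_def)
  have "closed (K m)" for m
    unfolding K_def by (cases "D = {}") (auto intro!: closed_Collect_le continuous_intros)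
  then have "compact (K m)" for m
    using compact_Int_closed[OF cpt, of "K m"] by simp
  moreover have "continuous_on (K m) f" for m
    using KD[of m] by (auto simp: D_def intro!: continuous_at_imp_continuous_on)
  ultimately have "open {x :: 's \<Rightarrow>\<^sub>C real. \<forall>s\<in>K m. f s < x s}" for m
    by (rule open_bcontfun_greater)
  then have [measurable]: "{x :: 's \<Rightarrow>\<^sub>C real. \<forall>s\<in>K m. f s < x s} \<in> sets borel" for m by simp
  have [simp]: "finite D" using fin by (simp add: D_def)
  have "{x :: 's \<Rightarrow>\<^sub>C real. \<forall>s. f s < x s} =
      {x \<in> space (borel :: ('s \<Rightarrow>\<^sub>C real) measure). \<forall>s\<in>D. f s < x s} \<inter> (\<Inter>m. {x :: 's \<Rightarrow>\<^sub>C real. \<forall>s\<in>K m. f s < x s})"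
    using DK by (force simp: set_eq_iff)
  also have "\<dots> \<in> sets borel" by measurable
  finally show ?thesis .
qed

text \<open>The discontinuities in \<open>D\<close> belong to every finite set, since the values of
  \<open>u\<close> there cannot be approached along the dense sequence.\<close>

lemma Min_dense_tendsto_INF:
  fixes u :: "'s::metric_space \<Rightarrow> real" and q :: "nat \<Rightarrow> 's"
  assumes q: "\<And>s e. e > 0 \<Longrightarrow> \<exists>n. dist s (q n) < e"
    and bb: "bdd_below (range u)" and D: "finite D" "\<And>s. s \<notin> D \<Longrightarrow> isCont u s"
  shows "(\<lambda>k. MIN s\<in>D \<union> q ` {..k}. u s) \<longlonglongrightarrow> (INF s. u s)"
proof (rule LIMSEQ_I)
  fix e :: real assume e: "e > 0"
  obtain s where s: "u s < (INF s. u s) + e"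
    using cINF_less_iff[of UNIV u "(INF s. u s) + e"] bb e by auto
  obtain j where j: "\<exists>t\<in>D \<union> {q j}. u t < (INF s. u s) + e"
  proof (cases "s \<in> D")
    case False
    then have "isCont (\<lambda>t. - u t) s" using D(2) by (intro continuous_intros)
    then have "\<exists>e'>0. \<forall>t. dist s t < e' \<longrightarrow> - ((INF s. u s) + e) < - u t"
      by (rule isCont_dist_greater) (use s in linarith)
    then obtain e' where "e' > 0" "\<And>t. dist s t < e' \<Longrightarrow> - ((INF s. u s) + e) < - u t" by blast
    then show ?thesis using q[of e' s] that by (meson UnI2 neg_less_iff_less singletonI)
  qed (use s that in auto)
  have "norm ((MIN s\<in>D \<union> q ` {..k}. u s) - (INF s. u s)) < e" if "k \<ge> j" for k
  proof -
    have "(MIN s\<in>D \<union> q ` {..k}. u s) < (INF s. u s) + e"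
      using j that D(1) by (subst Min_less_iff) auto
    moreover have "(INF s. u s) \<le> (MIN s\<in>D \<union> q ` {..k}. u s)"
      using bb D(1) by (subst Min_ge_iff) (auto intro: cINF_lower)
    ultimately show ?thesis by simp
  qed
  then show "\<exists>no. \<forall>k\<ge>no. norm ((MIN s\<in>D \<union> q ` {..k}. u s) - (INF s. u s)) < e" by blast
qed

lemma measurable_normalized_max:
  fixes a b :: "'s::metric_space \<Rightarrow>\<^sub>C real"
  assumes cpt: "compact (UNIV :: 's set)" and "n \<ge> 1" "a \<in> Cpos"
    and x: "\<And>i. i \<in> {1..n} \<Longrightarrow> x i \<in> borel_measurable M"
  shows "(\<lambda>\<omega>. normalized_max n a b (\<lambda>i. x i \<omega>)) \<in> borel_measurable M"
proof (rule measurable_bcontfunI[OF cpt])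
  fix s
  have [measurable]: "(\<lambda>\<omega>. x i \<omega> s) \<in> borel_measurable M" if "i \<in> {1..n}" for i
    using measurable_compose[OF x[OF that] borel_measurable_apply_bcontfun] .
  show "(\<lambda>\<omega>. normalized_max n a b (\<lambda>i. x i \<omega>) s) \<in> borel_measurable M"
    unfolding apply_normalized_max[OF assms(1-3)] by measurable
qed

subsection \<open>The limit process and its margins\<close>

lemma isCont_finite_support:
  fixes v :: "'s::t2_space \<Rightarrow> real"
  assumes "finite A" "s \<notin> A"
  shows "isCont (\<lambda>s. if s \<in> A then v s else 0) s"
proof -
  have "open (- A)" using assms finite_imp_closed[of A] by auto
  then have "\<forall>\<^sub>F t in nhds s. (if t \<in> A then v t else 0) = 0"
    using assms by (intro eventually_nhds[THEN iffD2] exI[of _ "-A"]) auto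
  then show ?thesis
    by (subst isCont_cong[where g = "\<lambda>_. 0"]) auto
qed

text \<open>Points outside \<open>A\<close> contribute 0, which is harmless because all other terms
  are nonnegative. This turns the D-norm of a finitely supported function into a maximum over
  finitely many coordinates of the generator.\<close>

lemma Sup_finite_support:
  fixes v z :: "'s \<Rightarrow> real"
  assumes A: "finite A" "A \<noteq> {}" and "\<And>s. s \<in> A \<Longrightarrow> v s \<ge> 0" and "\<And>s. z s \<ge> 0"
  shows "(SUP s. \<bar>if s \<in> A then - v s else 0\<bar> * z s) = (MAX s\<in>A. v s * z s)"
proof (rule cSup_eq_maximum)
  have "(MAX s\<in>A. v s * z s) \<in> (\<lambda>s. v s * z s) ` A" using A by (intro Max_in) auto
  then obtain s where s: "s \<in> A" "(MAX s\<in>A. v s * z s) = v s * z s" by blast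
  then show "(MAX s\<in>A. v s * z s) \<in> range (\<lambda>s. \<bar>if s \<in> A then - v s else 0\<bar> * z s)"
    using assms(3) by (intro image_eqI[of _ _ s]) auto
  have "0 \<le> (MAX s\<in>A. v s * z s)" using s assms by simp
  moreover have "v s * z s \<le> (MAX s\<in>A. v s * z s)" if "s \<in> A" for s
    using A that by (intro Max_ge) auto
  ultimately have "\<bar>if s \<in> A then - v s else 0\<bar> * z s \<le> (MAX s\<in>A. v s * z s)" for s
    using assms(3)[of s] by (cases "s \<in> A") auto
  then show "y \<le> (MAX s\<in>A. v s * z s)" if "y \<in> range (\<lambda>s. \<bar>if s \<in> A then - v s else 0\<bar> * z s)" for y
    using that by blast
qed

text \<open>From \<open>1 - p \<le> - ln p\<close> and \<open>p * (- ln p) \<le> 1 - p\<close> the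
  sequence is squeezed between \<open>p n * (- ln (p n ^ n))\<close> and
  \<open>- ln (p n ^ n)\<close>. The upper bound divided by \<open>n\<close> already gives
  \<open>p n\<close> tending to 1, so both sides have the limit \<open>l\<close>.\<close>

lemma power_tendsto_exp_imp:
  fixes p :: "nat \<Rightarrow> real"
  assumes p: "\<And>n. 0 \<le> p n" "\<And>n. p n \<le> 1" and lim: "(\<lambda>n. p n ^ n) \<longlonglongrightarrow> exp (- l)"
  shows "(\<lambda>n. real n * (1 - p n)) \<longlonglongrightarrow> l"
proof -
  define a where "a n = real n * (1 - p n)" for n
  have a0: "a n \<ge> 0" for n using p by (simp add: a_def)
  have lnlim: "(\<lambda>n. - ln (p n ^ n)) \<longlonglongrightarrow> l"
    using tendsto_minus[OF tendsto_ln[OF lim]] by simp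
  have pos: "\<forall>\<^sub>F n in sequentially. p n ^ n > 0 \<and> n > 0"
    using order_tendstoD(1)[OF lim, of 0] eventually_gt_at_top[of 0] by (intro eventually_conj) auto
  have upper: "\<forall>\<^sub>F n in sequentially. a n \<le> - ln (p n ^ n)"
    using pos
  proof eventually_elim
    case (elim n)
    then have "p n \<noteq> 0" by (metis less_irrefl power_eq_0_iff)
    then have pn: "p n > 0" using p(1)[of n] by linarith
    have "ln (p n) \<le> p n - 1" using pn by (rule ln_le_minus_one)
    then have "real n * ln (p n) \<le> real n * (p n - 1)" by (rule mult_left_mono) simp
    then show ?case using pn by (simp add: a_def ln_realpow algebra_simps)
  qed
  have "(\<lambda>n. (- ln (p n ^ n)) * inverse (real n)) \<longlonglongrightarrow> l * 0"
    by (intro tendsto_mult lnlim tendsto_inverse_0_at_top filterlim_real_sequentially)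
  then have lim0: "(\<lambda>n. (- ln (p n ^ n)) * inverse (real n)) \<longlonglongrightarrow> 0" by simp
  have "(\<lambda>n. 1 - p n) \<longlonglongrightarrow> 0"
  proof (rule tendsto_sandwich[OF _ _ tendsto_const lim0])
    show "\<forall>\<^sub>F n in sequentially. 1 - p n \<le> (- ln (p n ^ n)) * inverse (real n)"
      using upper pos
    proof eventually_elim
      case (elim n)
      then have "a n * inverse (real n) \<le> - ln (p n ^ n) * inverse (real n)"
        by (intro mult_right_mono) auto
      moreover have "a n * inverse (real n) = 1 - p n"
        using elim by (simp add: a_def field_simps)
      ultimately show ?case by simp
    qed
  qed (use p in auto)
  then have p1: "p \<longlonglongrightarrow> 1" using tendsto_diff[OF tendsto_const[of 1], of "\<lambda>n. 1 - p n" 0] by simp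
  have lower: "\<forall>\<^sub>F n in sequentially. p n * (- ln (p n ^ n)) \<le> a n"
    using pos
  proof eventually_elim
    case (elim n)
    then have "p n \<noteq> 0" by (metis less_irrefl power_eq_0_iff)
    then have pn: "p n > 0" using p(1)[of n] by linarith
    have "ln (inverse (p n)) \<le> inverse (p n) - 1" using pn by (intro ln_le_minus_one) simp
    then have "p n * (- ln (p n)) \<le> p n * (inverse (p n) - 1)"
      using pn by (intro mult_left_mono) (auto simp: ln_inverse)
    also have "\<dots> = 1 - p n" using pn by (simp add: field_simps)
    finally have "real n * (p n * (- ln (p n))) \<le> real n * (1 - p n)"
      by (rule mult_left_mono) simp
    then show ?case using pn by (simp add: a_def ln_realpow algebra_simps)
  qed
  have "a \<longlonglongrightarrow> l"
  proof (rule tendsto_sandwich[OF lower upper])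
    show "(\<lambda>n. p n * (- ln (p n ^ n))) \<longlonglongrightarrow> l"
      using tendsto_mult[OF p1 lnlim] by simp
  qed (rule lnlim)
  then show ?thesis by (simp add: a_def[abs_def])
qed

lemma apply_normalized_max_single:
  fixes a b :: "'s::metric_space \<Rightarrow>\<^sub>C real"
  assumes "compact (UNIV :: 's set)" "a \<in> Cpos"
  shows "normalized_max 1 a b (\<lambda>_. x) s = (x s - b s) / a s"
  using apply_normalized_max[OF assms(1) _ assms(2), of 1 b "\<lambda>_. x" s] by simp

locale record_setting =
  fixes N :: "'b measure" and \<theta> :: "'b \<Rightarrow> 's::metric_space \<Rightarrow>\<^sub>C real"
    and M :: "'a measure" and Xs :: "nat \<Rightarrow> 'a \<Rightarrow> 's \<Rightarrow>\<^sub>C real"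
    and \<mu> :: "('s \<Rightarrow>\<^sub>C real) measure"
    and K :: "'k measure" and Z :: "'k \<Rightarrow> 's \<Rightarrow>\<^sub>C real"
    and c d :: "nat \<Rightarrow> 's \<Rightarrow>\<^sub>C real"
    and G :: "'s \<Rightarrow> real \<Rightarrow> real"
  assumes cpt: "compact (UNIV :: 's set)"
    and theta: "path_process N \<theta>"
    and G_def: "G = margin_cdf N \<theta>"
    and prob_M: "prob_space M"
    and indep: "prob_space.indep_vars M (\<lambda>_. borel) Xs {1..}"
    and ident: "\<And>i. i \<ge> 1 \<Longrightarrow> distr M borel (Xs i) = \<mu>"
    and c_Cpos: "\<And>n. n \<ge> 1 \<Longrightarrow> c n \<in> Cpos"
    and weak: "weakly_convergent_to (\<lambda>n. normalized_max_law \<mu> n (c n) (d n)) (distr N borel \<theta>)"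
    and gen: "generator_of K Z N (\<lambda>\<omega>. log_margin G (\<theta> \<omega>))"
begin

sublocale N: prob_space N using theta by (simp add: path_process_def)
sublocale M: prob_space M by (rule prob_M)
sublocale K: prob_space K using gen by (simp add: generator_of_def generator_def path_process_def)

lemma theta_measurable [measurable]: "\<theta> \<in> borel_measurable N"
  using theta by (simp add: path_process_def)

lemma theta_vimage_sets: "A \<in> sets borel \<Longrightarrow> {\<omega>\<in>space N. \<theta> \<omega> \<in> A} \<in> sets N"
  using measurable_sets[OF theta_measurable, of A] by (simp add: vimage_def Int_def conj_commute)

lemma Z_measurable [measurable]: "Z \<in> borel_measurable K"
  using gen by (simp add: generator_of_def generator_def path_process_def)

lemma Xs_measurable: "i \<ge> 1 \<Longrightarrow> Xs i \<in> borel_measurable M"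
  using indep by (simp add: M.indep_vars_def)

lemma eval_measurable [measurable]:
  "(\<lambda>\<omega>. \<theta> \<omega> s) \<in> borel_measurable N" "(\<lambda>\<omega>. Z \<omega> s) \<in> borel_measurable K"
  using measurable_compose[OF theta_measurable borel_measurable_apply_bcontfun]
    measurable_compose[OF Z_measurable borel_measurable_apply_bcontfun] by auto

lemma sets_mu [measurable_cong, simp]: "sets \<mu> = sets borel"
  using ident[of 1] by auto

lemma space_mu [simp]: "space \<mu> = UNIV"
  using sets_eq_imp_space_eq[OF sets_mu] by simp

sublocale mu: prob_space \<mu>
  using M.prob_space_distr[OF Xs_measurable[of 1]] ident[of 1] by simp

lemma c_pos: "n \<ge> 1 \<Longrightarrow> c n s > 0"
  using c_Cpos[of n] by (auto simp: Cpos_def)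

text \<open>The functions on which \<open>\<psi>\<close> is the true logarithm. Elsewhere
  \<open>ln 0 = 0\<close> stands in for minus infinity, and the monotonicity of
  \<open>\<psi>\<close> breaks down.\<close>

definition good :: "('s \<Rightarrow>\<^sub>C real) \<Rightarrow> bool" where "good h \<longleftrightarrow> (\<forall>s. G s (h s) > 0)"

definition wt :: "('s \<Rightarrow> real) \<Rightarrow> 's \<Rightarrow> real" where "wt h s = - ln (G s (h s))"

definition nrm :: "nat \<Rightarrow> ('s \<Rightarrow>\<^sub>C real) \<Rightarrow> 's \<Rightarrow> real" where "nrm n x s = (x s - d n s) / c n s"

definition Zsup :: "'k \<Rightarrow> real" where "Zsup \<omega> = (SUP s. Z \<omega> s)"

lemma nrm_measurable [measurable]: "(\<lambda>x. nrm n x s) \<in> borel_measurable borel"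
  unfolding nrm_def by measurable

section \<open>Margins, weights and the standard max-stable process\<close>

lemma G_eq: "G s x = measure N {\<omega>\<in>space N. \<theta> \<omega> s \<le> x}"
  unfolding G_def margin_cdf_def cdf_def2
  by (subst measure_distr) (auto intro!: arg_cong[where f="measure N"])

lemma G_nonneg: "G s x \<ge> 0" and G_le_1: "G s x \<le> 1"
  by (auto simp: G_eq)

lemma G_mono: "x \<le> y \<Longrightarrow> G s x \<le> G s y"
  unfolding G_eq by (intro N.finite_measure_mono) auto

lemma wt_nonneg: "wt h s \<ge> 0"
  using G_le_1[of s "h s"] G_nonneg[of s "h s"] by (cases "G s (h s) = 0") (auto simp: wt_def)

lemma wt_antimono: "G s (h s) > 0 \<Longrightarrow> h s \<le> h' s \<Longrightarrow> wt h' s \<le> wt h s"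
  using G_mono[of "h s" "h' s" s] by (auto simp: wt_def)

lemma Z_nonneg: "\<omega> \<in> space K \<Longrightarrow> Z \<omega> s \<ge> 0"
  using gen by (auto simp: generator_of_def generator_def Cnonneg_def)

lemma Zsup_integrable: "integrable K Zsup"
  using gen by (simp add: generator_of_def generator_def Zsup_def[abs_def])

lemma Zsup_upper: "Z \<omega> s \<le> Zsup \<omega>"
proof -
  obtain B where "\<And>s. \<bar>Z \<omega> s\<bar> \<le> B" using bcontfun_abs_le[of "Z \<omega>"] by blast
  then show ?thesis unfolding Zsup_def by (intro cSUP_upper bdd_aboveI2[of _ _ B]) (auto simp: abs_le_iff)
qed

lemma Zsup_nonneg: "\<omega> \<in> space K \<Longrightarrow> Zsup \<omega> \<ge> 0"
  using Z_nonneg Zsup_upper order_trans by blast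

lemma Z_integrable: "integrable K (\<lambda>\<omega>. Z \<omega> s)" and Z_expectation: "(\<integral>\<omega>. Z \<omega> s \<partial>K) = 1"
  using gen by (auto simp: generator_of_def generator_def has_bochner_integral_iff)

lemma eta_le:
  assumes "f \<in> Enonpos"
  shows "{\<omega>\<in>space N. \<forall>s. log_margin G (\<theta> \<omega>) s \<le> f s} \<in> sets N"
    and "measure N {\<omega>\<in>space N. \<forall>s. log_margin G (\<theta> \<omega>) s \<le> f s} = exp (- D_norm K Z f)"
proof -
  show eq: "measure N {\<omega>\<in>space N. \<forall>s. log_margin G (\<theta> \<omega>) s \<le> f s} = exp (- D_norm K Z f)"
    using gen assms by (simp add: generator_of_def)
  \<comment> \<open>A nonmeasurable set has \<open>measure\<close> 0 by convention, but the
    exponential is positive. So the event is measurable in spite of the uncountable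
    quantifier.\<close>
  show "{\<omega>\<in>space N. \<forall>s. log_margin G (\<theta> \<omega>) s \<le> f s} \<in> sets N"
    by (rule ccontr) (use eq measure_notin_sets in force)
qed

lemma D_norm_const:
  assumes "e > 0"
  shows "D_norm K Z (\<lambda>_. - e) = e * integral\<^sup>L K Zsup"
proof -
  have "(SUP s. \<bar>- e\<bar> * Z \<omega> s) = e * Zsup \<omega>" for \<omega>
  proof (rule antisym)
    show "(SUP s. \<bar>- e\<bar> * Z \<omega> s) \<le> e * Zsup \<omega>"
      using assms Zsup_upper by (auto intro!: cSUP_least mult_left_mono)
    have "bdd_above (range (\<lambda>s. e * Z \<omega> s))"
      using assms Zsup_upper by (intro bdd_aboveI2[of _ _ "e * Zsup \<omega>"]) auto
    then have "Z \<omega> s \<le> (SUP s. e * Z \<omega> s) / e" for s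
      using cSUP_upper[of s UNIV "\<lambda>s. e * Z \<omega> s"] assms by (simp add: field_simps)
    then have "Zsup \<omega> \<le> (SUP s. e * Z \<omega> s) / e"
      unfolding Zsup_def by (intro cSUP_least) auto
    then show "e * Zsup \<omega> \<le> (SUP s. \<bar>- e\<bar> * Z \<omega> s)"
      using assms by (simp add: field_simps)
  qed
  then show ?thesis by (simp add: D_norm_def)
qed

lemma const_Enonpos: "e \<ge> 0 \<Longrightarrow> (\<lambda>_. - e) \<in> Enonpos"
  by (auto simp: Enonpos_def Efun_def)

text \<open>The probability that \<open>\<eta> \<le> - e\<close> on all of S is
  \<open>exp (- e * E(sup Z))\<close>, which tends to 1 as \<open>e\<close> tends to 0.\<close>

lemma AE_eta_less: "AE \<omega> in N. \<exists>e>0. \<forall>s. log_margin G (\<theta> \<omega>) s \<le> - e"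
proof -
  define E where "E k = {\<omega>\<in>space N. \<forall>s. log_margin G (\<theta> \<omega>) s \<le> - inverse (real (Suc k))}" for k
  have E: "E k \<in> sets N" "measure N (E k) = exp (- (inverse (real (Suc k)) * integral\<^sup>L K Zsup))" for k
    using eta_le[OF const_Enonpos[of "inverse (real (Suc k))"]] D_norm_const[of "inverse (real (Suc k))"]
    by (auto simp: E_def simp del: of_nat_Suc)
  have "(\<lambda>k. exp (- (inverse (real (Suc k)) * integral\<^sup>L K Zsup))) \<longlonglongrightarrow> exp (- (0 * integral\<^sup>L K Zsup))"
    by (intro tendsto_intros LIMSEQ_inverse_real_of_nat)
  moreover have "measure N (\<Union>k. E k) \<ge> exp (- (inverse (real (Suc k)) * integral\<^sup>L K Zsup))" for k
    unfolding E(2)[symmetric] using E(1) by (intro N.finite_measure_mono) auto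
  ultimately have "measure N (\<Union>k. E k) \<ge> 1"
    by (intro LIMSEQ_le_const2[where X="\<lambda>k. exp (- (inverse (real (Suc k)) * integral\<^sup>L K Zsup))"]) auto
  then have "measure N (\<Union>k. E k) = 1" by (intro antisym) auto
  then have "AE \<omega> in N. \<omega> \<in> (\<Union>k. E k)" using E(1) by (subst (asm) N.prob_eq_1) auto
  then show ?thesis
  proof eventually_elim
    case (elim \<omega>)
    then obtain k where "\<omega> \<in> E k" by blast
    then show ?case by (intro exI[of _ "inverse (real (Suc k))"]) (auto simp: E_def simp del: of_nat_Suc)
  qed
qed

text \<open>A path with \<open>G s (\<theta> \<omega> s) = 0\<close> for some \<open>s\<close> has the junk value \<open>ln 0 = 0\<close> there, which a negative bound excludes.\<close>

lemma AE_good: "AE \<omega> in N. good (\<theta> \<omega>)"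
  using AE_eta_less
proof eventually_elim
  case (elim \<omega>)
  then obtain e where e: "e > 0" "\<And>s. ln (G s (\<theta> \<omega> s)) \<le> - e" by (auto simp: log_margin_def)
  have "G s (\<theta> \<omega> s) \<noteq> 0" for s using e(2)[of s] e(1) by auto
  then show ?case using G_nonneg by (auto simp: good_def less_le)
qed

section \<open>Finite-dimensional laws of the limit process\<close>

definition wmax :: "'s set \<Rightarrow> ('s \<Rightarrow> real) \<Rightarrow> 'k \<Rightarrow> real" where
  "wmax A v \<omega> = (MAX s\<in>A. v s * Z \<omega> s)"

lemma wmax_nonneg:
  assumes "finite A" "A \<noteq> {}" "\<And>s. s \<in> A \<Longrightarrow> v s \<ge> 0" "\<omega> \<in> space K"
  shows "wmax A v \<omega> \<ge> 0"
  using assms Z_nonneg unfolding wmax_def by (subst Max_ge_iff) auto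

lemma wmax_integrable:
  assumes "finite A" "A \<noteq> {}" "\<And>s. s \<in> A \<Longrightarrow> v s \<ge> 0"
  shows "integrable K (wmax A v)"
proof (rule Bochner_Integration.integrable_bound)
  show "integrable K (\<lambda>\<omega>. \<Sum>s\<in>A. v s * Z \<omega> s)"
    using Z_integrable by auto
  show "wmax A v \<in> borel_measurable K"
    unfolding wmax_def[abs_def] using assms by (intro borel_measurable_Max) auto
  show "AE \<omega> in K. norm (wmax A v \<omega>) \<le> norm (\<Sum>s\<in>A. v s * Z \<omega> s)"
  proof (rule AE_I2)
    fix \<omega> assume \<omega>: "\<omega> \<in> space K"
    have "v t * Z \<omega> t \<le> (\<Sum>s\<in>A. v s * Z \<omega> s)" if "t \<in> A" for t
      using assms that Z_nonneg[OF \<omega>] by (intro member_le_sum) auto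
    then have "wmax A v \<omega> \<le> (\<Sum>s\<in>A. v s * Z \<omega> s)"
      unfolding wmax_def using assms by (subst Max_le_iff) auto
    then show "norm (wmax A v \<omega>) \<le> norm (\<Sum>s\<in>A. v s * Z \<omega> s)"
      using wmax_nonneg[OF assms \<omega>] by auto
  qed
qed

lemma finite_support_Enonpos:
  assumes "finite A" "\<And>s. s \<in> A \<Longrightarrow> v s \<ge> 0"
  shows "(\<lambda>s. if s \<in> A then - v s else 0) \<in> Enonpos"
proof -
  have "{s. \<not> isCont (\<lambda>s. if s \<in> A then - v s else 0) s} \<subseteq> A"
    using isCont_finite_support[of A _ "\<lambda>s. - v s"] assms(1) by auto
  moreover have "range (\<lambda>s. if s \<in> A then - v s else 0) \<subseteq> insert 0 ((\<lambda>s. - v s) ` A)" by auto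
  then have "bounded (range (\<lambda>s. if s \<in> A then - v s else 0))"
    by (rule bounded_subset[rotated]) (use assms(1) in \<open>auto intro: finite_imp_bounded\<close>)
  ultimately show ?thesis
    using assms by (auto simp: Enonpos_def Efun_def intro: finite_subset)
qed

lemma D_norm_finite_support:
  assumes "finite A" "A \<noteq> {}" "\<And>s. s \<in> A \<Longrightarrow> v s \<ge> 0"
  shows "D_norm K Z (\<lambda>s. if s \<in> A then - v s else 0) = integral\<^sup>L K (wmax A v)"
  unfolding D_norm_def wmax_def[abs_def]
  by (intro Bochner_Integration.integral_cong Sup_finite_support assms Z_nonneg) auto

text \<open>Monotonicity of the margins turns \<open>\<theta> \<le> h\<close> into
  \<open>\<eta> \<le> \<psi>(h)\<close>, but only on good paths, hence up to a null set.\<close>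

lemma theta_le_finite:
  assumes A: "finite A" "A \<noteq> {}" and h: "\<And>s. s \<in> A \<Longrightarrow> G s (h s) > 0"
  shows "measure N {\<omega>\<in>space N. \<forall>s\<in>A. \<theta> \<omega> s \<le> h s} \<le> exp (- integral\<^sup>L K (wmax A (wt h)))"
proof -
  let ?f = "\<lambda>s. if s \<in> A then - wt h s else 0"
  have f: "?f \<in> Enonpos" using A wt_nonneg by (intro finite_support_Enonpos) auto
  have "measure N {\<omega>\<in>space N. \<forall>s\<in>A. \<theta> \<omega> s \<le> h s} \<le>
      measure N {\<omega>\<in>space N. \<forall>s. log_margin G (\<theta> \<omega>) s \<le> ?f s}"
  proof (rule N.finite_measure_mono_AE)
    show "AE \<omega> in N. \<omega> \<in> {\<omega>\<in>space N. \<forall>s\<in>A. \<theta> \<omega> s \<le> h s} \<longrightarrow>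
        \<omega> \<in> {\<omega>\<in>space N. \<forall>s. log_margin G (\<theta> \<omega>) s \<le> ?f s}"
      using AE_good
    proof eventually_elim
      case (elim \<omega>)
      then have *: "G s (\<theta> \<omega> s) > 0" for s by (auto simp: good_def)
      have "ln (G s (\<theta> \<omega> s)) \<le> 0" for s using *[of s] G_le_1[of s "\<theta> \<omega> s"] by simp
      moreover have "ln (G s (\<theta> \<omega> s)) \<le> ln (G s (h s))" if "\<theta> \<omega> s \<le> h s" for s
        using *[of s] G_mono[OF that, of s] by simp
      ultimately show ?case by (auto simp: log_margin_def wt_def)
    qed
  qed (rule eta_le(1)[OF f])
  also have "\<dots> = exp (- integral\<^sup>L K (wmax A (wt h)))"
    using eta_le(2)[OF f] D_norm_finite_support[OF A, of "wt h"] wt_nonneg by simp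
  finally show ?thesis .
qed

text \<open>A strict inequality for \<open>\<theta>\<close> is forced by enlarging the weights by
  \<open>e\<close>: then \<open>\<eta>\<close> lies strictly below \<open>\<psi>(h)\<close> on
  \<open>A\<close>. The price in the exponent is at most \<open>e * E(sup Z)\<close> and vanishes
  with \<open>e\<close>. Together with \<open>theta_le_finite\<close> this says that the boundary
  carries no mass.\<close>

lemma theta_less_finite:
  assumes A: "finite A" "A \<noteq> {}" and h: "\<And>s. s \<in> A \<Longrightarrow> G s (h s) > 0"
  shows "exp (- integral\<^sup>L K (wmax A (wt h))) \<le> measure N {\<omega>\<in>space N. \<forall>s\<in>A. \<theta> \<omega> s < h s}"
proof -
  have "exp (- integral\<^sup>L K (wmax A (wt h)) - e * integral\<^sup>L K Zsup) \<le>
      measure N {\<omega>\<in>space N. \<forall>s\<in>A. \<theta> \<omega> s < h s}" if e: "e > 0" for e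
  proof -
    let ?v = "\<lambda>s. wt h s + e"
    let ?f = "\<lambda>s. if s \<in> A then - ?v s else 0"
    have v: "?v s \<ge> 0" for s using wt_nonneg[of h s] e by simp
    have f: "?f \<in> Enonpos" using A v by (intro finite_support_Enonpos) auto
    have "integral\<^sup>L K (wmax A ?v) \<le> (\<integral>\<omega>. wmax A (wt h) \<omega> + e * Zsup \<omega> \<partial>K)"
    proof (rule integral_mono)
      fix \<omega> assume \<omega>: "\<omega> \<in> space K"
      have "?v s * Z \<omega> s \<le> wmax A (wt h) \<omega> + e * Zsup \<omega>" if "s \<in> A" for s
      proof -
        have "wt h s * Z \<omega> s \<le> wmax A (wt h) \<omega>" unfolding wmax_def using A that by (intro Max_ge) auto
        moreover have "e * Z \<omega> s \<le> e * Zsup \<omega>" using e Zsup_upper by (intro mult_left_mono) auto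
        ultimately show ?thesis by (simp add: distrib_right)
      qed
      then show "wmax A ?v \<omega> \<le> wmax A (wt h) \<omega> + e * Zsup \<omega>"
        unfolding wmax_def[of A ?v] using A by (subst Max_le_iff) auto
    qed (intro Bochner_Integration.integrable_add integrable_mult_right wmax_integrable A v wt_nonneg Zsup_integrable)+
    also have "\<dots> = integral\<^sup>L K (wmax A (wt h)) + e * integral\<^sup>L K Zsup"
      using A wt_nonneg Zsup_integrable by (simp add: wmax_integrable)
    finally have "exp (- integral\<^sup>L K (wmax A (wt h)) - e * integral\<^sup>L K Zsup) \<le> exp (- integral\<^sup>L K (wmax A ?v))"
      by simp
    also have "\<dots> = measure N {\<omega>\<in>space N. \<forall>s. log_margin G (\<theta> \<omega>) s \<le> ?f s}"
      using eta_le(2)[OF f] D_norm_finite_support[OF A, of ?v] v by simp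
    also have "\<dots> \<le> measure N {\<omega>\<in>space N. \<forall>s\<in>A. \<theta> \<omega> s < h s}"
    proof (rule N.finite_measure_mono)
      have "\<theta> \<omega> s < h s" if "s \<in> A" "log_margin G (\<theta> \<omega>) s \<le> ?f s" for \<omega> s
      proof (rule ccontr)
        assume "\<not> ?thesis"
        then have "G s (h s) \<le> G s (\<theta> \<omega> s)" by (intro G_mono) auto
        then have "ln (G s (h s)) \<le> ln (G s (\<theta> \<omega> s))" using h[OF that(1)] by simp
        with that e show False by (simp add: log_margin_def wt_def)
      qed
      then show "{\<omega> \<in> space N. \<forall>s. log_margin G (\<theta> \<omega>) s \<le> ?f s} \<subseteq> {\<omega> \<in> space N. \<forall>s\<in>A. \<theta> \<omega> s < h s}"
        by blast
    qed (use A in measurable)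
    finally show ?thesis .
  qed
  note * = this
  have "(\<lambda>k. exp (- integral\<^sup>L K (wmax A (wt h)) - inverse (real (Suc k)) * integral\<^sup>L K Zsup)) \<longlonglongrightarrow>
      exp (- integral\<^sup>L K (wmax A (wt h)) - 0 * integral\<^sup>L K Zsup)"
    by (intro tendsto_intros LIMSEQ_inverse_real_of_nat)
  then have "exp (- integral\<^sup>L K (wmax A (wt h)) - 0 * integral\<^sup>L K Zsup) \<le>
      measure N {\<omega>\<in>space N. \<forall>s\<in>A. \<theta> \<omega> s < h s}"
    by (rule LIMSEQ_le_const2) (use * in auto)
  then show ?thesis by simp
qed

text \<open>For a one-point set the exponent is \<open>wt\<close>, as \<open>Z\<close> has mean 1,
  so \<open>theta_less_finite\<close> bounds \<open>G s x\<close> by the probability of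
  \<open>\<theta> \<omega> s < x\<close> and leaves nothing for the atom.\<close>

lemma theta_no_atom: "measure N {\<omega>\<in>space N. \<theta> \<omega> s = x} = 0"
proof (cases "G s x = 0")
  case True
  have "measure N {\<omega>\<in>space N. \<theta> \<omega> s = x} \<le> G s x"
    unfolding G_eq by (intro N.finite_measure_mono) auto
  then show ?thesis using True by (simp add: antisym)
next
  case False
  then have pos: "G s x > 0" using G_nonneg[of s x] by simp
  have "G s x \<le> measure N {\<omega>\<in>space N. \<theta> \<omega> s < x}"
    using theta_less_finite[of "{s}" "\<lambda>_. x"] pos by (simp add: wmax_def[abs_def] wt_def Z_expectation)
  moreover have "G s x = measure N {\<omega>\<in>space N. \<theta> \<omega> s < x} + measure N {\<omega>\<in>space N. \<theta> \<omega> s = x}"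
    unfolding G_eq by (subst N.finite_measure_Union[symmetric]) (auto intro!: arg_cong[where f="measure N"])
  ultimately show ?thesis using measure_nonneg[of N "{\<omega>\<in>space N. \<theta> \<omega> s = x}"] by linarith
qed

text \<open>Joint continuity: along a convergent sequence of points and levels the indicators
  converge by continuity of the path, except where the path meets the level exactly, and that is a
  null event by \<open>theta_no_atom\<close>.\<close>

lemma continuous_G: "continuous_on UNIV (\<lambda>(s, x). G s x)"
proof (rule continuous_on_sequentiallyI)
  fix u :: "nat \<Rightarrow> 's \<times> real" and a assume u: "u \<longlonglongrightarrow> a"
  obtain s x where a: "a = (s, x)" by force
  have us: "(\<lambda>n. fst (u n)) \<longlonglongrightarrow> s" and ux: "(\<lambda>n. snd (u n)) \<longlonglongrightarrow> x"
    using tendsto_fst[OF u] tendsto_snd[OF u] a by auto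
  have Gi: "G s x = (\<integral>\<omega>. indicator {\<omega>\<in>space N. \<theta> \<omega> s \<le> x} \<omega> \<partial>N)" for s x
    unfolding G_eq by (auto intro!: arg_cong[where f="measure N"])
  have "(\<lambda>n. \<integral>\<omega>. indicator {\<omega>\<in>space N. \<theta> \<omega> (fst (u n)) \<le> snd (u n)} \<omega> \<partial>N) \<longlonglongrightarrow>
      (\<integral>\<omega>. (indicator {\<omega>\<in>space N. \<theta> \<omega> s \<le> x} \<omega> :: real) \<partial>N)"
  proof (rule integral_dominated_convergence[where w="\<lambda>_. 1"])
    have "AE \<omega> in N. \<not> (\<theta> \<omega> s = x)"
      using theta_no_atom[of s x] by (subst AE_iff_measurable[OF _ refl]) (auto simp: N.emeasure_eq_measure)
    then show "AE \<omega> in N. (\<lambda>n. indicator {\<omega>\<in>space N. \<theta> \<omega> (fst (u n)) \<le> snd (u n)} \<omega>) \<longlonglongrightarrow>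
        (indicator {\<omega>\<in>space N. \<theta> \<omega> s \<le> x} \<omega> :: real)"
    proof eventually_elim
      case (elim \<omega>)
      have "isCont (\<theta> \<omega>) s"
        by (rule isCont_apply_bcontfun)
      then have "(\<lambda>n. \<theta> \<omega> (fst (u n))) \<longlonglongrightarrow> \<theta> \<omega> s"
        using us by (rule isCont_tendsto_compose)
      then have lim: "(\<lambda>n. \<theta> \<omega> (fst (u n)) - snd (u n)) \<longlonglongrightarrow> \<theta> \<omega> s - x"
        using ux by (intro tendsto_intros)
      have "\<forall>\<^sub>F n in sequentially. (\<theta> \<omega> (fst (u n)) \<le> snd (u n)) = (\<theta> \<omega> s \<le> x)"
      proof (cases "\<theta> \<omega> s < x")
        case True
        then show ?thesis using order_tendstoD(2)[OF lim, of 0] by (auto elim: eventually_mono)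
      next
        case False
        with elim show ?thesis using order_tendstoD(1)[OF lim, of 0] by (auto elim: eventually_mono)
      qed
      then show ?case
        by (intro tendsto_eventually) (auto elim!: eventually_mono simp: indicator_def)
    qed
  qed (auto simp: indicator_def)
  then show "(\<lambda>n. case u n of (s, x) \<Rightarrow> G s x) \<longlonglongrightarrow> (case a of (s, x) \<Rightarrow> G s x)"
    by (simp add: Gi a case_prod_unfold)
qed

lemma continuous_G_compose:
  assumes "continuous_on S g" "continuous_on S h"
  shows "continuous_on S (\<lambda>x. G (g x) (h x))"
  using continuous_on_compose2[OF continuous_G continuous_on_Pair[OF assms]] by simp

text \<open>By compactness \<open>G\<close> has a positive minimum along \<open>h\<close>, and
  uniform continuity on the product of S and \<open>{0..1}\<close> keeps it positive after a small
  downward shift. Goodness is thereby an open condition in the sup-norm.\<close>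

lemma good_shift:
  assumes "good h"
  obtains \<delta> where "\<delta> > 0" "\<And>s. G s (h s - \<delta>) > 0"
proof -
  have cont: "continuous_on UNIV (\<lambda>p. G (fst p) (h (fst p) - snd p))"
    by (intro continuous_G_compose continuous_intros continuous_on_compose2[OF continuous_on_apply_bcontfun[of UNIV]]) auto
  have "compact (UNIV \<times> {0..1::real} :: ('s \<times> real) set)"
    using cpt by (intro compact_Times) auto
  then have uc: "uniformly_continuous_on (UNIV \<times> {0..1}) (\<lambda>p. G (fst p) (h (fst p) - snd p))"
    by (intro compact_uniformly_continuous continuous_on_subset[OF cont]) auto
  have "continuous_on UNIV (\<lambda>s. G s (h s))"
    by (intro continuous_G_compose continuous_intros continuous_on_apply_bcontfun)
  then obtain t where t: "\<And>s. G t (h t) \<le> G s (h s)"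
    using continuous_attains_inf[OF cpt, of "\<lambda>s. G s (h s)"] by auto
  have "G t (h t) > 0" using assms by (simp add: good_def)
  then obtain e where e: "e > 0" "\<And>p p'. p \<in> UNIV \<times> {0..1} \<Longrightarrow> p' \<in> UNIV \<times> {0..1} \<Longrightarrow> dist p' p < e \<Longrightarrow>
      dist (G (fst p') (h (fst p') - snd p')) (G (fst p) (h (fst p) - snd p)) < G t (h t)"
    using uc unfolding uniformly_continuous_on_def by blast
  define \<delta> where "\<delta> = min 1 (e/2)"
  have \<delta>: "0 < \<delta>" "\<delta> \<le> 1" "\<delta> < e" using e(1) by (auto simp: \<delta>_def)
  show thesis
  proof (rule that[of \<delta>])
    fix s
    have "dist (G s (h s - \<delta>)) (G s (h s - 0)) < G t (h t)"
      using e(2)[of "(s, 0)" "(s, \<delta>)"] \<delta> by (simp add: dist_Pair_Pair dist_real_def)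
    then show "G s (h s - \<delta>) > 0" using t[of s] by (simp add: dist_real_def)
  qed (rule \<delta>)
qed

text \<open>The region between a good function and a constant is compact and avoids the zeros of
  \<open>G\<close>, so the logarithm is uniformly continuous on it.\<close>

lemma ln_G_uniform:
  assumes "good h" "e > 0"
  obtains \<delta> where "\<delta> > 0" "\<And>s y y'. h s \<le> y \<Longrightarrow> h s \<le> y' \<Longrightarrow> y \<le> B \<Longrightarrow> y' \<le> B \<Longrightarrow> \<bar>y - y'\<bar> < \<delta> \<Longrightarrow>
    \<bar>ln (G s y) - ln (G s y')\<bar> < e"
proof -
  obtain b where b: "\<And>s. \<bar>h s\<bar> \<le> b" using bcontfun_abs_le[of h] by blast
  define S where "S = {p :: 's \<times> real. h (fst p) \<le> snd p} \<inter> (UNIV \<times> {- b..B})"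
  have hc: "continuous_on UNIV (\<lambda>p :: 's \<times> real. h (fst p))"
    by (intro continuous_on_compose2[OF continuous_on_apply_bcontfun[of UNIV]] continuous_intros) auto
  have "compact S"
    unfolding S_def by (intro closed_Int_compact closed_Collect_le compact_Times cpt hc continuous_intros) auto
  moreover have "G (fst p) (snd p) \<noteq> 0" if "p \<in> S" for p
    using that assms(1) G_mono[of "h (fst p)" "snd p" "fst p"] by (auto simp: S_def good_def) (metis less_le_not_le)
  then have "continuous_on S (\<lambda>p. ln (G (fst p) (snd p)))"
    by (intro continuous_on_ln continuous_G_compose continuous_intros) auto
  ultimately have "uniformly_continuous_on S (\<lambda>p. ln (G (fst p) (snd p)))"
    by (intro compact_uniformly_continuous)
  then obtain \<delta> where \<delta>: "\<delta> > 0" "\<And>p p'. p \<in> S \<Longrightarrow> p' \<in> S \<Longrightarrow> dist p' p < \<delta> \<Longrightarrow>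
      dist (ln (G (fst p') (snd p'))) (ln (G (fst p) (snd p))) < e"
    using assms(2) unfolding uniformly_continuous_on_def by blast
  show thesis
  proof (rule that[OF \<delta>(1)])
    fix s y y' assume *: "h s \<le> y" "h s \<le> y'" "y \<le> B" "y' \<le> B" "\<bar>y - y'\<bar> < \<delta>"
    have "- b \<le> h s" using b[of s] by (simp add: abs_le_iff)
    then have "(s, y) \<in> S" "(s, y') \<in> S" using * by (auto simp: S_def)
    then show "\<bar>ln (G s y) - ln (G s y')\<bar> < e"
      using \<delta>(2)[of "(s, y')" "(s, y)"] * by (simp add: dist_Pair_Pair dist_real_def)
  qed
qed


subsection \<open>Exceedances on finite sets\<close>

text \<open>The number of paths and the norming index are separate arguments, because a record at
  time \<open>Suc n\<close> is compared with \<open>n\<close> paths normalized by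
  \<open>c (Suc n)\<close> and \<open>d (Suc n)\<close>.\<close>

definition Mn :: "nat \<Rightarrow> nat \<Rightarrow> 'a \<Rightarrow> 's \<Rightarrow>\<^sub>C real" where
  "Mn k n \<omega> = normalized_max k (c n) (d n) (\<lambda>i. Xs i \<omega>)"

lemma apply_Mn: "k \<ge> 1 \<Longrightarrow> n \<ge> 1 \<Longrightarrow> Mn k n \<omega> s = (MAX i\<in>{1..k}. nrm n (Xs i \<omega>) s)"
  unfolding Mn_def nrm_def by (intro apply_normalized_max cpt c_Cpos)

lemma Mn_le_iff: "k \<ge> 1 \<Longrightarrow> n \<ge> 1 \<Longrightarrow> Mn k n \<omega> s \<le> y \<longleftrightarrow> (\<forall>i\<in>{1..k}. nrm n (Xs i \<omega>) s \<le> y)"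
  and Mn_less_iff: "k \<ge> 1 \<Longrightarrow> n \<ge> 1 \<Longrightarrow> Mn k n \<omega> s < y \<longleftrightarrow> (\<forall>i\<in>{1..k}. nrm n (Xs i \<omega>) s < y)"
  by (auto simp: apply_Mn)

lemma Mn_ge: "i \<in> {1..k} \<Longrightarrow> n \<ge> 1 \<Longrightarrow> nrm n (Xs i \<omega>) s \<le> Mn k n \<omega> s"
  using Mn_le_iff[of k n \<omega> s "Mn k n \<omega> s"] by auto

lemma nrm_less_iff: "n \<ge> 1 \<Longrightarrow> nrm n x s < nrm n y s \<longleftrightarrow> x s < y s"
  using c_pos[of n s] by (simp add: nrm_def divide_less_cancel)

lemma measurable_Mn [measurable]: "k \<ge> 1 \<Longrightarrow> n \<ge> 1 \<Longrightarrow> Mn k n \<in> borel_measurable M"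
  unfolding Mn_def[abs_def]
  by (rule measurable_normalized_max[OF cpt]) (auto intro: Xs_measurable c_Cpos)

lemma Mn_vimage_sets: "k \<ge> 1 \<Longrightarrow> n \<ge> 1 \<Longrightarrow> A \<in> sets borel \<Longrightarrow> {\<omega>\<in>space M. Mn k n \<omega> \<in> A} \<in> sets M"
  using measurable_sets[OF measurable_Mn, of k n A] by (simp add: vimage_def Int_def conj_commute)

lemma distr_joint:
  assumes "k \<ge> 1"
  shows "distr M (\<Pi>\<^sub>M i\<in>{1..k}. borel) (\<lambda>\<omega>. \<lambda>i\<in>{1..k}. Xs i \<omega>) = (\<Pi>\<^sub>M i\<in>{1..k}. \<mu>)"
proof -
  have "M.indep_vars (\<lambda>_. borel) Xs {1..k}"
    using M.indep_vars_subset[OF indep, of "{1..k}"] by auto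
  then have "distr M (\<Pi>\<^sub>M i\<in>{1..k}. borel) (\<lambda>\<omega>. \<lambda>i\<in>{1..k}. Xs i \<omega>) = (\<Pi>\<^sub>M i\<in>{1..k}. distr M borel (Xs i))"
    using assms by (subst (asm) M.indep_vars_iff_distr_eq_PiM') (auto intro: Xs_measurable)
  also have "\<dots> = (\<Pi>\<^sub>M i\<in>{1..k}. \<mu>)" by (intro PiM_cong) (auto simp: ident)
  finally show ?thesis .
qed

lemma measurable_joint: "(\<lambda>\<omega>. \<lambda>i\<in>{1..k}. Xs i \<omega>) \<in> measurable M (\<Pi>\<^sub>M i\<in>{1..k}. borel)"
  by (intro measurable_restrict Xs_measurable) auto

lemma sets_PiM_mu: "sets (\<Pi>\<^sub>M i\<in>I. \<mu>) = sets (\<Pi>\<^sub>M i\<in>I. borel)"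
  by (intro sets_PiM_cong) auto

lemma distr_Mn:
  assumes "k \<ge> 1" "n \<ge> 1"
  shows "distr M borel (Mn k n) = normalized_max_law \<mu> k (c n) (d n)"
proof -
  have nm: "normalized_max k (c n) (d n) \<in> measurable (\<Pi>\<^sub>M i\<in>{1..k}. borel) borel"
    by (rule measurable_normalized_max[OF cpt assms(1) c_Cpos[OF assms(2)], of "\<lambda>i x. x i"]) auto
  have "normalized_max_law \<mu> k (c n) (d n) =
      distr (distr M (\<Pi>\<^sub>M i\<in>{1..k}. borel) (\<lambda>\<omega>. \<lambda>i\<in>{1..k}. Xs i \<omega>)) borel (normalized_max k (c n) (d n))"
    unfolding normalized_max_law_def distr_joint[OF assms(1)] ..
  also have "\<dots> = distr M borel (\<lambda>\<omega>. normalized_max k (c n) (d n) (\<lambda>i\<in>{1..k}. Xs i \<omega>))"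
    by (subst distr_distr[OF nm measurable_joint]) (simp add: comp_def)
  also have "(\<lambda>\<omega>. normalized_max k (c n) (d n) (\<lambda>i\<in>{1..k}. Xs i \<omega>)) = Mn k n"
    unfolding Mn_def normalized_max_def by (intro ext arg_cong[where f=Bcontfun] arg_cong[where f=Max]) auto
  finally show ?thesis ..
qed

lemma weak_Mn:
  "weakly_convergent_to (\<lambda>n. distr M borel (Mn n n)) (distr N borel \<theta>)"
proof -
  have "\<forall>\<^sub>F n in sequentially. normalized_max_law \<mu> n (c n) (d n) = distr M borel (Mn n n)"
    using eventually_ge_at_top[of 1] by eventually_elim (simp add: distr_Mn)
  then have ev: "\<forall>\<^sub>F n in sequentially. (\<integral>x. apply_bcontfun \<phi> x \<partial>normalized_max_law \<mu> n (c n) (d n)) =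
      (\<integral>x. \<phi> x \<partial>distr M borel (Mn n n))" for \<phi> :: "('s \<Rightarrow>\<^sub>C real) \<Rightarrow>\<^sub>C real"
    by eventually_elim simp
  show ?thesis
    unfolding weakly_convergent_to_def
  proof
    fix \<phi> :: "('s \<Rightarrow>\<^sub>C real) \<Rightarrow>\<^sub>C real"
    have "(\<lambda>n. \<integral>x. \<phi> x \<partial>normalized_max_law \<mu> n (c n) (d n)) \<longlonglongrightarrow> (\<integral>x. \<phi> x \<partial>distr N borel \<theta>)"
      using weak unfolding weakly_convergent_to_def by blast
    then show "(\<lambda>n. \<integral>x. \<phi> x \<partial>distr M borel (Mn n n)) \<longlonglongrightarrow> (\<integral>x. \<phi> x \<partial>distr N borel \<theta>)"
      by (rule Lim_transform_eventually) (rule ev)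
  qed
qed

text \<open>The eventual form skips \<open>n = 0\<close>, where the maximum runs over the empty
  set.\<close>

lemma prob_Mn: "\<forall>\<^sub>F n in sequentially. prob_space (distr M borel (Mn n n))"
  using eventually_ge_at_top[of 1] by eventually_elim (auto intro!: M.prob_space_distr)

lemma prob_theta: "prob_space (distr N borel \<theta>)"
  by (rule N.prob_space_distr) measurable

lemma weak_limit_Mn: "weak_limit (\<lambda>n. distr M borel (Mn n n)) (distr N borel \<theta>)"
  by (rule weak_limit.intro[OF weak_Mn prob_Mn sets_distr prob_theta sets_distr])

lemma measure_theta: "measure (distr N borel \<theta>) A = measure N {\<omega>\<in>space N. \<theta> \<omega> \<in> A}" if "A \<in> sets borel"
  using that by (subst measure_distr) (auto intro!: arg_cong[where f="measure N"])

lemma measure_Mn: "measure (distr M borel (Mn k n)) A = measure M {\<omega>\<in>space M. Mn k n \<omega> \<in> A}"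
  if "A \<in> sets borel" "k \<ge> 1" "n \<ge> 1"
  using that by (subst measure_distr) (auto intro!: arg_cong[where f="measure M"])

lemma Mn_closed:
  assumes "closed A" "e > 0"
  shows "\<forall>\<^sub>F n in sequentially. measure M {\<omega>\<in>space M. Mn n n \<omega> \<in> A} < measure N {\<omega>\<in>space N. \<theta> \<omega> \<in> A} + e"
  using weak_limit.portmanteau_closed[OF weak_limit_Mn assms] eventually_ge_at_top[of 1]
proof eventually_elim
  case (elim n)
  then show ?case using measure_theta[of A] measure_Mn[of A n n] assms(1) by simp
qed

lemma Mn_open:
  assumes "open A" "e > 0"
  shows "\<forall>\<^sub>F n in sequentially. measure M {\<omega>\<in>space M. Mn n n \<omega> \<in> A} > measure N {\<omega>\<in>space N. \<theta> \<omega> \<in> A} - e"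
  using weak_limit.portmanteau_open[OF weak_limit_Mn assms] eventually_ge_at_top[of 1]
proof eventually_elim
  case (elim n)
  then show ?case using measure_theta[of A] measure_Mn[of A n n] assms(1) by simp
qed

lemma measure_Xs:
  assumes "i \<ge> 1" "A \<in> sets borel"
  shows "measure M {\<omega>\<in>space M. Xs i \<omega> \<in> A} = measure \<mu> A"
  unfolding ident[OF assms(1), symmetric] using assms
  by (subst measure_distr) (auto intro!: Xs_measurable arg_cong[where f="measure M"])

lemma measure_box:
  assumes "finite I" "I \<noteq> {}" "I \<subseteq> {1..}" "\<And>i. i \<in> I \<Longrightarrow> A i \<in> sets borel"
  shows "measure M {\<omega>\<in>space M. \<forall>i\<in>I. Xs i \<omega> \<in> A i} = (\<Prod>i\<in>I. measure \<mu> (A i))"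
proof -
  have "{\<omega>\<in>space M. \<forall>i\<in>I. Xs i \<omega> \<in> A i} = (\<Inter>i\<in>I. Xs i -` A i \<inter> space M)"
    using assms(2) by auto
  also have "measure M \<dots> = (\<Prod>i\<in>I. measure M (Xs i -` A i \<inter> space M))"
    using assms by (intro M.indep_varsD[OF indep]) auto
  also have "\<dots> = (\<Prod>i\<in>I. measure \<mu> (A i))"
  proof (rule prod.cong[OF refl])
    fix i assume "i \<in> I"
    then show "measure M (Xs i -` A i \<inter> space M) = measure \<mu> (A i)"
      using assms measure_Xs[of i "A i"] by (auto simp: vimage_def Int_def conj_commute subset_eq)
  qed
  finally show ?thesis .
qed

lemma closed_le_on: "closed {y :: 's \<Rightarrow>\<^sub>C real. \<forall>s\<in>A. y s \<le> h s}"
proof -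
  have "closed (\<Inter>s\<in>A. {y :: 's \<Rightarrow>\<^sub>C real. y s \<le> h s})"
    by (intro closed_INT ballI closed_Collect_le continuous_on_eval_bcontfun continuous_on_const)
  also have "(\<Inter>s\<in>A. {y :: 's \<Rightarrow>\<^sub>C real. y s \<le> h s}) = {y. \<forall>s\<in>A. apply_bcontfun y s \<le> h s}"
    by auto
  finally show ?thesis .
qed

text \<open>The values \<open>nrm\<close> bundled as an element of C(S), so that closed and Borel
  sets of paths can be pulled back. It is the maximum over a single path.\<close>

definition nrm_path :: "nat \<Rightarrow> ('s \<Rightarrow>\<^sub>C real) \<Rightarrow> 's \<Rightarrow>\<^sub>C real" where
  "nrm_path n x = normalized_max 1 (c n) (d n) (\<lambda>_. x)"

lemma apply_nrm_path: "n \<ge> 1 \<Longrightarrow> nrm_path n x s = nrm n x s"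
  unfolding nrm_path_def nrm_def using apply_normalized_max_single[OF cpt c_Cpos, of n "d n" x s] by simp

lemma nrm_path_measurable [measurable]: "n \<ge> 1 \<Longrightarrow> nrm_path n \<in> borel_measurable borel"
  unfolding nrm_path_def[abs_def] by (rule measurable_normalized_max[OF cpt]) (auto intro: c_Cpos)

lemma nrm_path_vimage: "n \<ge> 1 \<Longrightarrow> A \<in> sets borel \<Longrightarrow> {x. nrm_path n x \<in> A} \<in> sets borel"
  using measurable_sets[OF nrm_path_measurable, of n A] by (simp add: vimage_def)

lemma le_power_Mn:
  assumes "n \<ge> 1"
  shows "measure M {\<omega>\<in>space M. \<forall>s\<in>A. Mn n n \<omega> s \<le> h s} = measure \<mu> {x. \<forall>s\<in>A. nrm n x s \<le> h s} ^ n"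
proof -
  have "{x. nrm_path n x \<in> {y. \<forall>s\<in>A. apply_bcontfun y s \<le> h s}} \<in> sets borel"
    by (rule nrm_path_vimage[OF assms borel_closed[OF closed_le_on]])
  then have *: "{x. \<forall>s\<in>A. nrm n x s \<le> h s} \<in> sets borel" using assms by (simp add: apply_nrm_path)
  have "{\<omega>\<in>space M. \<forall>s\<in>A. Mn n n \<omega> s \<le> h s} = {\<omega>\<in>space M. \<forall>i\<in>{1..n}. Xs i \<omega> \<in> {x. \<forall>s\<in>A. nrm n x s \<le> h s}}"
    using assms by (auto simp: Mn_le_iff)
  also have "measure M \<dots> = (\<Prod>i\<in>{1..n}. measure \<mu> {x. \<forall>s\<in>A. nrm n x s \<le> h s})"
    by (rule measure_box) (use assms * in auto)
  finally show ?thesis by simp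
qed

text \<open>The portmanteau inequalities are applied to the open set with strict and to the closed
  set with weak inequalities. Both bounds carry the same exponent, so they close up to a
  limit.\<close>

lemma power_le_finite:
  assumes A: "finite A" "A \<noteq> {}" and h: "\<And>s. s \<in> A \<Longrightarrow> G s (h s) > 0"
  shows "(\<lambda>n. measure \<mu> {x. \<forall>s\<in>A. nrm n x s \<le> h s} ^ n) \<longlonglongrightarrow> exp (- integral\<^sup>L K (wmax A (wt h)))"
proof -
  let ?L = "exp (- integral\<^sup>L K (wmax A (wt h)))"
  let ?p = "\<lambda>n. measure M {\<omega>\<in>space M. \<forall>s\<in>A. Mn n n \<omega> s \<le> h s}"
  have "?p \<longlonglongrightarrow> ?L"
  proof (rule order_tendstoI)
    fix a assume a: "a < ?L"
    have "\<forall>\<^sub>F n in sequentially. measure M {\<omega>\<in>space M. Mn n n \<omega> \<in> {y. \<forall>s\<in>A. apply_bcontfun y s < h s}} >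
        measure N {\<omega>\<in>space N. \<theta> \<omega> \<in> {y. \<forall>s\<in>A. apply_bcontfun y s < h s}} - (?L - a)"
      using a 
      by (intro Mn_open open_bcontfun_less finite_imp_compact continuous_on_finite A) auto
    with eventually_ge_at_top[of 1] show "\<forall>\<^sub>F n in sequentially. a < ?p n"
    proof eventually_elim
      case (elim n)
      have [measurable]: "Mn n n \<in> borel_measurable M" using elim(1) by simp
      have [measurable]: "(\<lambda>\<omega>. Mn n n \<omega> s) \<in> borel_measurable M" for s
        by (rule measurable_compose[OF _ borel_measurable_apply_bcontfun]) measurable
      have "measure M {\<omega>\<in>space M. Mn n n \<omega> \<in> {y. \<forall>s\<in>A. apply_bcontfun y s < h s}} \<le> ?p n"
        using A by (intro M.finite_measure_mono) (auto intro: less_imp_le)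
      then show ?case using elim(2) theta_less_finite[OF A h] by simp
    qed
  next
    fix a assume a: "?L < a"
    have "\<forall>\<^sub>F n in sequentially. measure M {\<omega>\<in>space M. Mn n n \<omega> \<in> {y. \<forall>s\<in>A. apply_bcontfun y s \<le> h s}} <
        measure N {\<omega>\<in>space N. \<theta> \<omega> \<in> {y. \<forall>s\<in>A. apply_bcontfun y s \<le> h s}} + (a - ?L)"
      using a by (intro Mn_closed closed_le_on) auto
    then show "\<forall>\<^sub>F n in sequentially. ?p n < a"
      by eventually_elim (use theta_le_finite[OF A h] in simp)
  qed
  moreover have "\<forall>\<^sub>F n in sequentially. ?p n = measure \<mu> {x. \<forall>s\<in>A. nrm n x s \<le> h s} ^ n"
    using eventually_ge_at_top[of 1] by eventually_elim (rule le_power_Mn)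
  ultimately show ?thesis by (rule Lim_transform_eventually)
qed

lemma exceed_some_finite:
  assumes A: "finite A" "A \<noteq> {}" and h: "\<And>s. s \<in> A \<Longrightarrow> G s (h s) > 0"
  shows "(\<lambda>n. real n * measure \<mu> {x. \<exists>s\<in>A. nrm n x s > h s}) \<longlonglongrightarrow> integral\<^sup>L K (wmax A (wt h))"
proof -
  have "measure \<mu> {x. \<exists>s\<in>A. nrm n x s > h s} = 1 - measure \<mu> {x. \<forall>s\<in>A. nrm n x s \<le> h s}" for n
  proof -
    have "{x \<in> space \<mu>. \<forall>s\<in>A. nrm n x s \<le> h s} \<in> sets \<mu>" using A by measurable
    then have "measure \<mu> (space \<mu> - {x. \<forall>s\<in>A. nrm n x s \<le> h s}) = 1 - measure \<mu> {x. \<forall>s\<in>A. nrm n x s \<le> h s}"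
      by (intro mu.prob_compl) simp
    moreover have "space \<mu> - {x. \<forall>s\<in>A. nrm n x s \<le> h s} = {x. \<exists>s\<in>A. nrm n x s > h s}"
      by (auto simp: not_le)
    ultimately show ?thesis by simp
  qed
  then show ?thesis
    using power_tendsto_exp_imp[OF _ _ power_le_finite[OF A h]] by simp
qed

text \<open>Inclusion-exclusion, one point \<open>t\<close> of \<open>T\<close> at a time: with \<open>W\<close>, \<open>V\<close>, \<open>U\<close> for an exceedance on all of \<open>T\<close>, at \<open>t\<close>, and somewhere on \<open>A\<close>,
  \<open>P (W \<inter> V \<inter> U) = P (W \<inter> V) + P (W \<inter> U) - P (W \<inter> (V \<union> U))\<close>, matched by the same identity for minima and maxima.\<close>

lemma exceed_all_and_some:
  assumes "finite T" "finite A" "A \<noteq> {}" and h: "\<And>s. s \<in> T \<union> A \<Longrightarrow> G s (h s) > 0"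
  shows "integrable K (\<lambda>\<omega>. Min (insert (wmax A (wt h) \<omega>) ((\<lambda>s. wt h s * Z \<omega> s) ` T)))"
    and "(\<lambda>n. real n * measure \<mu> {x. (\<forall>s\<in>T. nrm n x s > h s) \<and> (\<exists>s\<in>A. nrm n x s > h s)}) \<longlonglongrightarrow>
      (\<integral>\<omega>. Min (insert (wmax A (wt h) \<omega>) ((\<lambda>s. wt h s * Z \<omega> s) ` T)) \<partial>K)"
  using assms
proof (induction T arbitrary: A rule: finite_induct)
  case empty
  { case 1 then show ?case using wmax_integrable[of A "wt h"] wt_nonneg by simp }
  { case 2 then show ?case using exceed_some_finite[of A h] by simp }
next
  case (insert t T)
  let ?m = "\<lambda>A \<omega>. Min (insert (wmax A (wt h) \<omega>) ((\<lambda>s. wt h s * Z \<omega> s) ` T))"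
  let ?q = "\<lambda>n A. measure \<mu> {x. (\<forall>s\<in>T. nrm n x s > h s) \<and> (\<exists>s\<in>A. nrm n x s > h s)}"
  have id: "Min (insert (wmax A (wt h) \<omega>) ((\<lambda>s. wt h s * Z \<omega> s) ` insert t T)) =
      ?m {t} \<omega> + ?m A \<omega> - ?m (insert t A) \<omega>" if "finite A" "A \<noteq> {}" for A \<omega>
  proof -
    have Mt: "wmax {t} (wt h) \<omega> = wt h t * Z \<omega> t" "wmax (insert t A) (wt h) \<omega> = max (wt h t * Z \<omega> t) (wmax A (wt h) \<omega>)"
      using that by (auto simp: wmax_def)
    show ?thesis
    proof (cases "T = {}")
      case True
      show ?thesis unfolding image_insert Mt True by simp
    next
      case False
      define m where "m = (MIN s\<in>T. wt h s * Z \<omega> s)"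
      have ins: "Min (insert a ((\<lambda>s. wt h s * Z \<omega> s) ` T)) = min a m" for a
        unfolding m_def using False insert.hyps(1) by simp
      have "Min (insert a (insert b ((\<lambda>s. wt h s * Z \<omega> s) ` T))) = min a (min b m)" for a b
        using False insert.hyps(1) by (subst Min_insert) (auto simp: ins)
      then show ?thesis
        unfolding image_insert Mt ins by (simp add: min_def max_def)
    qed
  qed
  { case 1
    then have A: "finite A" "A \<noteq> {}" by auto
    show ?case
      unfolding id[OF A] using 1
      by (intro Bochner_Integration.integrable_add Bochner_Integration.integrable_diff insert.IH(1)) auto }
  { case 2
    then have A: "finite A" "A \<noteq> {}" by auto
    have int: "integrable K (?m {t})" "integrable K (?m A)" "integrable K (?m (insert t A))"
      using 2 by (auto intro!: insert.IH(1))
    have meas: "{x. (\<forall>s\<in>T. nrm n x s > h s) \<and> (\<exists>s\<in>A. nrm n x s > h s)} \<in> sets \<mu>" if "finite A" for A n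
    proof -
      have "{x\<in>space \<mu>. (\<forall>s\<in>T. nrm n x s > h s) \<and> (\<exists>s\<in>A. nrm n x s > h s)} \<in> sets \<mu>"
        using that insert.hyps by measurable
      then show ?thesis by simp
    qed
    have "measure \<mu> {x. (\<forall>s\<in>insert t T. nrm n x s > h s) \<and> (\<exists>s\<in>A. nrm n x s > h s)} =
        ?q n {t} + ?q n A - ?q n (insert t A)" for n
    proof -
      let ?W = "{x. \<forall>s\<in>T. nrm n x s > h s}"
      let ?B = "{x. (\<forall>s\<in>T. nrm n x s > h s) \<and> (\<exists>s\<in>{t}. nrm n x s > h s)}"
      let ?C = "{x. (\<forall>s\<in>T. nrm n x s > h s) \<and> (\<exists>s\<in>A. nrm n x s > h s)}"
      have "measure \<mu> (?B \<union> ?C) = measure \<mu> ?B + measure \<mu> ?C - measure \<mu> (?B \<inter> ?C)"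
        using meas[of "{t}" n] meas[OF A(1), of n] by (intro measure_Un3) (auto simp: fmeasurable_def less_top[symmetric])
      moreover have "?B \<union> ?C = {x. (\<forall>s\<in>T. nrm n x s > h s) \<and> (\<exists>s\<in>insert t A. nrm n x s > h s)}"
        "?B \<inter> ?C = {x. (\<forall>s\<in>insert t T. nrm n x s > h s) \<and> (\<exists>s\<in>A. nrm n x s > h s)}" by auto
      ultimately show ?thesis by simp
    qed
    then have "(\<lambda>n. real n * measure \<mu> {x. (\<forall>s\<in>insert t T. nrm n x s > h s) \<and> (\<exists>s\<in>A. nrm n x s > h s)}) =
        (\<lambda>n. real n * ?q n {t} + real n * ?q n A - real n * ?q n (insert t A))"
      by (simp only: right_diff_distrib distrib_left)
    also have "\<dots> \<longlonglongrightarrow> integral\<^sup>L K (?m {t}) + integral\<^sup>L K (?m A) - integral\<^sup>L K (?m (insert t A))"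
      using 2 by (intro tendsto_intros insert.IH(2)) auto
    also have "integral\<^sup>L K (?m {t}) + integral\<^sup>L K (?m A) - integral\<^sup>L K (?m (insert t A)) =
        (\<integral>\<omega>. ?m {t} \<omega> + ?m A \<omega> - ?m (insert t A) \<omega> \<partial>K)"
      using int by simp
    finally show ?case unfolding id[OF A] . }
qed

definition wmin :: "'s set \<Rightarrow> ('s \<Rightarrow> real) \<Rightarrow> 'k \<Rightarrow> real" where
  "wmin T v \<omega> = (MIN s\<in>T. v s * Z \<omega> s)"

text \<open>Taking \<open>A = {t}\<close> with \<open>t\<close> in \<open>T\<close> makes the second
  requirement redundant.\<close>

lemma exceed_all_finite:
  assumes T: "finite T" "T \<noteq> {}" and h: "\<And>s. s \<in> T \<Longrightarrow> G s (h s) > 0"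
  shows "(\<lambda>n. real n * measure \<mu> {x. \<forall>s\<in>T. nrm n x s > h s}) \<longlonglongrightarrow> integral\<^sup>L K (wmin T (wt h))"
proof -
  obtain t where t: "t \<in> T" using T by blast
  have "Min (insert (wmax {t} (wt h) \<omega>) ((\<lambda>s. wt h s * Z \<omega> s) ` T)) = wmin T (wt h) \<omega>" for \<omega>
    using t T by (simp add: wmax_def wmin_def min_absorb2) 
  moreover have "{x. (\<forall>s\<in>T. nrm n x s > h s) \<and> (\<exists>s\<in>{t}. nrm n x s > h s)} = {x. \<forall>s\<in>T. nrm n x s > h s}" for n
    using t by auto
  ultimately show ?thesis
    using exceed_all_and_some(2)[of T "{t}" h] T t h by (simp add: insert_absorb)
qed

end

subsection \<open>Exceedances of functions\<close>

lemma bdd_below_diff: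
  fixes y :: "'s::metric_space \<Rightarrow>\<^sub>C real"
  assumes "bounded (range h)"
  shows "bdd_below (range (\<lambda>s. y s - h s))"
proof -
  obtain b where b: "\<And>s. \<bar>h s\<bar> \<le> b" using assms by (auto simp: bounded_iff)
  obtain B where "\<And>s. \<bar>y s\<bar> \<le> B" using bcontfun_abs_le[of y] by blast
  then have "- B - b \<le> y s - h s" for s using b[of s] by (smt (verit))
  then show ?thesis by (intro bdd_belowI2)
qed

text \<open>Whatever the bounded function \<open>h\<close>, the infimum of \<open>y - h\<close> is
  1-Lipschitz in \<open>y\<close> for the sup-norm.\<close>

lemma closed_INF_le:
  fixes h :: "'s::metric_space \<Rightarrow> real"
  assumes "bounded (range h)"
  shows "closed {y :: 's \<Rightarrow>\<^sub>C real. (INF s. y s - h s) \<le> a}"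
proof -
  note bb = bdd_below_diff[OF assms]
  have le: "(INF s. x s - h s) - dist x y \<le> (INF s. y s - h s)" for x y :: "'s \<Rightarrow>\<^sub>C real"
  proof (rule cINF_greatest)
    fix s
    have "(INF s. x s - h s) \<le> x s - h s" by (rule cINF_lower[OF bb]) simp
    moreover have "\<bar>x s - y s\<bar> \<le> dist x y" using dist_bounded[of x s y] by (simp add: dist_real_def)
    ultimately show "(INF s. x s - h s) - dist x y \<le> y s - h s" by linarith
  qed simp
  have "1-lipschitz_on UNIV (\<lambda>y :: 's \<Rightarrow>\<^sub>C real. INF s. y s - h s)"
  proof (rule lipschitz_onI)
    fix x y :: "'s \<Rightarrow>\<^sub>C real"
    show "dist (INF s. x s - h s) (INF s. y s - h s) \<le> 1 * dist x y"
      using le[of x y] le[of y x] by (simp add: dist_real_def dist_commute abs_le_iff)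
  qed simp
  then show ?thesis
    by (intro closed_Collect_le continuous_on_const lipschitz_on_continuous_on)
qed

context record_setting begin

text \<open>The good minorant supplies what pointwise positivity of \<open>G s (h s)\<close> does
  not give for discontinuous \<open>h\<close>: a bound on the weights and uniform control of
  \<open>ln G\<close>. It also serves as the low level under which all other paths are kept while
  one path is large.\<close>

definition adm :: "('s \<Rightarrow> real) \<Rightarrow> bool" where
  "adm h \<longleftrightarrow> h \<in> Efun \<and> (\<exists>h0. good h0 \<and> (\<forall>s. h0 s \<le> h s))"

definition dseq :: "nat \<Rightarrow> 's" where "dseq = (SOME q. \<forall>s e. e > 0 \<longrightarrow> (\<exists>n. dist s (q n) < e))"

lemma dseq_dense: "e > 0 \<Longrightarrow> \<exists>n. dist s (dseq n) < e"
proof -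
  obtain q :: "nat \<Rightarrow> 's" where "\<And>s e. e > 0 \<Longrightarrow> \<exists>n. dist s (q n) < e"
    using compact_UNIV_dense_sequence[OF cpt] by blast
  then have "\<forall>s e. e > 0 \<longrightarrow> (\<exists>n. dist s (q n) < e)" by blast
  then have "\<forall>s e. e > 0 \<longrightarrow> (\<exists>n. dist s (dseq n) < e)" unfolding dseq_def
    by (rule someI[where P = "\<lambda>q. \<forall>s e. e > 0 \<longrightarrow> (\<exists>n. dist s (q n) < e)"])
  then show "e > 0 \<Longrightarrow> \<exists>n. dist s (dseq n) < e" by blast
qed

definition net_of :: "('s \<Rightarrow> real) \<Rightarrow> nat \<Rightarrow> 's set" where
  "net_of h k = {s. \<not> isCont h s} \<union> dseq ` {..k}"

section \<open>The limit functional \<open>dualw\<close> and its continuity\<close>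

definition winf :: "('s \<Rightarrow> real) \<Rightarrow> 'k \<Rightarrow> real" where
  "winf h \<omega> = (INF s. wt h s * Z \<omega> s)"

definition dualw :: "('s \<Rightarrow> real) \<Rightarrow> real" where
  "dualw h = integral\<^sup>L K (winf h)"

lemma abs_log_margin: "\<bar>log_margin G h s\<bar> = wt h s"
  using wt_nonneg[of h s] by (simp add: log_margin_def wt_def)

lemma dual_D_norm_log_margin: "dual_D_norm K Z (log_margin G h) = dualw h"
  by (simp add: dual_D_norm_def dualw_def winf_def[abs_def] abs_log_margin)

lemma adm_G_pos: "adm h \<Longrightarrow> G s (h s) > 0"
  using G_mono unfolding adm_def good_def by (meson less_le_trans)

lemma net_of_finite: "adm h \<Longrightarrow> finite (net_of h k)" and net_of_nonempty: "net_of h k \<noteq> {}"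
  by (auto simp: adm_def Efun_def net_of_def)

lemma good_wt_bounded:
  assumes "good h0"
  obtains b where "\<And>s. wt h0 s \<le> b"
proof -
  have "G s (h0 s) \<noteq> 0" for s using assms by (auto simp: good_def less_le)
  then have "continuous_on UNIV (wt h0)"
    unfolding wt_def[abs_def]
    by (intro continuous_intros continuous_on_ln continuous_G_compose continuous_on_apply_bcontfun) auto
  then obtain t where "\<And>s. wt h0 s \<le> wt h0 t"
    using continuous_attains_sup[OF cpt, of "wt h0"] by auto
  then show thesis by (rule that)
qed

lemma adm_wt_isCont:
  assumes "adm h" "isCont h s"
  shows "isCont (wt h) s"
proof -
  have "isCont (\<lambda>(s, x). G s x) (s, h s)"
    using continuous_G continuous_on_eq_continuous_at[OF open_UNIV] by blast
  moreover have "isCont (\<lambda>s. (s, h s)) s" using assms(2) by (intro continuous_Pair continuous_ident)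
  ultimately have "isCont (\<lambda>s. G s (h s)) s"
    using isCont_o2[of s "\<lambda>s. (s, h s)" "\<lambda>(s, x). G s x"] by simp
  then show ?thesis
    unfolding wt_def[abs_def] using adm_G_pos[OF assms(1), of s] by (intro continuous_intros) auto
qed

lemma wt_Z_nonneg: "\<omega> \<in> space K \<Longrightarrow> wt h s * Z \<omega> s \<ge> 0"
  using wt_nonneg Z_nonneg by simp

lemma wt_Z_bdd: "\<omega> \<in> space K \<Longrightarrow> bdd_below (range (\<lambda>s. wt h s * Z \<omega> s))"
  using wt_Z_nonneg by (intro bdd_belowI2)

lemma winf_le: "\<omega> \<in> space K \<Longrightarrow> winf h \<omega> \<le> wt h s * Z \<omega> s"
  unfolding winf_def by (intro cINF_lower wt_Z_bdd) auto

lemma winf_ge: "(\<And>s. a \<le> wt h s * Z \<omega> s) \<Longrightarrow> a \<le> winf h \<omega>"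
  unfolding winf_def by (rule cINF_greatest) auto

lemma winf_nonneg: "\<omega> \<in> space K \<Longrightarrow> winf h \<omega> \<ge> 0"
  by (rule winf_ge) (rule wt_Z_nonneg)

lemma wmin_tendsto_winf:
  assumes "adm h" "\<omega> \<in> space K"
  shows "(\<lambda>k. wmin (net_of h k) (wt h) \<omega>) \<longlonglongrightarrow> winf h \<omega>"
  unfolding wmin_def winf_def net_of_def
proof (rule Min_dense_tendsto_INF[OF dseq_dense wt_Z_bdd[OF assms(2)]])
  show "finite {s. \<not> isCont h s}" using assms by (auto simp: adm_def Efun_def)
  show "isCont (\<lambda>s. wt h s * Z \<omega> s) s" if "s \<notin> {s. \<not> isCont h s}" for s
    using that assms(1) by (intro continuous_intros adm_wt_isCont isCont_apply_bcontfun) auto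
qed

lemma wmin_measurable: "finite T \<Longrightarrow> T \<noteq> {} \<Longrightarrow> wmin T v \<in> borel_measurable K"
  unfolding wmin_def[abs_def] by (intro borel_measurable_Min) auto

lemma winf_measurable: "adm h \<Longrightarrow> winf h \<in> borel_measurable K"
  by (rule borel_measurable_LIMSEQ_real[OF wmin_tendsto_winf wmin_measurable[OF net_of_finite net_of_nonempty]])

lemma winf_integrable:
  assumes "adm h"
  shows "integrable K (winf h)"
proof (rule Bochner_Integration.integrable_bound[OF _ winf_measurable[OF assms]])
  fix s
  show "integrable K (\<lambda>\<omega>. wt h s * Z \<omega> s)" using Z_integrable by simp
  show "AE \<omega> in K. norm (winf h \<omega>) \<le> norm (wt h s * Z \<omega> s)"
  proof (rule AE_I2)
    fix \<omega> assume \<omega>: "\<omega> \<in> space K"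
    show "norm (winf h \<omega>) \<le> norm (wt h s * Z \<omega> s)"
      using winf_nonneg[OF \<omega>, of h] winf_le[OF \<omega>, of h s] wt_Z_nonneg[OF \<omega>, of h s] by simp
  qed
qed

lemma dualw_nonneg: "dualw h \<ge> 0"
  unfolding dualw_def by (rule integral_nonneg_AE) (auto intro: winf_nonneg)

lemma dualw_le_wt: "adm h \<Longrightarrow> dualw h \<le> wt h s"
proof -
  assume "adm h"
  then have "dualw h \<le> (\<integral>\<omega>. wt h s * Z \<omega> s \<partial>K)"
    unfolding dualw_def using Z_integrable by (intro integral_mono winf_integrable winf_le) auto
  then show ?thesis by (simp add: Z_expectation)
qed

lemma wmin_tendsto_dualw:
  assumes "adm h"
  shows "(\<lambda>k. integral\<^sup>L K (wmin (net_of h k) (wt h))) \<longlonglongrightarrow> dualw h"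
  unfolding dualw_def
proof (rule integral_dominated_convergence[where w="\<lambda>\<omega>. wt h (dseq 0) * Z \<omega> (dseq 0)"])
  show "AE \<omega> in K. norm (wmin (net_of h k) (wt h) \<omega>) \<le> wt h (dseq 0) * Z \<omega> (dseq 0)" for k
  proof (rule AE_I2)
    fix \<omega> assume "\<omega> \<in> space K"
    then have "0 \<le> wmin (net_of h k) (wt h) \<omega>"
      unfolding wmin_def using net_of_finite[OF assms] net_of_nonempty wt_Z_nonneg by (subst Min_ge_iff) auto
    moreover have "wmin (net_of h k) (wt h) \<omega> \<le> wt h (dseq 0) * Z \<omega> (dseq 0)"
      unfolding wmin_def using net_of_finite[OF assms] by (intro Min_le) (auto simp: net_of_def)
    ultimately show "norm (wmin (net_of h k) (wt h) \<omega>) \<le> wt h (dseq 0) * Z \<omega> (dseq 0)" by simp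
  qed
qed (use assms Z_integrable in \<open>auto intro!: winf_measurable wmin_measurable net_of_finite net_of_nonempty wmin_tendsto_winf AE_I2\<close>)

lemma dualw_le_wmin:
  assumes "adm h" "finite T" "T \<noteq> {}"
  shows "dualw h \<le> integral\<^sup>L K (wmin T (wt h))"
proof -
  obtain t where t: "t \<in> T" using assms by blast
  have "integrable K (wmin T (wt h))"
  proof (rule Bochner_Integration.integrable_bound)
    show "AE \<omega> in K. norm (wmin T (wt h) \<omega>) \<le> norm (wt h t * Z \<omega> t)"
    proof (rule AE_I2)
      fix \<omega> assume \<omega>: "\<omega> \<in> space K"
      then have "0 \<le> wmin T (wt h) \<omega>"
        unfolding wmin_def using assms wt_Z_nonneg by (subst Min_ge_iff) auto
      moreover have "wmin T (wt h) \<omega> \<le> wt h t * Z \<omega> t"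
        unfolding wmin_def using assms t by (intro Min_le) auto
      ultimately show "norm (wmin T (wt h) \<omega>) \<le> norm (wt h t * Z \<omega> t)" using wt_Z_nonneg[OF \<omega>, of h t] by simp
    qed
  qed (use Z_integrable assms in \<open>auto intro: wmin_measurable\<close>)
  then show ?thesis
    unfolding dualw_def using assms
    by (intro integral_mono winf_integrable) (auto simp: wmin_def intro!: winf_le)
qed

lemma Zsup_expectation_nonneg: "integral\<^sup>L K Zsup \<ge> 0"
  by (rule integral_nonneg_AE) (auto intro: Zsup_nonneg)

lemma dualw_le_add:
  assumes "adm h" "adm h'" "e \<ge> 0" "\<And>s. wt h s \<le> wt h' s + e"
  shows "dualw h \<le> dualw h' + e * integral\<^sup>L K Zsup"
proof -
  have "dualw h \<le> (\<integral>\<omega>. winf h' \<omega> + e * Zsup \<omega> \<partial>K)"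
    unfolding dualw_def
  proof (rule integral_mono)
    fix \<omega> assume \<omega>: "\<omega> \<in> space K"
    have "winf h \<omega> - e * Zsup \<omega> \<le> winf h' \<omega>"
    proof (rule winf_ge)
      fix s
      have "winf h \<omega> \<le> (wt h' s + e) * Z \<omega> s"
        using winf_le[OF \<omega>, of h s] mult_right_mono[OF assms(4) Z_nonneg[OF \<omega>], of s s] by linarith
      also have "\<dots> \<le> wt h' s * Z \<omega> s + e * Zsup \<omega>"
        using mult_left_mono[OF Zsup_upper assms(3), of \<omega> s] by (simp add: distrib_right)
      finally show "winf h \<omega> - e * Zsup \<omega> \<le> wt h' s * Z \<omega> s" by simp
    qed
    then show "winf h \<omega> \<le> winf h' \<omega> + e * Zsup \<omega>" by simp
  qed (use assms Zsup_integrable in \<open>auto intro!: winf_integrable\<close>)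
  also have "\<dots> = dualw h' + e * integral\<^sup>L K Zsup"
    using assms Zsup_integrable by (simp add: dualw_def winf_integrable)
  finally show ?thesis .
qed

lemma dualw_antimono: "adm h \<Longrightarrow> adm h' \<Longrightarrow> (\<And>s. h s \<le> h' s) \<Longrightarrow> dualw h' \<le> dualw h"
  using dualw_le_add[of h' h 0] wt_antimono[of _ h h'] adm_G_pos[of h] by simp

lemma adm_mono: "adm h \<Longrightarrow> h' \<in> Efun \<Longrightarrow> (\<And>s. h s \<le> h' s) \<Longrightarrow> adm h'"
  unfolding adm_def by (meson order_trans)

lemma Efun_add_const:
  assumes "h \<in> Efun"
  shows "(\<lambda>s. h s + e) \<in> Efun"
proof -
  have "bounded ((\<lambda>x. x + e) ` range h)"
    using assms bounded_translation[of "range h" e] by (simp add: Efun_def add.commute[of _ e] image_image)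
  moreover have "{s. \<not> isCont (\<lambda>s. h s + e) s} \<subseteq> {s. \<not> isCont h s}"
    by (auto intro: continuous_intros)
  ultimately show ?thesis
    using assms by (auto simp: Efun_def image_image intro: finite_subset)
qed

text \<open>Comparison functions may be discontinuous; confining them between one good function and
  a constant is enough for a common modulus, by \<open>ln_G_uniform\<close>.\<close>

lemma dualw_uniform:
  assumes h1: "good h1" and r: "r > 0"
  obtains \<delta> where "\<delta> > 0" "\<And>g g'. g \<in> Efun \<Longrightarrow> g' \<in> Efun \<Longrightarrow> (\<And>s. h1 s \<le> g s \<and> g s \<le> B) \<Longrightarrow>
    (\<And>s. h1 s \<le> g' s \<and> g' s \<le> B) \<Longrightarrow> (\<And>s. \<bar>g s - g' s\<bar> < \<delta>) \<Longrightarrow> dualw g \<le> dualw g' + r"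
proof -
  \<comment> \<open>Changing the weights by \<open>r'\<close> changes \<open>dualw\<close> by at
    most \<open>r' * E(sup Z)\<close>. The summand 1 keeps the denominator positive.\<close>
  define r' where "r' = r / (integral\<^sup>L K Zsup + 1)"
  have r': "r' > 0" "r' * integral\<^sup>L K Zsup \<le> r"
    using r Zsup_expectation_nonneg by (auto simp: r'_def field_simps)
  obtain \<delta> where \<delta>: "\<delta> > 0" "\<And>s y y'. h1 s \<le> y \<Longrightarrow> h1 s \<le> y' \<Longrightarrow> y \<le> B \<Longrightarrow> y' \<le> B \<Longrightarrow> \<bar>y - y'\<bar> < \<delta> \<Longrightarrow>
    \<bar>ln (G s y) - ln (G s y')\<bar> < r'"
    using ln_G_uniform[OF h1 r'(1), of B] by blast
  show thesis
  proof (rule that[OF \<delta>(1)])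
    fix g g' assume E: "g \<in> Efun" "g' \<in> Efun"
      and g: "\<And>s. h1 s \<le> g s \<and> g s \<le> B" "\<And>s. h1 s \<le> g' s \<and> g' s \<le> B" "\<And>s. \<bar>g s - g' s\<bar> < \<delta>"
    have adm: "adm g" "adm g'" using E g h1 by (auto simp: adm_def)
    have "wt g s \<le> wt g' s + r'" for s
    proof -
      have "\<bar>ln (G s (g s)) - ln (G s (g' s))\<bar> < r'" using g by (intro \<delta>(2)) auto
      then show ?thesis unfolding wt_def by linarith
    qed
    then have "dualw g \<le> dualw g' + r' * integral\<^sup>L K Zsup"
      using adm r' by (intro dualw_le_add) auto
    then show "dualw g \<le> dualw g' + r" using r'(2) by linarith
  qed
qed

lemma dualw_shift:
  assumes "adm h" "r > 0"
  obtains e where "e > 0" "dualw h \<le> dualw (\<lambda>s. h s + e) + r"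
proof -
  obtain h0 where h0: "good h0" "\<And>s. h0 s \<le> h s" using assms by (auto simp: adm_def)
  obtain B where B: "\<And>s. \<bar>h s\<bar> \<le> B" using assms by (auto simp: adm_def Efun_def bounded_iff)
  obtain \<delta> where \<delta>: "\<delta> > 0" "\<And>g g'. g \<in> Efun \<Longrightarrow> g' \<in> Efun \<Longrightarrow> (\<And>s. h0 s \<le> g s \<and> g s \<le> B + 1) \<Longrightarrow>
    (\<And>s. h0 s \<le> g' s \<and> g' s \<le> B + 1) \<Longrightarrow> (\<And>s. \<bar>g s - g' s\<bar> < \<delta>) \<Longrightarrow> dualw g \<le> dualw g' + r"
    using dualw_uniform[OF h0(1) assms(2), of "B + 1"] by blast
  define e where "e = min (\<delta>/2) 1"
  have e: "e > 0" "e < \<delta>" "e \<le> 1" using \<delta>(1) by (auto simp: e_def)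
  have "h0 s \<le> h s \<and> h s \<le> B + 1" "h0 s \<le> h s + e \<and> h s + e \<le> B + 1" for s
    using h0(2)[of s] B[of s] e by (simp_all add: abs_le_iff)
  then have "dualw h \<le> dualw (\<lambda>s. h s + e) + r"
    using assms e by (intro \<delta>(2) Efun_add_const) (auto simp: adm_def)
  then show thesis by (rule that[OF e(1)])
qed

text \<open>The power is the probability that the normalized maximum stays below \<open>h0\<close>.
  It remains bounded away from 0 because \<open>\<theta>\<close> lies strictly below
  \<open>h0\<close> with positive probability.\<close>

lemma power_le_bounded_below:
  assumes "good h0"
  obtains \<kappa> where "\<kappa> > 0" "\<forall>\<^sub>F n in sequentially. measure \<mu> {x. \<forall>s. nrm n x s \<le> h0 s} ^ n > \<kappa>"
proof -
  obtain b where b: "\<And>s. wt h0 s \<le> b" using good_wt_bounded[OF assms] by blast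
  have "b \<ge> 0" using b wt_nonneg order_trans by blast
  let ?U = "{y :: 's \<Rightarrow>\<^sub>C real. \<forall>s\<in>UNIV. y s < h0 s}"
  have U: "open ?U" by (intro open_bcontfun_less cpt continuous_on_apply_bcontfun)
  \<comment> \<open>The weights of \<open>h0\<close> are at most \<open>b\<close>, so
    \<open>\<eta> \<le> - (b + 1)\<close> places \<open>\<theta>\<close> strictly below
    \<open>h0\<close>.\<close>
  have b1: "(\<lambda>_. - (b + 1)) \<in> Enonpos" using \<open>b \<ge> 0\<close> by (intro const_Enonpos) simp
  have "0 < measure N {\<omega>\<in>space N. \<forall>s. log_margin G (\<theta> \<omega>) s \<le> - (b + 1)}"
    unfolding eta_le(2)[OF b1] by simp
  also have "\<dots> \<le> measure N {\<omega>\<in>space N. \<theta> \<omega> \<in> ?U}"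
  proof (rule N.finite_measure_mono)
    have "\<theta> \<omega> s < h0 s" if "log_margin G (\<theta> \<omega>) s \<le> - (b + 1)" for \<omega> s
    proof (rule ccontr)
      assume "\<not> ?thesis"
      then have "G s (h0 s) \<le> G s (\<theta> \<omega> s)" by (intro G_mono) auto
      moreover have "G s (h0 s) > 0" using assms by (simp add: good_def)
      ultimately have "ln (G s (h0 s)) \<le> ln (G s (\<theta> \<omega> s))" by simp
      with that b[of s] show False by (simp add: log_margin_def wt_def)
    qed
    then show "{\<omega> \<in> space N. \<forall>s. log_margin G (\<theta> \<omega>) s \<le> - (b + 1)} \<subseteq> {\<omega>\<in>space N. \<theta> \<omega> \<in> ?U}" by auto
    show "{\<omega>\<in>space N. \<theta> \<omega> \<in> ?U} \<in> sets N"
      by (rule theta_vimage_sets[OF borel_open[OF U]])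
  qed
  finally have pos: "measure N {\<omega>\<in>space N. \<theta> \<omega> \<in> ?U} > 0" .
  define \<kappa> where "\<kappa> = measure N {\<omega>\<in>space N. \<theta> \<omega> \<in> ?U} / 2"
  have \<kappa>: "\<kappa> > 0" using pos by (simp add: \<kappa>_def)
  have "\<forall>\<^sub>F n in sequentially. measure M {\<omega>\<in>space M. Mn n n \<omega> \<in> ?U} > measure N {\<omega>\<in>space N. \<theta> \<omega> \<in> ?U} - \<kappa>"
    by (rule Mn_open[OF U \<kappa>])
  with eventually_ge_at_top[of 1]
  have "\<forall>\<^sub>F n in sequentially. measure \<mu> {x. \<forall>s. nrm n x s \<le> h0 s} ^ n > \<kappa>"
  proof eventually_elim
    case (elim n)
    have "measure M {\<omega>\<in>space M. Mn n n \<omega> \<in> ?U} \<le> measure M {\<omega>\<in>space M. \<forall>s\<in>UNIV. Mn n n \<omega> s \<le> h0 s}"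
    proof (rule M.finite_measure_mono)
      show "{\<omega>\<in>space M. \<forall>s\<in>UNIV. Mn n n \<omega> s \<le> h0 s} \<in> sets M"
        using Mn_vimage_sets[OF elim(1,1) borel_closed[OF closed_le_on[of UNIV h0]]] by simp
    qed (auto intro: less_imp_le)
    also have "\<dots> = measure \<mu> {x. \<forall>s. nrm n x s \<le> h0 s} ^ n"
      using le_power_Mn[OF elim(1), of UNIV h0] by simp
    finally show ?case using elim(2) by (simp add: \<kappa>_def)
  qed
  then show thesis by (rule that[OF \<kappa>])
qed

text \<open>A closed set containing the paths that clear \<open>h\<close> by \<open>e\<close> on
  \<open>T\<close> but fail to exceed \<open>h\<close> somewhere. The infimum replaces the existence
  of a point with \<open>y s \<le> h s\<close>, which would not be a closed condition for
  discontinuous \<open>h\<close>.\<close>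

definition crossing :: "('s \<Rightarrow> real) \<Rightarrow> real \<Rightarrow> 's set \<Rightarrow> ('s \<Rightarrow>\<^sub>C real) set" where
  "crossing h e T = {y :: 's \<Rightarrow>\<^sub>C real. (\<forall>s\<in>T. h s + e \<le> y s) \<and> (INF s. y s - h s) \<le> 0}"

lemma closed_crossing:
  assumes "bounded (range h)"
  shows "closed (crossing h e T)"
proof -
  have "closed ((\<Inter>s\<in>T. {y :: 's \<Rightarrow>\<^sub>C real. h s + e \<le> y s}) \<inter> {y. (INF s. apply_bcontfun y s - h s) \<le> 0})"
    by (rule closed_Int[OF _ closed_INF_le[OF assms]])
      (intro closed_INT ballI closed_Collect_le continuous_on_eval_bcontfun continuous_on_const)
  also have "(\<Inter>s\<in>T. {y :: 's \<Rightarrow>\<^sub>C real. h s + e \<le> y s}) \<inter> {y. (INF s. apply_bcontfun y s - h s) \<le> 0} = crossing h e T"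
    by (auto simp: crossing_def)
  finally show ?thesis .
qed

text \<open>The sets decrease in \<open>k\<close>. A path in all of them clears \<open>h\<close> by
  \<open>e\<close> on a dense sequence and at the discontinuities of \<open>h\<close>, hence
  everywhere, which contradicts a nonpositive infimum.\<close>

lemma theta_crossing_tendsto_0:
  assumes "adm h" "e > 0"
  shows "(\<lambda>k. measure N {\<omega>\<in>space N. \<theta> \<omega> \<in> crossing h e (net_of h k)}) \<longlonglongrightarrow> 0"
proof -
  have bdd: "bounded (range h)" using assms by (simp add: adm_def Efun_def)
  let ?A = "\<lambda>k. {\<omega>\<in>space N. \<theta> \<omega> \<in> crossing h e (net_of h k)}"
  have "range ?A \<subseteq> sets N"
    using theta_vimage_sets[OF borel_closed[OF closed_crossing[OF bdd]]] by auto
  moreover have "decseq ?A" by (auto simp: decseq_def crossing_def net_of_def)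
  ultimately have "(\<lambda>k. measure N (?A k)) \<longlonglongrightarrow> measure N (\<Inter>k. ?A k)"
    by (rule N.finite_Lim_measure_decseq)
  moreover have "\<theta> \<omega> \<notin> (\<Inter>k. crossing h e (net_of h k))" for \<omega>
  proof
    assume *: "\<theta> \<omega> \<in> (\<Inter>k. crossing h e (net_of h k))"
    have T: "h s + e \<le> \<theta> \<omega> s" if "s \<in> net_of h k" for s k
      using * that by (auto simp: crossing_def)
    have "e \<le> \<theta> \<omega> s - h s" for s
    proof (cases "isCont h s")
      case False
      then show ?thesis using T[of s 0] by (simp add: net_of_def)
    next
      case True
      show ?thesis
      proof (rule ccontr)
        assume "\<not> ?thesis"
        then have "\<exists>d>0. \<forall>t. dist s t < d \<longrightarrow> - e < - (\<theta> \<omega> t - h t)"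
          using True by (intro isCont_dist_greater continuous_intros isCont_apply_bcontfun) auto
        then obtain d where d: "d > 0" "\<And>t. dist s t < d \<Longrightarrow> - e < - (\<theta> \<omega> t - h t)" by blast
        obtain n where "dist s (dseq n) < d" using dseq_dense[OF d(1)] by blast
        then show False using d(2)[of "dseq n"] T[of "dseq n" n] by (simp add: net_of_def)
      qed
    qed
    then have "e \<le> (INF s. \<theta> \<omega> s - h s)" by (intro cINF_greatest) auto
    moreover have "(INF s. \<theta> \<omega> s - h s) \<le> 0" using * by (auto simp: crossing_def)
    ultimately show False using assms by simp
  qed
  then have "(\<Inter>k. ?A k) = {}" by blast
  ultimately show ?thesis by simp
qed

text \<open>If path \<open>i\<close> crosses \<open>h\<close> while all others stay below \<open>h0\<close>, then the maximum crosses \<open>h\<close>; these events are disjoint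
  in \<open>i\<close>. Thus tightness of the maxima passes to the single large paths.\<close>

lemma crossing_single_path:
  assumes "bounded (range h)" "e > 0" "T \<noteq> {}" "\<And>s. h0 s \<le> h s" "n \<ge> 1"
  shows "real n * measure \<mu> {x. nrm_path n x \<in> crossing h e T} * measure \<mu> {x. \<forall>s. nrm n x s \<le> h0 s} ^ (n - 1) \<le>
    measure M {\<omega>\<in>space M. Mn n n \<omega> \<in> crossing h e T}"
proof -
  let ?C = "{x. nrm_path n x \<in> crossing h e T}" and ?L = "{x. \<forall>s. nrm n x s \<le> h0 s}"
  have C: "?C \<in> sets borel" by (rule nrm_path_vimage[OF assms(5) borel_closed[OF closed_crossing[OF assms(1)]]])
  have "{x. nrm_path n x \<in> {y. \<forall>s\<in>UNIV. apply_bcontfun y s \<le> h0 s}} \<in> sets borel"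
    by (rule nrm_path_vimage[OF assms(5) borel_closed[OF closed_le_on]])
  then have L: "?L \<in> sets borel" using assms by (simp add: apply_nrm_path)
  define A where "A i j = (if j = i then ?C else ?L)" for i j :: nat
  define E where "E i = {\<omega>\<in>space M. \<forall>j\<in>{1..n}. Xs j \<omega> \<in> A i j}" for i
  have A: "A i j \<in> sets borel" for i j using C L by (simp add: A_def)
  have E_sets: "E i \<in> sets M" for i
  proof -
    have "E i = (\<Inter>j\<in>{1..n}. Xs j -` A i j \<inter> space M)" using assms(5) by (auto simp: E_def)
    also have "\<dots> \<in> sets M"
      using assms(5) by (intro sets.finite_INT measurable_sets[OF Xs_measurable A]) auto
    finally show ?thesis .
  qed
  have E_measure: "measure M (E i) = measure \<mu> ?C * measure \<mu> ?L ^ (n - 1)" if "i \<in> {1..n}" for i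
  proof -
    have "measure M (E i) = (\<Prod>j\<in>{1..n}. measure \<mu> (A i j))"
      unfolding E_def by (rule measure_box) (use assms(5) A in auto)
    also have "\<dots> = measure \<mu> (A i i) * (\<Prod>j\<in>{1..n} - {i}. measure \<mu> (A i j))"
      using that by (intro prod.remove) auto
    also have "(\<Prod>j\<in>{1..n} - {i}. measure \<mu> (A i j)) = (\<Prod>j\<in>{1..n} - {i}. measure \<mu> ?L)"
      by (rule prod.cong) (auto simp: A_def)
    also have "\<dots> = measure \<mu> ?L ^ (n - 1)" using that by simp
    finally show ?thesis by (simp add: A_def)
  qed
  obtain t where t: "t \<in> T" using assms by blast
  have disj: "disjoint_family_on E {1..n}"
  proof (unfold disjoint_family_on_def, safe)
    fix i j \<omega> assume ij: "i \<in> {1..n}" "j \<in> {1..n}" "i \<noteq> j" "\<omega> \<in> E i" "\<omega> \<in> E j"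
    then have "Xs i \<omega> \<in> A i i" "Xs i \<omega> \<in> A j i" by (auto simp: E_def)
    then have "h t + e \<le> nrm n (Xs i \<omega>) t" "nrm n (Xs i \<omega>) t \<le> h0 t"
      using ij t assms(5) by (auto simp: A_def crossing_def apply_nrm_path)
    with assms(2) assms(4)[of t] show "\<omega> \<in> {}" by simp
  qed
  have sub: "E i \<subseteq> {\<omega>\<in>space M. Mn n n \<omega> \<in> crossing h e T}" if i: "i \<in> {1..n}" for i
  proof
    fix \<omega> assume \<omega>: "\<omega> \<in> E i"
    then have mem: "Xs j \<omega> \<in> A i j" if "j \<in> {1..n}" for j using that by (auto simp: E_def)
    have Xi: "Xs i \<omega> \<in> ?C" using mem[OF i] by (simp add: A_def)
    have Xj: "nrm n (Xs j \<omega>) s \<le> h0 s" if "j \<in> {1..n}" "j \<noteq> i" for j s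
      using mem[OF that(1)] that(2) by (simp add: A_def)
    have "h s + e \<le> Mn n n \<omega> s" if "s \<in> T" for s
    proof -
      have "h s + e \<le> nrm n (Xs i \<omega>) s" using Xi that assms(5) by (auto simp: crossing_def apply_nrm_path)
      also have "\<dots> \<le> Mn n n \<omega> s" by (rule Mn_ge[OF i assms(5)])
      finally show ?thesis .
    qed
    \<comment> \<open>The infimum for path \<open>i\<close> need not be attained, hence the slack
      \<open>r\<close>. At a point where path \<open>i\<close> is below \<open>h + r\<close> the
      others are below \<open>h0 \<le> h\<close>, so the maximum is below \<open>h + r\<close>
      too.\<close>
    moreover have "(INF s. Mn n n \<omega> s - h s) \<le> 0"
    proof (rule field_le_epsilon)
      fix r :: real assume r: "r > 0"
      have "(INF s. nrm_path n (Xs i \<omega>) s - h s) < r" using Xi r by (auto simp: crossing_def)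
      then obtain s where s: "nrm n (Xs i \<omega>) s - h s < r"
        using cINF_less_iff[OF _ bdd_below_diff[OF assms(1), of "nrm_path n (Xs i \<omega>)"], of r] assms(5) by (auto simp: apply_nrm_path)
      have "Mn n n \<omega> s \<le> h s + r"
        unfolding Mn_le_iff[OF assms(5,5)]
      proof
        fix j assume j: "j \<in> {1..n}"
        show "nrm n (Xs j \<omega>) s \<le> h s + r"
          using s r assms(4)[of s] Xj[OF j, of s] by (cases "j = i") auto
      qed
      moreover have "(INF s. Mn n n \<omega> s - h s) \<le> Mn n n \<omega> s - h s"
        by (rule cINF_lower[OF bdd_below_diff[OF assms(1)]]) simp
      ultimately show "(INF s. Mn n n \<omega> s - h s) \<le> 0 + r" by simp
    qed
    ultimately show "\<omega> \<in> {\<omega>\<in>space M. Mn n n \<omega> \<in> crossing h e T}"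
      using \<omega> unfolding crossing_def E_def by blast
  qed
  have "real n * measure \<mu> ?C * measure \<mu> ?L ^ (n - 1) = (\<Sum>i\<in>{1..n}. measure M (E i))"
    by (simp add: E_measure)
  also have "\<dots> = measure M (\<Union>i\<in>{1..n}. E i)"
    using E_sets disj by (intro M.finite_measure_finite_Union[symmetric]) auto
  also have "\<dots> \<le> measure M {\<omega>\<in>space M. Mn n n \<omega> \<in> crossing h e T}"
  proof (rule M.finite_measure_mono)
    show "{\<omega>\<in>space M. Mn n n \<omega> \<in> crossing h e T} \<in> sets M"
      by (rule Mn_vimage_sets[OF assms(5,5) borel_closed[OF closed_crossing[OF assms(1)]]])
    show "(\<Union>i\<in>{1..n}. E i) \<subseteq> {\<omega>\<in>space M. Mn n n \<omega> \<in> crossing h e T}"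
      by (rule UN_least) (rule sub)
  qed
  finally show ?thesis .
qed

lemma sets_exceed:
  assumes "n \<ge> 1" "h \<in> Efun"
  shows "{x. \<forall>s. nrm n x s > h s} \<in> sets borel"
proof -
  have "{x. nrm_path n x \<in> {y. \<forall>s. h s < apply_bcontfun y s}} \<in> sets borel"
    using assms by (intro nrm_path_vimage sets_bcontfun_greater cpt) (auto simp: Efun_def)
  then show ?thesis using assms by (simp add: apply_nrm_path)
qed

text \<open>The upper bound holds for every finite net and passes to the limit of the nets. For the
  lower bound, a path above \<open>h + e\<close> on the net exceeds \<open>h\<close> everywhere
  unless it is a crossing path, and crossing paths are rare even after multiplication by
  \<open>n\<close>.\<close>

lemma exceed_all:
  assumes "adm h"
  shows "(\<lambda>n. real n * measure \<mu> {x. \<forall>s. nrm n x s > h s}) \<longlonglongrightarrow> dualw h"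
proof (rule order_tendstoI)
  fix a assume a: "dualw h < a"
  obtain k where k: "integral\<^sup>L K (wmin (net_of h k) (wt h)) < a"
    using order_tendstoD(2)[OF wmin_tendsto_dualw[OF assms] a] by (auto simp: eventually_sequentially)
  have "\<forall>\<^sub>F n in sequentially. real n * measure \<mu> {x. \<forall>s\<in>net_of h k. nrm n x s > h s} < a"
    by (rule order_tendstoD(2)[OF exceed_all_finite k]) (auto intro: net_of_finite assms adm_G_pos simp: net_of_nonempty)
  then show "\<forall>\<^sub>F n in sequentially. real n * measure \<mu> {x. \<forall>s. nrm n x s > h s} < a"
  proof eventually_elim
    case (elim n)
    have "{x\<in>space \<mu>. \<forall>s\<in>net_of h k. nrm n x s > h s} \<in> sets \<mu>"
      using net_of_finite[OF assms, of k] by measurable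
    then have "measure \<mu> {x. \<forall>s. nrm n x s > h s} \<le> measure \<mu> {x. \<forall>s\<in>net_of h k. nrm n x s > h s}"
      by (intro mu.finite_measure_mono) auto
    then have "real n * measure \<mu> {x. \<forall>s. nrm n x s > h s} \<le> real n * measure \<mu> {x. \<forall>s\<in>net_of h k. nrm n x s > h s}"
      by (intro mult_left_mono) auto
    with elim show ?case by linarith
  qed
next
  fix a assume a: "a < dualw h"
  obtain h0 where h0: "good h0" "\<And>s. h0 s \<le> h s" using assms by (auto simp: adm_def)
  have bdd: "bounded (range h)" using assms by (simp add: adm_def Efun_def)
  \<comment> \<open>Three losses of size \<open>r\<close> occur: raising \<open>h\<close> by
    \<open>e\<close>, the approximation on the net, and the crossing paths.\<close>
  define r where "r = (dualw h - a) / 3"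
  have r: "r > 0" using a by (simp add: r_def)
  obtain e where e: "e > 0" "dualw h \<le> dualw (\<lambda>s. h s + e) + r" using dualw_shift[OF assms r] by blast
  have adm': "adm (\<lambda>s. h s + e)"
    using assms e by (intro adm_mono[OF assms] Efun_add_const) (auto simp: adm_def)
  obtain \<kappa> where \<kappa>: "\<kappa> > 0" "\<forall>\<^sub>F n in sequentially. measure \<mu> {x. \<forall>s. nrm n x s \<le> h0 s} ^ n > \<kappa>"
    using power_le_bounded_below[OF h0(1)] by blast
  \<comment> \<open>Two errors of this size, for the limit law and for the weak convergence, keep
    the crossing probability of the maximum below \<open>\<kappa> * r\<close>. Dividing by \<kappa>,
    the lower bound for the other paths being low, leaves \<open>r\<close> for a single
    path.\<close>
  have kr: "\<kappa> * r / 2 > 0" using \<kappa> r by simp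
  obtain k where k: "measure N {\<omega>\<in>space N. \<theta> \<omega> \<in> crossing h e (net_of h k)} < \<kappa> * r / 2"
    using order_tendstoD(2)[OF theta_crossing_tendsto_0[OF assms e(1)] kr] by (auto simp: eventually_sequentially)
  let ?T = "net_of h k"
  have T: "finite ?T" "?T \<noteq> {}" using net_of_finite[OF assms] net_of_nonempty by auto
  have "dualw (\<lambda>s. h s + e) - r < integral\<^sup>L K (wmin ?T (wt (\<lambda>s. h s + e)))"
    using dualw_le_wmin[OF adm' T] r by linarith
  then have ev1: "\<forall>\<^sub>F n in sequentially. dualw (\<lambda>s. h s + e) - r < real n * measure \<mu> {x. \<forall>s\<in>?T. nrm n x s > h s + e}"
    using adm_G_pos[OF adm'] by (intro order_tendstoD(1)[OF exceed_all_finite[OF T]]) auto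
  have ev2: "\<forall>\<^sub>F n in sequentially. measure M {\<omega>\<in>space M. Mn n n \<omega> \<in> crossing h e ?T} <
      measure N {\<omega>\<in>space N. \<theta> \<omega> \<in> crossing h e ?T} + \<kappa> * r / 2"
    by (rule Mn_closed[OF closed_crossing[OF bdd] kr])
  show "\<forall>\<^sub>F n in sequentially. a < real n * measure \<mu> {x. \<forall>s. nrm n x s > h s}"
    using ev1 ev2 \<kappa>(2) eventually_ge_at_top[of 1]
  proof eventually_elim
    case (elim n)
    let ?p = "measure \<mu> {x. \<forall>s. nrm n x s \<le> h0 s}"
    let ?C = "{x. nrm_path n x \<in> crossing h e ?T}"
    have C: "?C \<in> sets borel" by (rule nrm_path_vimage[OF elim(4) borel_closed[OF closed_crossing[OF bdd]]])
    have "?p ^ n \<le> ?p ^ (n - 1)" by (rule power_decreasing) auto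
    then have "real n * measure \<mu> ?C * \<kappa> \<le> real n * measure \<mu> ?C * ?p ^ (n - 1)"
      using elim(3) by (intro mult_left_mono) auto
    also have "\<dots> \<le> measure M {\<omega>\<in>space M. Mn n n \<omega> \<in> crossing h e ?T}"
      by (rule crossing_single_path[OF bdd e(1) T(2) h0(2) elim(4)])
    also have "\<dots> < r * \<kappa>" using elim(2) k by (simp add: mult.commute)
    finally have Cr: "real n * measure \<mu> ?C < r" using \<kappa>(1) by simp
    have S: "{x. \<forall>s. nrm n x s > h s} \<in> sets \<mu>"
      using sets_exceed[OF elim(4), of h] assms by (simp add: adm_def)
    have "{x. \<forall>s\<in>?T. nrm n x s > h s + e} \<subseteq> {x. \<forall>s. nrm n x s > h s} \<union> ?C"
    proof safe
      fix x s assume x: "\<forall>s\<in>?T. nrm n x s > h s + e" "nrm_path n x \<notin> crossing h e ?T"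
      then have "\<not> (INF s. nrm_path n x s - h s) \<le> 0"
        using elim(4) by (auto simp: crossing_def apply_nrm_path less_imp_le)
      moreover have "(INF s. nrm_path n x s - h s) \<le> nrm_path n x s - h s"
        by (rule cINF_lower[OF bdd_below_diff[OF bdd]]) simp
      ultimately show "h s < nrm n x s" using elim(4) by (simp add: apply_nrm_path)
    qed
    then have "measure \<mu> {x. \<forall>s\<in>?T. nrm n x s > h s + e} \<le> measure \<mu> ({x. \<forall>s. nrm n x s > h s} \<union> ?C)"
      using S C by (intro mu.finite_measure_mono) auto
    also have "\<dots> \<le> measure \<mu> {x. \<forall>s. nrm n x s > h s} + measure \<mu> ?C"
      using S C by (intro measure_Un_le) auto
    finally have le: "measure \<mu> {x. \<forall>s\<in>?T. nrm n x s > h s + e} \<le>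
        measure \<mu> {x. \<forall>s. nrm n x s > h s} + measure \<mu> ?C" .
    have "real n * measure \<mu> {x. \<forall>s\<in>?T. nrm n x s > h s + e} \<le>
        real n * (measure \<mu> {x. \<forall>s. nrm n x s > h s} + measure \<mu> ?C)"
      by (rule mult_left_mono[OF le]) simp
    also have "\<dots> = real n * measure \<mu> {x. \<forall>s. nrm n x s > h s} + real n * measure \<mu> ?C"
      by (rule distrib_left)
    finally have "real n * measure \<mu> {x. \<forall>s\<in>?T. nrm n x s > h s + e} \<le>
        real n * measure \<mu> {x. \<forall>s. nrm n x s > h s} + real n * measure \<mu> ?C" .
    then have "dualw h - 3 * r < real n * measure \<mu> {x. \<forall>s. nrm n x s > h s}"
      using elim(1) e(2) Cr by linarith
    moreover have "3 * r = dualw h - a" unfolding r_def by simp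
    ultimately show ?case by linarith
  qed
qed

end

subsection \<open>Records and the preceding maximum\<close>

lemma Efun_max:
  assumes "f \<in> Efun" "g \<in> Efun"
  shows "(\<lambda>s. max (f s) (g s)) \<in> Efun"
proof -
  obtain a b where "\<And>s. \<bar>f s\<bar> \<le> a" "\<And>s. \<bar>g s\<bar> \<le> b"
    using assms by (auto simp: Efun_def bounded_iff)
  then have "\<bar>max (f s) (g s)\<bar> \<le> max a b" for s by (simp add: max_def) (meson linear order_trans)
  then have "bounded (range (\<lambda>s. max (f s) (g s)))" by (auto simp: bounded_iff)
  moreover have "{s. \<not> isCont (\<lambda>s. max (f s) (g s)) s} \<subseteq> {s. \<not> isCont f s} \<union> {s. \<not> isCont g s}"
    by (auto intro: continuous_max)
  ultimately show ?thesis using assms by (auto simp: Efun_def intro: finite_subset)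
qed

lemma bcontfun_Efun: "apply_bcontfun h \<in> Efun"
  using bcontfun_abs_le[of h] by (auto simp: Efun_def bounded_iff isCont_apply_bcontfun)

context record_setting begin

text \<open>On a compact space strict pointwise inequality is uniform, hence decided on a dense sequence.\<close>

lemma less_iff_dense:
  fixes h y :: "'s \<Rightarrow>\<^sub>C real"
  shows "(\<forall>s. h s < y s) \<longleftrightarrow> (\<exists>m. \<forall>k. h (dseq k) + inverse (real (Suc m)) \<le> y (dseq k))"
proof
  assume "\<forall>s. h s < y s"
  then obtain e where e: "e > 0" "\<And>s. y s \<ge> h s + e"
    using bcontfun_eventually_gt[OF cpt _ continuous_on_apply_bcontfun, of h y] by auto
  obtain m where "inverse (real (Suc m)) < e" using reals_Archimedean[OF e(1)] by blast
  then have "h (dseq k) + inverse (real (Suc m)) \<le> y (dseq k)" for k using e(2)[of "dseq k"] by linarith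
  then show "\<exists>m. \<forall>k. h (dseq k) + inverse (real (Suc m)) \<le> y (dseq k)" by blast
next
  assume "\<exists>m. \<forall>k. h (dseq k) + inverse (real (Suc m)) \<le> y (dseq k)"
  then obtain m where m: "\<And>k. h (dseq k) + inverse (real (Suc m)) \<le> y (dseq k)" by blast
  show "\<forall>s. h s < y s"
  proof (rule allI, rule ccontr)
    fix s assume "\<not> h s < y s"
    then have "\<exists>d>0. \<forall>t. dist s t < d \<longrightarrow> - inverse (real (Suc m)) < h t - y t"
    proof (intro isCont_dist_greater continuous_intros isCont_apply_bcontfun)
      assume "\<not> h s < y s"
      moreover have "inverse (real (Suc m)) > 0" by simp
      ultimately show "- inverse (real (Suc m)) < h s - y s" by linarith
    qed
    then obtain d where d: "d > 0" "\<And>t. dist s t < d \<Longrightarrow> - inverse (real (Suc m)) < h t - y t" by blast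
    obtain k where "dist s (dseq k) < d" using dseq_dense[OF d(1)] by blast
    then show False using d(2)[of "dseq k"] m[of k] by linarith
  qed
qed

lemma le_iff_dense:
  fixes h y :: "'s \<Rightarrow>\<^sub>C real"
  shows "(\<forall>s. y s \<le> h s) \<longleftrightarrow> (\<forall>k. y (dseq k) \<le> h (dseq k))"
proof (intro iffI allI; (elim allE, assumption)?)
  fix s assume *: "\<forall>k. y (dseq k) \<le> h (dseq k)"
  show "y s \<le> h s"
  proof (rule ccontr)
    assume "\<not> y s \<le> h s"
    then have "\<exists>d>0. \<forall>t. dist s t < d \<longrightarrow> 0 < y t - h t"
      by (intro isCont_dist_greater continuous_intros isCont_apply_bcontfun) auto
    then obtain d where d: "d > 0" "\<And>t. dist s t < d \<Longrightarrow> 0 < y t - h t" by blast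
    obtain k where "dist s (dseq k) < d" using dseq_dense[OF d(1)] by blast
    then show False using d(2)[of "dseq k"] *[rule_format, of k] by linarith
  qed
qed

lemma pred_less [measurable (raw)]:
  fixes h y :: "'x \<Rightarrow> 's \<Rightarrow>\<^sub>C real"
  assumes [measurable]: "h \<in> borel_measurable L" "y \<in> borel_measurable L"
  shows "Measurable.pred L (\<lambda>x. \<forall>s. h x s < y x s)"
proof -
  have [measurable]: "(\<lambda>x. h x s) \<in> borel_measurable L" "(\<lambda>x. y x s) \<in> borel_measurable L" for s
    using measurable_compose[OF assms(1) borel_measurable_apply_bcontfun]
      measurable_compose[OF assms(2) borel_measurable_apply_bcontfun] by auto
  show ?thesis unfolding less_iff_dense by measurable
qed

lemma pred_le:
  fixes h y :: "'x \<Rightarrow> 's \<Rightarrow>\<^sub>C real"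
  assumes [measurable]: "h \<in> borel_measurable L" "y \<in> borel_measurable L"
  shows "Measurable.pred L (\<lambda>x. \<forall>s. y x s \<le> h x s)"
proof -
  have [measurable]: "(\<lambda>x. h x s) \<in> borel_measurable L" "(\<lambda>x. y x s) \<in> borel_measurable L" for s
    using measurable_compose[OF assms(1) borel_measurable_apply_bcontfun]
      measurable_compose[OF assms(2) borel_measurable_apply_bcontfun] by auto
  show ?thesis unfolding le_iff_dense by measurable
qed

section \<open>Independence of the new path and the preceding maximum\<close>

lemma pair_law:
  assumes "k \<ge> 1" "n \<ge> 1"
  shows "distr M (borel \<Otimes>\<^sub>M borel) (\<lambda>\<omega>. (Mn k n \<omega>, Xs (Suc k) \<omega>)) = distr M borel (Mn k n) \<Otimes>\<^sub>M \<mu>"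
proof -
  have nm: "normalized_max k (c n) (d n) \<in> measurable (\<Pi>\<^sub>M i\<in>{1..k}. borel) borel"
    by (rule measurable_normalized_max[OF cpt assms(1) c_Cpos[OF assms(2)], of "\<lambda>i x. x i"]) auto
  have "M.indep_var (PiM {1..k} (\<lambda>_. borel)) (\<lambda>\<omega>. restrict (\<lambda>i. Xs i \<omega>) {1..k})
      (PiM {Suc k} (\<lambda>_. borel)) (\<lambda>\<omega>. restrict (\<lambda>i. Xs i \<omega>) {Suc k})"
    by (rule M.indep_var_restrict[OF indep]) auto
  then have "M.indep_var borel (normalized_max k (c n) (d n) \<circ> (\<lambda>\<omega>. restrict (\<lambda>i. Xs i \<omega>) {1..k}))
      borel ((\<lambda>x. x (Suc k)) \<circ> (\<lambda>\<omega>. restrict (\<lambda>i. Xs i \<omega>) {Suc k}))"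
    by (rule M.indep_var_compose[OF _ nm]) auto
  moreover have "normalized_max k (c n) (d n) \<circ> (\<lambda>\<omega>. restrict (\<lambda>i. Xs i \<omega>) {1..k}) = Mn k n"
    unfolding Mn_def normalized_max_def comp_def by (intro ext arg_cong[where f=Bcontfun] arg_cong[where f=Max]) auto
  moreover have "(\<lambda>x. x (Suc k)) \<circ> (\<lambda>\<omega>. restrict (\<lambda>i. Xs i \<omega>) {Suc k}) = Xs (Suc k)"
    by auto
  ultimately have "M.indep_var borel (Mn k n) borel (Xs (Suc k))" by simp
  then show ?thesis
    using ident[of "Suc k"] by (simp add: M.indep_var_distribution_eq)
qed

lemma measure_pair:
  assumes "k \<ge> 1" "n \<ge> 1" and Q: "Q \<in> sets (borel \<Otimes>\<^sub>M borel)"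
  shows "(\<lambda>h. measure \<mu> (Pair h -` Q)) \<in> borel_measurable borel"
    and "measure M {\<omega>\<in>space M. (Mn k n \<omega>, Xs (Suc k) \<omega>) \<in> Q} =
      (\<integral>h. measure \<mu> (Pair h -` Q) \<partial>distr M borel (Mn k n))"
proof -
  have "sets (borel \<Otimes>\<^sub>M borel) = sets (borel \<Otimes>\<^sub>M \<mu>)" by (intro sets_pair_measure_cong) auto
  then have Q': "Q \<in> sets (borel \<Otimes>\<^sub>M \<mu>)" using Q by simp
  have m: "(\<lambda>h. emeasure \<mu> (Pair h -` Q)) \<in> borel_measurable borel"
    by (rule mu.measurable_emeasure_Pair[OF Q'])
  then show meas: "(\<lambda>h. measure \<mu> (Pair h -` Q)) \<in> borel_measurable borel"
    unfolding measure_def by measurable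
  have [measurable]: "Mn k n \<in> borel_measurable M" "Xs (Suc k) \<in> borel_measurable M"
    using assms Xs_measurable by auto
  interpret L: prob_space "distr M borel (Mn k n)" by (rule M.prob_space_distr) simp
  have "emeasure M {\<omega>\<in>space M. (Mn k n \<omega>, Xs (Suc k) \<omega>) \<in> Q} =
      emeasure (distr M (borel \<Otimes>\<^sub>M borel) (\<lambda>\<omega>. (Mn k n \<omega>, Xs (Suc k) \<omega>))) Q"
    using Q by (subst emeasure_distr) (auto intro!: arg_cong[where f="emeasure M"])
  also have "\<dots> = (\<integral>\<^sup>+h. emeasure \<mu> (Pair h -` Q) \<partial>distr M borel (Mn k n))"
    unfolding pair_law[OF assms(1,2)]
    using Q' by (intro mu.emeasure_pair_measure_alt) (simp cong: sets_pair_measure_cong)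
  also have "\<dots> = (\<integral>\<^sup>+h. ennreal (measure \<mu> (Pair h -` Q)) \<partial>distr M borel (Mn k n))"
    by (simp add: mu.emeasure_eq_measure)
  also have "\<dots> = ennreal (\<integral>h. measure \<mu> (Pair h -` Q) \<partial>distr M borel (Mn k n))"
    using meas by (intro nn_integral_eq_integral L.integrable_const_bound[where B=1]) auto
  finally show "measure M {\<omega>\<in>space M. (Mn k n \<omega>, Xs (Suc k) \<omega>) \<in> Q} =
      (\<integral>h. measure \<mu> (Pair h -` Q) \<partial>distr M borel (Mn k n))"
    unfolding M.emeasure_eq_measure by (subst (asm) ennreal_inj) (auto intro!: integral_nonneg_AE)
qed

definition Qge :: "nat \<Rightarrow> (('s \<Rightarrow>\<^sub>C real) \<times> ('s \<Rightarrow>\<^sub>C real)) set" where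
  "Qge n = {(h, x). \<forall>s. nrm n x s \<le> apply_bcontfun h s}"

definition Qgt :: "nat \<Rightarrow> ('s \<Rightarrow>\<^sub>C real) set \<Rightarrow> (('s \<Rightarrow>\<^sub>C real) \<times> ('s \<Rightarrow>\<^sub>C real)) set" where
  "Qgt n A = {(h, x). (\<forall>s. apply_bcontfun h s < nrm n x s) \<and> x \<in> A}"

lemma Q_sets:
  assumes "n \<ge> 1" "A \<in> sets borel"
  shows "Qge n \<in> sets (borel \<Otimes>\<^sub>M borel)" "Qgt n A \<in> sets (borel \<Otimes>\<^sub>M borel)"
proof -
  have [measurable]: "nrm_path n \<in> borel_measurable borel" using assms by simp
  have "{p \<in> space (borel \<Otimes>\<^sub>M borel). \<forall>s. nrm_path n (snd p) s \<le> apply_bcontfun (fst p) s} \<in> sets (borel \<Otimes>\<^sub>M borel)"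
    by (rule pred_le[unfolded pred_def]) measurable
  also have "{p \<in> space (borel \<Otimes>\<^sub>M borel). \<forall>s. nrm_path n (snd p) s \<le> apply_bcontfun (fst p) s} = Qge n"
    using assms by (auto simp: Qge_def space_pair_measure apply_nrm_path)
  finally show "Qge n \<in> sets (borel \<Otimes>\<^sub>M borel)" .
  have "{p \<in> space (borel \<Otimes>\<^sub>M borel). (\<forall>s. apply_bcontfun (fst p) s < nrm_path n (snd p) s) \<and> snd p \<in> A} \<in> sets (borel \<Otimes>\<^sub>M borel)"
    using assms(2) by measurable
  also have "{p \<in> space (borel \<Otimes>\<^sub>M borel). (\<forall>s. apply_bcontfun (fst p) s < nrm_path n (snd p) s) \<and> snd p \<in> A} = Qgt n A"
    using assms by (auto simp: Qgt_def space_pair_measure apply_nrm_path)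
  finally show "Qgt n A \<in> sets (borel \<Otimes>\<^sub>M borel)" .
qed

lemma open_good: "open {h. good h}"
proof (unfold open_dist, safe)
  fix h assume "good h"
  then obtain \<delta> where \<delta>: "\<delta> > 0" "\<And>s. G s (h s - \<delta>) > 0" using good_shift by blast
  have "good y" if "dist y h < \<delta>" for y
  proof (unfold good_def, rule allI)
    fix s
    have "\<bar>y s - h s\<bar> < \<delta>" using dist_bounded[of y s h] that by (simp add: dist_real_def)
    then have "G s (h s - \<delta>) \<le> G s (y s)" by (intro G_mono) linarith
    then show "G s (y s) > 0" using \<delta>(2)[of s] by linarith
  qed
  then show "\<exists>e>0. \<forall>y. dist y h < e \<longrightarrow> y \<in> {h. good h}" using \<delta>(1) by auto
qed

lemma AE_good': "AE h in distr N borel \<theta>. good h"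
  using AE_good borel_open[OF open_good] by (subst AE_distr_iff) auto

lemma good_minus:
  assumes "good h"
  obtains \<delta> h1 where "\<delta> > 0" "good h1" "\<And>s. apply_bcontfun h1 s = h s - \<delta>"
proof -
  obtain \<delta> where \<delta>: "\<delta> > 0" "\<And>s. G s (h s - \<delta>) > 0" using good_shift[OF assms] by blast
  have "apply_bcontfun (h - const_bcontfun \<delta>) s = h s - \<delta>" for s by simp
  then show thesis using that[of \<delta> "h - const_bcontfun \<delta>"] \<delta> by (auto simp: good_def)
qed

lemma dist_lessD: "dist y h < \<delta> \<Longrightarrow> \<bar>apply_bcontfun y s - apply_bcontfun h s\<bar> < \<delta>"
  using dist_bounded[of y s h] by (simp add: dist_real_def)

text \<open>Hence the maximum of \<open>n\<close> paths may be normalized with the functions belonging to \<open>n + 1\<close>.\<close>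

lemma no_new_extreme:
  "(\<lambda>n. measure M {\<omega>\<in>space M. \<forall>s. nrm n (Xs (Suc n) \<omega>) s \<le> Mn n n \<omega> s}) \<longlonglongrightarrow> 1"
proof (rule order_tendstoI)
  fix a :: real assume a: "a < 1"
  define \<phi> where "\<phi> n h = (if n \<ge> 1 then measure \<mu> (Pair h -` Qge n) else 0)" for n h
  have \<phi>: "\<phi> n h = measure \<mu> {x. \<forall>s. nrm n x s \<le> h s}" if "n \<ge> 1" for n h
    using that by (simp add: \<phi>_def Qge_def vimage_def)
  have meas: "\<phi> n \<in> borel_measurable borel" for n
    unfolding \<phi>_def[abs_def] using measure_pair(1)[of n n, OF _ _ Q_sets(1)[OF _ sets.top]] by (cases "n \<ge> 1") auto
  have "\<forall>\<^sub>F n in sequentially. (\<integral>h. \<phi> n h \<partial>distr M borel (Mn n n)) > (\<integral>h. 1 \<partial>distr N borel \<theta>) - (1 - a)"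
  proof (rule weak_limit.weak_convergence_liminf[OF weak_limit_Mn meas, where B=1])
    show "\<forall>\<^sub>F n in sequentially. \<forall>h. 0 \<le> \<phi> n h \<and> \<phi> n h \<le> 1" by (simp add: \<phi>_def)
    show "AE h in distr N borel \<theta>. \<forall>e>0. \<exists>\<delta>>0. \<forall>\<^sub>F n in sequentially. \<forall>y. dist y h < \<delta> \<longrightarrow> 1 - e < \<phi> n y"
      using AE_good'
    proof eventually_elim
      case (elim h)
      obtain \<delta> h1 where \<delta>: "\<delta> > 0" "good h1" "\<And>s. apply_bcontfun h1 s = h s - \<delta>" using good_minus[OF elim] by blast
      obtain \<kappa> where \<kappa>: "\<kappa> > 0" "\<forall>\<^sub>F n in sequentially. measure \<mu> {x. \<forall>s. nrm n x s \<le> h1 s} ^ n > \<kappa>"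
        using power_le_bounded_below[OF \<delta>(2)] by blast
      have "\<forall>\<^sub>F n in sequentially. \<forall>y. dist y h < \<delta> \<longrightarrow> 1 - e < \<phi> n y" if e: "e > 0" for e
      proof -
        \<comment> \<open>If the probability were at most \<open>r < 1\<close>, its
          \<open>n\<close>-th power would be at most \<open>r ^ n\<close> and eventually fall below
          \<kappa>. The maximum with 0 covers \<open>e > 1\<close>.\<close>
        define r where "r = max 0 (1 - e)"
        have r: "0 \<le> r" "r < 1" "1 - e \<le> r" using e by (auto simp: r_def)
        have "(\<lambda>n. r ^ n) \<longlonglongrightarrow> 0" using r by (intro LIMSEQ_power_zero) auto
        then have "\<forall>\<^sub>F n in sequentially. r ^ n < \<kappa>" using \<kappa>(1) by (rule order_tendstoD(2))
        with \<kappa>(2) eventually_ge_at_top[of 1] show ?thesis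
        proof eventually_elim
          case (elim n)
          let ?p = "measure \<mu> {x. \<forall>s. nrm n x s \<le> h1 s}"
          have "r < ?p"
          proof (rule ccontr)
            assume "\<not> r < ?p"
            then have "?p ^ n \<le> r ^ n" by (intro power_mono) auto
            with elim show False by linarith
          qed
          moreover have "?p \<le> \<phi> n y" if "dist y h < \<delta>" for y
          proof -
            have "Pair y \<in> measurable borel (borel \<Otimes>\<^sub>M borel)" by (rule measurable_Pair1') simp
            from measurable_sets[OF this Q_sets(1)[OF elim(2) sets.top]]
            have "Pair y -` Qge n \<in> sets \<mu>" by simp
            then have "{x. \<forall>s. nrm n x s \<le> y s} \<in> sets \<mu>" by (simp add: Qge_def vimage_def)
            moreover have "h1 s \<le> y s" for s using dist_lessD[OF that, of s] \<delta>(3)[of s] by linarith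
            ultimately show ?thesis
              unfolding \<phi>[OF elim(2)] by (intro mu.finite_measure_mono) (auto intro: order_trans)
          qed
          ultimately show ?case using r(3) by (smt (verit))
        qed
      qed
      then show ?case using \<delta>(1) by blast
    qed
  qed (use a in auto)
  moreover have "(\<integral>h. (1::real) \<partial>distr N borel \<theta>) = 1"
    using prob_space.prob_space[OF prob_theta] by simp
  ultimately have "\<forall>\<^sub>F n in sequentially. (\<integral>h. \<phi> n h \<partial>distr M borel (Mn n n)) > a" by simp
  with eventually_ge_at_top[of 1]
  show "\<forall>\<^sub>F n in sequentially. a < measure M {\<omega>\<in>space M. \<forall>s. nrm n (Xs (Suc n) \<omega>) s \<le> Mn n n \<omega> s}"
  proof eventually_elim
    case (elim n)
    have "measure M {\<omega>\<in>space M. \<forall>s. nrm n (Xs (Suc n) \<omega>) s \<le> Mn n n \<omega> s} =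
        measure M {\<omega>\<in>space M. (Mn n n \<omega>, Xs (Suc n) \<omega>) \<in> Qge n}" by (simp add: Qge_def)
    also have "\<dots> = (\<integral>h. \<phi> n h \<partial>distr M borel (Mn n n))"
      using measure_pair(2)[OF elim(1) elim(1) Q_sets(1)[OF elim(1) sets.top]] elim(1) by (simp add: \<phi>_def)
    finally show ?case using elim(2) by simp
  qed
next
  fix a :: real assume "1 < a"
  then show "\<forall>\<^sub>F n in sequentially. measure M {\<omega>\<in>space M. \<forall>s. nrm n (Xs (Suc n) \<omega>) s \<le> Mn n n \<omega> s} < a"
    by (intro always_eventually allI) (use M.prob_le_1 in \<open>auto intro: le_less_trans\<close>)
qed

text \<open>Normalization is increasing at each point, so being dominated there by an earlier path
  does not depend on the norming index. A dominated last path does not change the maximum under the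
  next normalization either.\<close>

lemma Mn_pred_eq:
  assumes "n \<ge> 1" "\<forall>s. nrm n (Xs (Suc n) \<omega>) s \<le> Mn n n \<omega> s"
  shows "Mn n (Suc n) \<omega> = Mn (Suc n) (Suc n) \<omega>"
proof (rule bcontfun_eqI, rule antisym)
  fix s
  show "Mn n (Suc n) \<omega> s \<le> Mn (Suc n) (Suc n) \<omega> s"
    using assms by (subst Mn_le_iff) (auto intro: Mn_ge)
  have "Mn n n \<omega> s \<in> (\<lambda>i. nrm n (Xs i \<omega>) s) ` {1..n}"
    using assms(1) by (subst apply_Mn) (auto intro!: Max_in)
  then obtain i where i: "i \<in> {1..n}" "Mn n n \<omega> s = nrm n (Xs i \<omega>) s" by blast
  have "nrm n (Xs (Suc n) \<omega>) s \<le> nrm n (Xs i \<omega>) s" using assms(2) i(2) by metis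
  then have "Xs (Suc n) \<omega> s \<le> Xs i \<omega> s"
    using nrm_less_iff[OF assms(1), of "Xs i \<omega>" s "Xs (Suc n) \<omega>"] by linarith
  then have "nrm (Suc n) (Xs (Suc n) \<omega>) s \<le> nrm (Suc n) (Xs i \<omega>) s"
    using nrm_less_iff[of "Suc n" "Xs i \<omega>" s "Xs (Suc n) \<omega>"] by linarith
  also have "\<dots> \<le> Mn n (Suc n) \<omega> s" using i(1) by (intro Mn_ge) auto
  finally have "nrm (Suc n) (Xs (Suc n) \<omega>) s \<le> Mn n (Suc n) \<omega> s" .
  moreover have "nrm (Suc n) (Xs j \<omega>) s \<le> Mn n (Suc n) \<omega> s" if "j \<in> {1..n}" for j
    using that by (intro Mn_ge) auto
  ultimately show "Mn (Suc n) (Suc n) \<omega> s \<le> Mn n (Suc n) \<omega> s"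
    by (subst Mn_le_iff) (auto simp: le_Suc_eq)
qed

text \<open>The maxima of \<open>n\<close> and of \<open>n + 1\<close> paths under the common index
  \<open>n + 1\<close> differ only on an event of vanishing probability, and a bounded test function
  notices at most \<open>2 * B\<close> times that probability.\<close>

lemma weak_Mn_pred:
  "weakly_convergent_to (\<lambda>n. distr M borel (Mn n (Suc n))) (distr N borel \<theta>)"
  unfolding weakly_convergent_to_def
proof
  fix \<phi> :: "('s \<Rightarrow>\<^sub>C real) \<Rightarrow>\<^sub>C real"
  obtain B where B: "\<And>h. \<bar>\<phi> h\<bar> \<le> B" using bcontfun_abs_le[of \<phi>] by blast
  have [measurable]: "apply_bcontfun \<phi> \<in> borel_measurable borel"
    by (rule borel_measurable_continuous_onI) simp
  let ?I = "\<lambda>n. \<integral>h. \<phi> h \<partial>distr M borel (Mn n (Suc n))"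
  let ?J = "\<lambda>n. \<integral>h. \<phi> h \<partial>distr M borel (Mn (Suc n) (Suc n))"
  let ?g = "\<lambda>n. {\<omega>\<in>space M. \<forall>s. nrm n (Xs (Suc n) \<omega>) s \<le> Mn n n \<omega> s}"
  have J: "?J \<longlonglongrightarrow> (\<integral>h. \<phi> h \<partial>distr N borel \<theta>)"
    using weak_Mn unfolding weakly_convergent_to_def
    by (intro LIMSEQ_Suc[of "\<lambda>n. \<integral>h. \<phi> h \<partial>distr M borel (Mn n n)"]) blast
  have bound: "\<forall>\<^sub>F n in sequentially. norm (?I n - ?J n) \<le> 2 * B * (1 - measure M (?g n))"
    using eventually_ge_at_top[of 1]
  proof eventually_elim
    case (elim n)
    have [measurable]: "Mn n (Suc n) \<in> borel_measurable M" "Mn (Suc n) (Suc n) \<in> borel_measurable M"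
      "Mn n n \<in> borel_measurable M" "Xs (Suc n) \<in> borel_measurable M" "nrm_path n \<in> borel_measurable borel"
      using elim Xs_measurable by auto
    have "{\<omega>\<in>space M. \<forall>s. nrm_path n (Xs (Suc n) \<omega>) s \<le> Mn n n \<omega> s} \<in> sets M"
      by (rule pred_le[unfolded pred_def]) measurable
    then have g [measurable]: "?g n \<in> sets M" using elim by (simp add: apply_nrm_path)
    have int: "integrable M (\<lambda>\<omega>. \<phi> (Mn n (Suc n) \<omega>))" "integrable M (\<lambda>\<omega>. \<phi> (Mn (Suc n) (Suc n) \<omega>))"
      using B by (auto intro!: M.integrable_const_bound[where B=B])
    have eq: "?I n - ?J n = (\<integral>\<omega>. \<phi> (Mn n (Suc n) \<omega>) - \<phi> (Mn (Suc n) (Suc n) \<omega>) \<partial>M)"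
      using int by (simp add: integral_distr)
    have "norm (\<integral>\<omega>. \<phi> (Mn n (Suc n) \<omega>) - \<phi> (Mn (Suc n) (Suc n) \<omega>) \<partial>M) \<le>
        (\<integral>\<omega>. norm (\<phi> (Mn n (Suc n) \<omega>) - \<phi> (Mn (Suc n) (Suc n) \<omega>)) \<partial>M)"
      by (rule integral_norm_bound)
    also have "\<dots> \<le> (\<integral>\<omega>. 2 * B * indicator (space M - ?g n) \<omega> \<partial>M)"
    proof (rule integral_mono)
      show "integrable M (\<lambda>\<omega>. norm (\<phi> (Mn n (Suc n) \<omega>) - \<phi> (Mn (Suc n) (Suc n) \<omega>)))"
        using int by auto
      show "integrable M (\<lambda>\<omega>. 2 * B * indicator (space M - ?g n) \<omega>)"
        by (intro integrable_mult_right integrable_real_indicator) (auto simp: less_top[symmetric])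
      fix \<omega> assume \<omega>: "\<omega> \<in> space M"
      show "norm (\<phi> (Mn n (Suc n) \<omega>) - \<phi> (Mn (Suc n) (Suc n) \<omega>)) \<le> 2 * B * indicator (space M - ?g n) \<omega>"
      proof (cases "\<omega> \<in> ?g n")
        case True
        then show ?thesis using Mn_pred_eq[OF elim, of \<omega>] by simp
      next
        case False
        have "\<bar>\<phi> (Mn n (Suc n) \<omega>) - \<phi> (Mn (Suc n) (Suc n) \<omega>)\<bar> \<le> 2 * B"
          using B[of "Mn n (Suc n) \<omega>"] B[of "Mn (Suc n) (Suc n) \<omega>"] by linarith
        with False \<omega> show ?thesis by simp
      qed
    qed
    also have "\<dots> = 2 * B * (1 - measure M (?g n))"
      using M.prob_compl[OF g] by (simp del: mem_Collect_eq)
    finally show ?case unfolding eq .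
  qed
  have "(\<lambda>n. 2 * B * (1 - measure M (?g n))) \<longlonglongrightarrow> 2 * B * (1 - 1)"
    by (intro tendsto_intros no_new_extreme)
  then have "(\<lambda>n. 2 * B * (1 - measure M (?g n))) \<longlonglongrightarrow> 0" by simp
  then have "(\<lambda>n. ?I n - ?J n) \<longlonglongrightarrow> 0" by (rule Lim_null_comparison[OF bound])
  from tendsto_add[OF this J] show "?I \<longlonglongrightarrow> (\<integral>h. \<phi> h \<partial>distr N borel \<theta>)" by simp
qed


subsection \<open>Record probabilities\<close>

text \<open>The value 0 on paths that are not good is the one the dual norm itself takes there; see
  \<open>dual_D_norm_Phi\<close>.\<close>

definition Phi :: "('s \<Rightarrow> real) \<Rightarrow> ('s \<Rightarrow>\<^sub>C real) \<Rightarrow> real" where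
  "Phi f h = (if good h then dualw (\<lambda>s. max (h s) (f s)) else 0)"

text \<open>The record occurs at time \<open>Suc n\<close>, so \<open>n\<close> counts the preceding
  paths; \<open>tail_event\<close> follows the same indexing.\<close>

definition record_event :: "nat \<Rightarrow> 'a set" where
  "record_event n = {\<omega>\<in>space M. \<forall>j\<in>{1..n}. \<forall>s. Xs j \<omega> s < Xs (Suc n) \<omega> s}"

definition tail_event :: "nat \<Rightarrow> ('s \<Rightarrow> real) \<Rightarrow> 'a set" where
  "tail_event n f = {\<omega>\<in>space M. \<forall>s. f s < nrm (Suc n) (Xs (Suc n) \<omega>) s}"

lemma Phi_nonneg: "Phi f h \<ge> 0"
  by (simp add: Phi_def dualw_nonneg)

lemma adm_max: "good h \<Longrightarrow> f \<in> Efun \<Longrightarrow> adm (\<lambda>s. max (h s) (f s))"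
  unfolding adm_def by (auto intro!: Efun_max bcontfun_Efun exI[of _ h])

lemma wt_single_expectation: "integral\<^sup>L K (wmax {s} (wt h)) = wt h s"
  by (simp add: wmax_def[abs_def] Z_expectation)

lemma Phi_le: "f \<in> Efun \<Longrightarrow> G s (f s) > 0 \<Longrightarrow> Phi f h \<le> wt f s"
  using dualw_le_wt[OF adm_max, of h f s] wt_antimono[of s f "\<lambda>s. max (h s) (f s)"] wt_nonneg[of f s]
  by (auto simp: Phi_def)

lemma record_event_iff:
  assumes "n \<ge> 1"
  shows "(\<forall>j\<in>{1..n}. \<forall>s. Xs j \<omega> s < Xs (Suc n) \<omega> s) \<longleftrightarrow> (\<forall>s. Mn n (Suc n) \<omega> s < nrm (Suc n) (Xs (Suc n) \<omega>) s)"
  using assms by (auto simp: Mn_less_iff nrm_less_iff)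

lemma tail_sets: "n \<ge> 1 \<Longrightarrow> f \<in> Efun \<Longrightarrow> {x. \<forall>s. f s < nrm n x s} \<in> sets borel"
  by (rule sets_exceed)

lemma tail_event_sets: "f \<in> Efun \<Longrightarrow> tail_event n f \<in> sets M"
  using measurable_sets[OF Xs_measurable tail_sets, of "Suc n" "Suc n" f]
  by (simp add: tail_event_def vimage_def Int_def conj_commute)

lemma record_event_sets: "record_event n \<in> sets M"
proof -
  have "{\<omega>\<in>space M. \<forall>s. Xs j \<omega> s < Xs (Suc n) \<omega> s} \<in> sets M" if "j \<in> {1..n}" for j
    using that by (intro pred_less[unfolded pred_def] Xs_measurable) auto
  then have "{\<omega>\<in>space M. \<forall>j\<in>{1..n}. \<forall>s. Xs j \<omega> s < Xs (Suc n) \<omega> s} \<in> sets M"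
    by (intro sets.sets_Collect_finite_All) auto
  then show ?thesis by (simp add: record_event_def)
qed

lemma exceed_max_tendsto:
  assumes "good h" "f \<in> Efun"
  shows "(\<lambda>n. real (Suc n) * measure \<mu> {x. \<forall>s. nrm (Suc n) x s > max (h s) (f s)}) \<longlonglongrightarrow>
    dualw (\<lambda>s. max (h s) (f s))"
  by (rule LIMSEQ_Suc[OF exceed_all[OF adm_max[OF assms]]])

text \<open>The functions \<open>h1\<close> and \<open>h2\<close> bracket the whole \<delta>-ball
  around \<open>h\<close>. As exceedance probabilities decrease in \<open>h\<close>, convergence at
  these two functions alone controls all paths in the ball.\<close>

lemma dualw_max_continuous:
  assumes "good h" "f \<in> Efun" "e > 0"
  obtains \<delta> h1 h2 where "\<delta> > 0" "good h1" "good h2"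
    "\<And>s. apply_bcontfun h1 s = h s - \<delta>" "\<And>s. apply_bcontfun h2 s = h s + \<delta>"
    "dualw (\<lambda>s. max (h1 s) (f s)) \<le> dualw (\<lambda>s. max (h s) (f s)) + e"
    "dualw (\<lambda>s. max (h s) (f s)) \<le> dualw (\<lambda>s. max (h2 s) (f s)) + e"
proof -
  obtain \<delta>0 h0 where h0: "\<delta>0 > 0" "good h0" "\<And>s. apply_bcontfun h0 s = h s - \<delta>0"
    using good_minus[OF assms(1)] by blast
  obtain a where a: "\<And>s. \<bar>h s\<bar> \<le> a" using bcontfun_abs_le[of h] by blast
  obtain b where b: "\<And>s. \<bar>f s\<bar> \<le> b" using assms(2) by (auto simp: Efun_def bounded_iff)
  \<comment> \<open>The 1 leaves room for \<open>h + \<delta>\<close>, since \<delta> is chosen at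
    most 1.\<close>
  define B where "B = max (a + 1) b"
  obtain \<delta>1 where \<delta>1: "\<delta>1 > 0" "\<And>g g'. g \<in> Efun \<Longrightarrow> g' \<in> Efun \<Longrightarrow> (\<And>s. h0 s \<le> g s \<and> g s \<le> B) \<Longrightarrow>
    (\<And>s. h0 s \<le> g' s \<and> g' s \<le> B) \<Longrightarrow> (\<And>s. \<bar>g s - g' s\<bar> < \<delta>1) \<Longrightarrow> dualw g \<le> dualw g' + e"
    using dualw_uniform[OF h0(2) assms(3), of B] by blast
  define \<delta> where "\<delta> = min 1 (min \<delta>0 (\<delta>1/2))"
  have \<delta>: "\<delta> > 0" "\<delta> \<le> 1" "\<delta> \<le> \<delta>0" "\<delta> < \<delta>1" using h0(1) \<delta>1(1) by (auto simp: \<delta>_def)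
  define h1 where "h1 = h - const_bcontfun \<delta>"
  define h2 where "h2 = h + const_bcontfun \<delta>"
  have h12: "apply_bcontfun h1 s = h s - \<delta>" "apply_bcontfun h2 s = h s + \<delta>" for s
    by (simp_all add: h1_def h2_def)
  have ge: "h0 s \<le> h1 s" "h0 s \<le> h s" "h0 s \<le> h2 s" for s
    using \<delta> h0(1,3) h12 by auto
  have good: "good g" if "\<And>s. apply_bcontfun h0 s \<le> apply_bcontfun g s" for g
    unfolding good_def
  proof
    fix s show "0 < G s (g s)" using G_mono[OF that[of s], of s] h0(2) unfolding good_def by (meson less_le_trans)
  qed
  have E: "(\<lambda>s. max (g s) (f s)) \<in> Efun" for g :: "'s \<Rightarrow>\<^sub>C real"
    using assms(2) by (intro Efun_max bcontfun_Efun)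
  have le: "max (h1 s) (f s) \<le> B" "max (h s) (f s) \<le> B" "max (h2 s) (f s) \<le> B" for s
    using a[of s] b[of s] \<delta> h12[of s] by (auto simp: B_def abs_le_iff le_max_iff_disj)
  show thesis
  proof (rule that[OF \<delta>(1) good[OF ge(1)] good[OF ge(3)] h12])
    have lb: "h0 s \<le> max (h1 s) (f s)" "h0 s \<le> max (h s) (f s)" "h0 s \<le> max (h2 s) (f s)" for s
      using ge[of s] by (simp_all add: le_max_iff_disj)
    have near: "\<bar>max (h1 s) (f s) - max (h s) (f s)\<bar> < \<delta>1" "\<bar>max (h s) (f s) - max (h2 s) (f s)\<bar> < \<delta>1" for s
      using \<delta> h12[of s] by (simp_all add: max_def)
    show "dualw (\<lambda>s. max (h1 s) (f s)) \<le> dualw (\<lambda>s. max (h s) (f s)) + e"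
      by (rule \<delta>1(2)[OF E E]) (intro conjI lb le near)+
    show "dualw (\<lambda>s. max (h s) (f s)) \<le> dualw (\<lambda>s. max (h2 s) (f s)) + e"
      by (rule \<delta>1(2)[OF E E]) (intro conjI lb le near)+
  qed
qed

text \<open>Given the preceding maximum \<open>h\<close>, the rescaled record probability is
  \<open>\<phi> n h\<close>, which converges continuously on good paths. Exceeding \<open>f\<close>
  at the one point \<open>s0\<close> bounds it by a sequence tending to \<open>wt f s0\<close>, so
  the integrands are uniformly bounded.\<close>

lemma numerator:
  assumes f: "f \<in> Efun" "G s0 (f s0) > 0"
  shows "Phi f \<in> borel_measurable borel"
    and "(\<lambda>n. real (Suc n) * measure M (record_event n \<inter> tail_event n f)) \<longlonglongrightarrow> (\<integral>\<omega>. Phi f (\<theta> \<omega>) \<partial>N)"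
proof -
  define A where "A n = {x. \<forall>s. f s < nrm (Suc n) x s}" for n
  have A: "A n \<in> sets borel" for n unfolding A_def using f by (intro tail_sets) auto
  define \<phi> where "\<phi> n h = real (Suc n) * measure \<mu> (Pair h -` Qgt (Suc n) (A n))" for n h
  have \<phi>: "\<phi> n h = real (Suc n) * measure \<mu> {x. \<forall>s. nrm (Suc n) x s > max (h s) (f s)}" for n h
    unfolding \<phi>_def by (intro arg_cong[where f="\<lambda>A. real (Suc n) * measure \<mu> A"]) (auto simp: Qgt_def A_def)
  have Q: "Qgt (Suc n) (A n) \<in> sets (borel \<Otimes>\<^sub>M borel)" for n by (intro Q_sets A) simp
  have meas [measurable]: "\<phi> n \<in> borel_measurable borel" for n
    unfolding \<phi>_def[abs_def] using measure_pair(1)[OF _ _ Q, of 1 1] by measurable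
  have mono: "\<phi> n h' \<le> \<phi> n h" if "\<And>s. h s \<le> h' s" for n and h h' :: "'s \<Rightarrow>\<^sub>C real"
  proof -
    have "(\<lambda>s. max (apply_bcontfun h s) (f s)) \<in> Efun"
      using f by (intro Efun_max bcontfun_Efun)
    then have "{x. \<forall>s. max (h s) (f s) < nrm (Suc n) x s} \<in> sets \<mu>"
      using sets_exceed[of "Suc n" "\<lambda>s. max (h s) (f s)"] by simp
    then have "measure \<mu> {x. \<forall>s. nrm (Suc n) x s > max (h' s) (f s)} \<le> measure \<mu> {x. \<forall>s. nrm (Suc n) x s > max (h s) (f s)}"
      by (intro mu.finite_measure_mono) (use that in \<open>auto intro: le_less_trans\<close>)
    then show ?thesis unfolding \<phi> by (intro mult_left_mono) auto
  qed
  have lim: "(\<lambda>n. \<phi> n h) \<longlonglongrightarrow> dualw (\<lambda>s. max (h s) (f s))" if "good h" for h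
    unfolding \<phi> by (rule exceed_max_tendsto[OF that f(1)])
  have [measurable]: "{h. good h} \<in> sets borel" using open_good by (rule borel_open)
  show Pm: "Phi f \<in> borel_measurable borel"
  \<comment> \<open>Measurability is inherited from the probabilities \<open>\<phi> n\<close>, cut
    off outside the open set of good paths.\<close>
  proof (rule borel_measurable_LIMSEQ_real)
    show "(\<lambda>n. indicator {h. good h} h * \<phi> n h) \<longlonglongrightarrow> Phi f h" for h
      using lim[of h] by (cases "good h") (auto simp: Phi_def)
  qed measurable
  define B where "B = wt f s0 + 1"
  have bnd: "\<forall>\<^sub>F n in sequentially. \<forall>h. 0 \<le> \<phi> n h \<and> \<phi> n h \<le> B"
  proof -
    have "(\<lambda>n. real n * measure \<mu> {x. \<exists>s\<in>{s0}. nrm n x s > f s}) \<longlonglongrightarrow> wt f s0"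
      using exceed_some_finite[of "{s0}" f] f(2) by (simp add: wt_single_expectation)
    then have "(\<lambda>n. real (Suc n) * measure \<mu> {x. nrm (Suc n) x s0 > f s0}) \<longlonglongrightarrow> wt f s0"
      using LIMSEQ_Suc by fastforce
    then have "\<forall>\<^sub>F n in sequentially. real (Suc n) * measure \<mu> {x. nrm (Suc n) x s0 > f s0} < B"
      by (rule order_tendstoD(2)) (simp add: B_def)
    then show ?thesis
    proof eventually_elim
      case (elim n)
      have "{x\<in>space \<mu>. nrm (Suc n) x s0 > f s0} \<in> sets \<mu>" by measurable
      then have "measure \<mu> {x. \<forall>s. nrm (Suc n) x s > max (h s) (f s)} \<le> measure \<mu> {x. nrm (Suc n) x s0 > f s0}" for h :: "'s \<Rightarrow>\<^sub>C real"
        by (intro mu.finite_measure_mono) (auto dest: spec[of _ s0])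
      then have "\<phi> n h \<le> real (Suc n) * measure \<mu> {x. nrm (Suc n) x s0 > f s0}" for h
        unfolding \<phi> by (intro mult_left_mono) auto
      then have "\<phi> n h \<le> B" for h using elim less_imp_le order_trans by blast
      moreover have "0 \<le> \<phi> n h" for h by (simp add: \<phi>_def)
      ultimately show ?case by blast
    qed
  qed
  have Pbnd: "0 \<le> Phi f h \<and> Phi f h \<le> B" for h
    using Phi_nonneg[of f h] Phi_le[OF f, of h] by (simp add: B_def)
  have prob': "\<forall>\<^sub>F n in sequentially. prob_space (distr M borel (Mn n (Suc n)))"
    using eventually_ge_at_top[of 1] by eventually_elim (auto intro!: M.prob_space_distr)
  let ?I = "\<integral>h. Phi f h \<partial>distr N borel \<theta>"
  have close: "AE h in distr N borel \<theta>. \<forall>e>0. \<exists>\<delta>>0. \<forall>\<^sub>F n in sequentially. \<forall>y. dist y h < \<delta> \<longrightarrow> \<bar>\<phi> n y - Phi f h\<bar> < e"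
    using AE_good'
  proof (eventually_elim, intro allI impI)
    fix h and e :: real assume h: "good h" and e: "e > 0"
    obtain \<delta> h1 h2 where d: "\<delta> > 0" "good h1" "good h2"
      "\<And>s. apply_bcontfun h1 s = h s - \<delta>" "\<And>s. apply_bcontfun h2 s = h s + \<delta>"
      "dualw (\<lambda>s. max (h1 s) (f s)) \<le> dualw (\<lambda>s. max (h s) (f s)) + e/2"
      "dualw (\<lambda>s. max (h s) (f s)) \<le> dualw (\<lambda>s. max (h2 s) (f s)) + e/2"
      using dualw_max_continuous[OF h f(1) half_gt_zero[OF e]] by blast
    have "\<forall>\<^sub>F n in sequentially. \<phi> n h1 < Phi f h + e"
      using d(6) e h by (intro order_tendstoD(2)[OF lim[OF d(2)]]) (auto simp: Phi_def)
    moreover have "\<forall>\<^sub>F n in sequentially. \<phi> n h2 > Phi f h - e"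
      using d(7) e h by (intro order_tendstoD(1)[OF lim[OF d(3)]]) (auto simp: Phi_def)
    ultimately have "\<forall>\<^sub>F n in sequentially. \<forall>y. dist y h < \<delta> \<longrightarrow> \<bar>\<phi> n y - Phi f h\<bar> < e"
    proof (eventually_elim, intro allI impI)
      fix n y assume *: "\<phi> n h1 < Phi f h + e" "Phi f h - e < \<phi> n h2" and y: "dist y h < \<delta>"
      have le: "h1 s \<le> y s" "y s \<le> h2 s" for s
        using dist_lessD[OF y, of s] d(4,5)[of s] by linarith+
      have "\<phi> n h2 \<le> \<phi> n y" "\<phi> n y \<le> \<phi> n h1" using le by (auto intro: mono)
      with * show "\<bar>\<phi> n y - Phi f h\<bar> < e" by linarith
    qed
    with d(1) show "\<exists>\<delta>>0. \<forall>\<^sub>F n in sequentially. \<forall>y. dist y h < \<delta> \<longrightarrow> \<bar>\<phi> n y - Phi f h\<bar> < e" by blast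
  qed
  have lim1: "(\<lambda>n. \<integral>h. \<phi> n h \<partial>distr M borel (Mn n (Suc n))) \<longlonglongrightarrow> ?I"
    by (rule weak_limit.weak_convergence_tendsto[OF weak_limit.intro[OF weak_Mn_pred prob' sets_distr prob_theta sets_distr]
      meas bnd Pm Pbnd close])
  have "\<forall>\<^sub>F n in sequentially. (\<integral>h. \<phi> n h \<partial>distr M borel (Mn n (Suc n))) =
      real (Suc n) * measure M (record_event n \<inter> tail_event n f)"
    using eventually_ge_at_top[of 1]
  proof eventually_elim
    case (elim n)
    have eq: "record_event n \<inter> tail_event n f = {\<omega>\<in>space M. (Mn n (Suc n) \<omega>, Xs (Suc n) \<omega>) \<in> Qgt (Suc n) (A n)}"
      using record_event_iff[OF elim] by (auto simp: record_event_def tail_event_def Qgt_def A_def)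
    have "measure M (record_event n \<inter> tail_event n f) =
        (\<integral>h. measure \<mu> (Pair h -` Qgt (Suc n) (A n)) \<partial>distr M borel (Mn n (Suc n)))"
      unfolding eq by (rule measure_pair(2)[OF elim _ Q]) simp
    then show ?case unfolding \<phi>_def by simp
  qed
  then have "(\<lambda>n. real (Suc n) * measure M (record_event n \<inter> tail_event n f)) \<longlonglongrightarrow> ?I"
    by (rule Lim_transform_eventually[OF lim1])
  also have "?I = (\<integral>\<omega>. Phi f (\<theta> \<omega>) \<partial>N)" using Pm by (simp add: integral_distr)
  finally show "(\<lambda>n. real (Suc n) * measure M (record_event n \<inter> tail_event n f)) \<longlonglongrightarrow> (\<integral>\<omega>. Phi f (\<theta> \<omega>) \<partial>N)" .
qed

section \<open>Exchangeability and the path that dominates all others\<close>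

definition champion :: "nat \<Rightarrow> ('s \<Rightarrow>\<^sub>C real) set \<Rightarrow> nat \<Rightarrow> 'a set" where
  "champion n A i = {\<omega>\<in>space M. (\<forall>j\<in>{1..n} - {i}. \<forall>s. Xs j \<omega> s < Xs i \<omega> s) \<and> Xs i \<omega> \<in> A}"

text \<open>The joint law is a product of equal factors, hence invariant under the transposition
  \<tau> of \<open>i\<close> and \<open>n\<close>, which carries one event to the other.\<close>

lemma champion_exchangeable:
  assumes A: "A \<in> sets borel" and i: "i \<in> {1..n}"
  shows "champion n A i \<in> sets M" and "measure M (champion n A i) = measure M (champion n A n)"
proof -
  let ?P = "\<Pi>\<^sub>M i\<in>{1..n}. \<mu>"
  let ?E = "\<lambda>i. {x\<in>space ?P. (\<forall>j\<in>{1..n} - {i}. \<forall>s. apply_bcontfun (x j) s < apply_bcontfun (x i) s) \<and> x i \<in> A}"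
  let ?J = "\<lambda>\<omega>. \<lambda>i\<in>{1..n}. Xs i \<omega>"
  have n: "n \<ge> 1" "n \<in> {1..n}" using i by auto
  have sp: "space ?P = {1..n} \<rightarrow>\<^sub>E UNIV" by (simp add: space_PiM)
  have E: "?E i \<in> sets ?P" if "i \<in> {1..n}" for i
  proof -
    have comp: "(\<lambda>x. x j) \<in> borel_measurable ?P" if "j \<in> {1..n}" for j
      using measurable_component_singleton[OF that, of "\<lambda>_. \<mu>"] by (simp cong: measurable_cong_sets)
    have "{x\<in>space ?P. \<forall>s. apply_bcontfun (x j) s < apply_bcontfun (x i) s} \<in> sets ?P" if "j \<in> {1..n} - {i}" for j
      using that \<open>i \<in> {1..n}\<close> by (intro pred_less[unfolded pred_def] comp) auto
    moreover have "{x\<in>space ?P. x i \<in> A} \<in> sets ?P"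
      using measurable_sets[OF comp[OF that] A] by (simp add: vimage_def Int_def conj_commute)
    ultimately show ?thesis
      by (intro sets.sets_Collect_conj sets.sets_Collect_finite_All) auto
  qed
  have J: "?J \<in> measurable M ?P"
    using measurable_joint[of n] by (simp add: measurable_cong_sets[OF refl sets_PiM_mu])
  have dJ: "distr M ?P ?J = ?P"
    using distr_joint[OF n(1)] by (simp add: distr_cong[OF refl sets_PiM_mu refl])
  have champ: "champion n A i = ?J -` ?E i \<inter> space M" if "i \<in> {1..n}" for i
    using that by (auto simp: champion_def space_PiM)
  show "champion n A i \<in> sets M"
    unfolding champ[OF i] by (rule measurable_sets[OF J E[OF i]])
  have cm: "measure M (champion n A i) = measure ?P (?E i)" if "i \<in> {1..n}" for i
    unfolding champ[OF that] by (subst (2) dJ[symmetric]) (rule measure_distr[OF J E[OF that], symmetric])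
  define \<tau> where "\<tau> j = (if j = i then n else if j = n then i else j)" for j
  have \<tau>: "inj_on \<tau> {1..n}" "\<tau> \<in> {1..n} \<rightarrow> {1..n}" "\<tau> n = i" "\<tau> i = n" "\<And>j. \<tau> (\<tau> j) = j"
    using i by (auto simp: \<tau>_def inj_on_def split: if_splits)
  let ?R = "\<lambda>x. \<lambda>j\<in>{1..n}. x (\<tau> j) :: 's \<Rightarrow>\<^sub>C real"
  have R: "?R \<in> measurable ?P ?P"
    using \<tau>(2) by (intro measurable_restrict measurable_component_singleton) auto
  have dR: "distr ?P ?P ?R = ?P"
    by (rule distr_PiM_reindex[of "{1..n}" "\<lambda>_. \<mu>", OF _ \<tau>(1,2)]) (rule mu.prob_space_axioms)
  have "?R -` ?E n \<inter> space ?P = ?E i"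
  proof (intro set_eqI)
    fix x :: "nat \<Rightarrow> 's \<Rightarrow>\<^sub>C real"
    have "(\<forall>j\<in>{1..n} - {n}. \<forall>s. apply_bcontfun (x (\<tau> j)) s < apply_bcontfun (x i) s) \<longleftrightarrow>
        (\<forall>j\<in>{1..n} - {i}. \<forall>s. apply_bcontfun (x j) s < apply_bcontfun (x i) s)"
    proof -
      have "\<tau> ` ({1..n} - {n}) = {1..n} - {i}"
      proof (intro equalityI subsetI)
        fix j assume "j \<in> {1..n} - {i}"
        then have "\<tau> j \<in> {1..n} - {n}" using \<tau> by (metis DiffE DiffI PiE singleton_iff)
        then show "j \<in> \<tau> ` ({1..n} - {n})" using \<tau>(5)[of j] by (metis imageI)
      next
        fix j assume "j \<in> \<tau> ` ({1..n} - {n})"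
        then show "j \<in> {1..n} - {i}" using \<tau> by (metis (no_types, lifting) DiffE DiffI PiE imageE singleton_iff)
      qed
      then have "(\<forall>j\<in>{1..n} - {i}. \<forall>s. apply_bcontfun (x j) s < apply_bcontfun (x i) s) \<longleftrightarrow>
          (\<forall>j\<in>\<tau> ` ({1..n} - {n}). \<forall>s. apply_bcontfun (x j) s < apply_bcontfun (x i) s)" by simp
      then show ?thesis by auto
    qed
    then show "x \<in> ?R -` ?E n \<inter> space ?P \<longleftrightarrow> x \<in> ?E i"
      using n i \<tau> by (auto simp: space_PiM)
  qed
  then have "measure ?P (?E i) = measure ?P (?E n)"
    using measure_distr[OF R E[OF n(2)]] dR by simp
  then show "measure M (champion n A i) = measure M (champion n A n)"
    using cm[OF i] cm[OF n(2)] by simp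
qed

text \<open>By exchangeability; bounding by a probability replaces a uniform integrability argument for the unbounded
  conditional record probabilities.\<close>

lemma champion_union:
  assumes "A \<in> sets borel"
  shows "real n * measure M (champion n A n) = measure M (\<Union>i\<in>{1..n}. champion n A i)"
proof -
  have disj: "disjoint_family_on (champion n A) {1..n}"
  proof (unfold disjoint_family_on_def, safe)
    fix i j \<omega> assume *: "i \<in> {1..n}" "j \<in> {1..n}" "i \<noteq> j" "\<omega> \<in> champion n A i" "\<omega> \<in> champion n A j"
    \<comment> \<open>Any point of S serves here, as types are nonempty.\<close>
    then have "Xs j \<omega> undefined < Xs i \<omega> undefined" "Xs i \<omega> undefined < Xs j \<omega> undefined"
      by (auto simp: champion_def)
    then show "\<omega> \<in> {}" by simp
  qed
  have "measure M (\<Union>i\<in>{1..n}. champion n A i) = (\<Sum>i\<in>{1..n}. measure M (champion n A i))"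
    using champion_exchangeable(1)[OF assms] disj by (intro M.finite_measure_finite_Union) auto
  also have "\<dots> = (\<Sum>i\<in>{1..n}. measure M (champion n A n))"
    by (intro sum.cong champion_exchangeable(2)[OF assms]) auto
  finally show ?thesis by simp
qed

lemma record_event_champion: "record_event n = champion (Suc n) UNIV (Suc n)"
  by (auto simp: record_event_def champion_def le_Suc_eq)

lemma record_le_1: "real (Suc n) * measure M (record_event n) \<le> 1"
  unfolding record_event_champion by (subst champion_union) auto

text \<open>A dominating path that is at most \<open>f\<close> at some point keeps the entire
  maximum at most \<open>f\<close> there. So the truncation error, even multiplied by
  \<open>Suc n\<close>, is bounded by a probability about the maximum, whose limit is under
  control.\<close>

lemma record_not_tail:
  assumes "f \<in> Efun"
  shows "real (Suc n) * measure M (record_event n) - real (Suc n) * measure M (record_event n \<inter> tail_event n f) \<le>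
    measure M {\<omega>\<in>space M. \<not> (\<forall>s. f s < Mn (Suc n) (Suc n) \<omega> s)}"
proof -
  let ?A = "- {x. \<forall>s. f s < nrm (Suc n) x s}"
  have A: "?A \<in> sets borel" using tail_sets[OF _ assms, of "Suc n"] by (auto simp: Compl_eq_Diff_UNIV)
  have "record_event n - tail_event n f = champion (Suc n) ?A (Suc n)"
    unfolding record_event_champion by (auto simp: champion_def tail_event_def)
  moreover have "measure M (record_event n - tail_event n f) = measure M (record_event n) - measure M (record_event n \<inter> tail_event n f)"
    using record_event_sets tail_event_sets[OF assms] by (rule M.finite_measure_Diff')
  ultimately have "real (Suc n) * measure M (record_event n) - real (Suc n) * measure M (record_event n \<inter> tail_event n f) =
      real (Suc n) * measure M (champion (Suc n) ?A (Suc n))"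
    by (simp add: right_diff_distrib)
  also have "\<dots> = measure M (\<Union>i\<in>{1..Suc n}. champion (Suc n) ?A i)" by (rule champion_union[OF A])
  also have "\<dots> \<le> measure M {\<omega>\<in>space M. \<not> (\<forall>s. f s < Mn (Suc n) (Suc n) \<omega> s)}"
  proof (rule M.finite_measure_mono)
    have "- {y. \<forall>s. f s < apply_bcontfun y s} \<in> sets borel"
      using sets_bcontfun_greater[OF cpt, of f] assms by (simp add: Efun_def Compl_eq_Diff_UNIV sets.compl_sets)
    from Mn_vimage_sets[OF _ _ this, of "Suc n" "Suc n"]
    show "{\<omega>\<in>space M. \<not> (\<forall>s. f s < Mn (Suc n) (Suc n) \<omega> s)} \<in> sets M" by simp
    show "(\<Union>i\<in>{1..Suc n}. champion (Suc n) ?A i) \<subseteq> {\<omega>\<in>space M. \<not> (\<forall>s. f s < Mn (Suc n) (Suc n) \<omega> s)}"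
    proof (rule UN_least, rule subsetI)
      fix i \<omega> assume i: "i \<in> {1..Suc n}" and \<omega>: "\<omega> \<in> champion (Suc n) ?A i"
      then obtain s where s: "nrm (Suc n) (Xs i \<omega>) s \<le> f s" by (auto simp: champion_def not_less)
      have "Mn (Suc n) (Suc n) \<omega> s \<le> f s"
      proof (subst Mn_le_iff; (intro ballI)?)
        fix j assume j: "j \<in> {1..Suc n}"
        show "nrm (Suc n) (Xs j \<omega>) s \<le> f s"
        proof (cases "j = i")
          case False
          then have "Xs j \<omega> s < Xs i \<omega> s" using \<omega> j by (auto simp: champion_def)
          then have "nrm (Suc n) (Xs j \<omega>) s < nrm (Suc n) (Xs i \<omega>) s" by (simp add: nrm_less_iff)
          with s show ?thesis by linarith
        qed (use s in simp)
      qed auto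
      then show "\<omega> \<in> {\<omega>\<in>space M. \<not> (\<forall>s. f s < Mn (Suc n) (Suc n) \<omega> s)}"
        using \<omega> by (auto simp: champion_def not_less)
    qed
  qed
  finally show ?thesis .
qed

end

subsection \<open>The conditional limit\<close>

lemma inverse_shift_tendsto_0: "(\<lambda>k. inverse (real (k + 2))) \<longlonglongrightarrow> 0"
  by (rule LIMSEQ_ignore_initial_segment[OF tendsto_inverse_0_at_top[OF filterlim_real_sequentially]])

context record_setting begin

section \<open>Truncation levels\<close>

lemma G_quantile:
  assumes "0 < v" "v < 1"
  obtains q where "G s q = v"
proof -
  interpret D: real_distribution "distr N borel (\<lambda>\<omega>. \<theta> \<omega> s)"
    by (rule N.real_distribution_distr) measurable
  have Gs: "G s = cdf (distr N borel (\<lambda>\<omega>. \<theta> \<omega> s))" by (simp add: G_def margin_cdf_def)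
  have "\<forall>\<^sub>F x in at_bot. G s x < v"
    unfolding Gs using D.cdf_lim_at_bot assms(1) by (rule order_tendstoD(2))
  then obtain a where a: "G s a < v" by (metis eventually_at_bot_linorder order_refl)
  have "\<forall>\<^sub>F x in at_top. v < G s x"
    unfolding Gs using D.cdf_lim_at_top_prob assms(2) by (rule order_tendstoD(1))
  then obtain b where b: "v < G s b" by (metis eventually_at_top_linorder order_refl)
  have "a \<le> b" using a b G_mono[of b a s] by (cases "a \<le> b") auto
  moreover have "continuous_on {a..b} (G s)"
    using continuous_G_compose[of "{a..b}" "\<lambda>_. s" "\<lambda>x. x"] by (simp add: continuous_on_id)
  ultimately obtain q where "G s q = v" using IVT'[of "G s" a v b] a b by auto
  then show thesis by (rule that)
qed

text \<open>The shift by 2 keeps the level strictly between 0 and 1, also for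
  \<open>k = 0\<close>.\<close>

definition quantile :: "nat \<Rightarrow> real" where "quantile k = (SOME q. G (dseq 0) q = inverse (real (k + 2)))"

lemma G_level: "G (dseq 0) (quantile k) = inverse (real (k + 2))"
proof -
  have "0 < inverse (real (k + 2))" "inverse (real (k + 2)) < 1" by (auto simp: inverse_less_1_iff)
  then obtain q where "G (dseq 0) q = inverse (real (k + 2))" using G_quantile by blast
  then show ?thesis unfolding quantile_def by (rule someI)
qed

text \<open>A level with \<open>G > 0\<close> at a single point suffices for \<open>numerator\<close>, and elsewhere it may tend to minus infinity,
  so that every good path eventually lies above \<open>trunc k\<close>.\<close>

definition trunc :: "nat \<Rightarrow> 's \<Rightarrow> real" where
  "trunc k s = (if s = dseq 0 then quantile k else - real k)"

lemma trunc_Efun: "trunc k \<in> Efun"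
proof -
  have "isCont (trunc k) s" if "s \<noteq> dseq 0" for s
  proof -
    have "isCont (\<lambda>s. (if s \<in> {dseq 0} then quantile k + real k else 0) - real k) s"
      using that by (intro continuous_diff isCont_finite_support continuous_const) auto
    moreover have "(\<lambda>s. (if s \<in> {dseq 0} then quantile k + real k else 0) - real k) = trunc k"
      by (auto simp: trunc_def)
    ultimately show ?thesis by simp
  qed
  then have "{s. \<not> isCont (trunc k) s} \<subseteq> {dseq 0}" by auto
  moreover have "range (trunc k) \<subseteq> {quantile k, - real k}" by (auto simp: trunc_def)
  ultimately show ?thesis
    by (auto simp: Efun_def intro: finite_subset bounded_subset[OF finite_imp_bounded])
qed

lemma trunc_pos: "G (dseq 0) (trunc k (dseq 0)) > 0"
  by (simp add: trunc_def G_level)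

lemma trunc_eventually_le:
  assumes "good h"
  shows "\<forall>\<^sub>F k in sequentially. \<forall>s. trunc k s \<le> h s"
proof -
  obtain b where b: "\<And>s. \<bar>h s\<bar> \<le> b" using bcontfun_abs_le[of h] by blast
  have "\<forall>\<^sub>F k in sequentially. inverse (real (k + 2)) < G (dseq 0) (h (dseq 0))"
    by (rule order_tendstoD(2)[OF inverse_shift_tendsto_0]) (use assms in \<open>simp add: good_def\<close>)
  moreover have "\<forall>\<^sub>F k in sequentially. b \<le> real k"
    using filterlim_real_sequentially by (auto simp: filterlim_at_top)
  ultimately show ?thesis
  proof eventually_elim
    case (elim k)
    have "\<not> h (dseq 0) \<le> quantile k" using elim(1) G_mono[of "h (dseq 0)" "quantile k" "dseq 0"] G_level[of k] by linarith
    moreover have "- real k \<le> h s" for s using elim(2) b[of s] by linarith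
    ultimately show ?case by (simp add: trunc_def)
  qed
qed

text \<open>A closed set containing all paths that do not exceed \<open>trunc k\<close>, so that the
  portmanteau inequality bounds the maximum from above. The subtracted 0 casts the second part in
  the form of \<open>closed_INF_le\<close>.\<close>

definition low :: "nat \<Rightarrow> ('s \<Rightarrow>\<^sub>C real) set" where
  "low k = {y :: 's \<Rightarrow>\<^sub>C real. \<forall>s\<in>{dseq 0}. y s \<le> quantile k} \<union> {y. (INF s. apply_bcontfun y s - 0) \<le> - real k}"

lemma low_closed: "closed (low k)"
  unfolding low_def by (intro closed_Un closed_le_on closed_INF_le) auto

lemma not_trunc_low: "\<not> (\<forall>s. trunc k s < apply_bcontfun y s) \<Longrightarrow> y \<in> low k"
proof -
  assume "\<not> (\<forall>s. trunc k s < apply_bcontfun y s)"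
  then obtain s where s: "y s \<le> trunc k s" by (auto simp: not_less)
  show "y \<in> low k"
  proof (cases "s = dseq 0")
    case False
    have "bounded (range (\<lambda>_ :: 's. 0 :: real))" by simp
    from cINF_lower[OF bdd_below_diff[OF this, of y], of s] s False show ?thesis
      by (simp add: low_def trunc_def)
  qed (use s in \<open>auto simp: low_def trunc_def\<close>)
qed

text \<open>The first part of \<open>low k\<close> has probability
  \<open>inverse (real (k + 2))\<close> by the choice of the quantile. The second part vanishes
  since every path is bounded below.\<close>

lemma low_tendsto_0: "(\<lambda>k. measure N {\<omega>\<in>space N. \<theta> \<omega> \<in> low k}) \<longlonglongrightarrow> 0"
proof -
  let ?I = "\<lambda>k. {y :: 's \<Rightarrow>\<^sub>C real. (INF s. y s - 0) \<le> - real k}"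
  let ?A = "\<lambda>k. {\<omega>\<in>space N. \<theta> \<omega> \<in> ?I k}"
  have I: "?I k \<in> sets borel" for k by (intro borel_closed closed_INF_le) simp
  have "range ?A \<subseteq> sets N" using theta_vimage_sets[OF I] by auto
  moreover have "decseq ?A" by (auto simp: decseq_def intro: order_trans)
  ultimately have "(\<lambda>k. measure N (?A k)) \<longlonglongrightarrow> measure N (\<Inter>k. ?A k)"
    by (rule N.finite_Lim_measure_decseq)
  moreover have "(\<Inter>k. ?A k) = {}"
  proof (rule equals0I)
    fix \<omega> assume \<omega>: "\<omega> \<in> (\<Inter>k. ?A k)"
    obtain k :: nat where k: "- (INF s. \<theta> \<omega> s - 0) < real k" using reals_Archimedean2 by blast
    have "\<theta> \<omega> \<in> ?I k" using \<omega> by blast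
    then have "(INF s. \<theta> \<omega> s - 0) \<le> - real k" by (rule CollectD)
    with k show False by linarith
  qed
  ultimately have "(\<lambda>k. measure N (?A k)) \<longlonglongrightarrow> 0" by (simp only: measure_empty)
  from tendsto_add[OF inverse_shift_tendsto_0 this]
  have lim: "(\<lambda>k. inverse (real (k + 2)) + measure N (?A k)) \<longlonglongrightarrow> 0" by simp
  show ?thesis
  proof (rule tendsto_sandwich[OF _ _ tendsto_const lim])
    have "measure N {\<omega>\<in>space N. \<theta> \<omega> \<in> low k} \<le> inverse (real (k + 2)) + measure N (?A k)" for k
    proof -
      have "{\<omega>\<in>space N. \<theta> \<omega> \<in> low k} = {\<omega>\<in>space N. \<theta> \<omega> (dseq 0) \<le> quantile k} \<union> ?A k" by (auto simp: low_def)
      also have "measure N \<dots> \<le> measure N {\<omega>\<in>space N. \<theta> \<omega> (dseq 0) \<le> quantile k} + measure N (?A k)"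
        using theta_vimage_sets[OF I] by (intro measure_Un_le) auto
      finally show ?thesis using G_eq[of "dseq 0" "quantile k"] G_level[of k] by simp
    qed
    then show "\<forall>\<^sub>F k in sequentially. measure N {\<omega>\<in>space N. \<theta> \<omega> \<in> low k} \<le> inverse (real (k + 2)) + measure N (?A k)"
      by simp
  qed simp
qed

section \<open>The probability of a complete record\<close>

definition Phi0 :: "('s \<Rightarrow>\<^sub>C real) \<Rightarrow> real" where
  "Phi0 h = (if good h then dualw h else 0)"

lemma good_adm: "good h \<Longrightarrow> adm h"
  by (auto simp: adm_def intro!: bcontfun_Efun exI[of _ h])

lemma Phi0_nonneg: "Phi0 h \<ge> 0"
  by (simp add: Phi0_def dualw_nonneg)

lemma Phi_le_Phi0: "f \<in> Efun \<Longrightarrow> Phi f h \<le> Phi0 h"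
  by (auto simp: Phi_def Phi0_def intro!: dualw_antimono good_adm adm_max)

lemma Phi_trunc_tendsto: "(\<lambda>k. Phi (trunc k) h) \<longlonglongrightarrow> Phi0 h"
proof (cases "good h")
  case True
  show ?thesis
    using trunc_eventually_le[OF True]
  proof (intro tendsto_eventually, eventually_elim)
    case (elim k)
    then have "(\<lambda>s. max (h s) (trunc k s)) = apply_bcontfun h" by (auto simp: max_absorb1)
    then show ?case by (simp add: Phi_def Phi0_def)
  qed
qed (simp add: Phi_def Phi0_def)

lemma Phi_measurable [measurable]: "Phi (trunc k) \<in> borel_measurable borel"
  by (rule numerator(1)[OF trunc_Efun trunc_pos])

lemma Phi_trunc_le_1: "(\<integral>\<omega>. Phi (trunc k) (\<theta> \<omega>) \<partial>N) \<le> 1"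
proof (rule LIMSEQ_le_const2[OF numerator(2)[OF trunc_Efun trunc_pos]])
  have "real (Suc n) * measure M (record_event n \<inter> tail_event n (trunc k)) \<le> 1" for n
  proof -
    have "measure M (record_event n \<inter> tail_event n (trunc k)) \<le> measure M (record_event n)"
      by (rule M.finite_measure_mono) (auto simp: record_event_sets)
    then have "real (Suc n) * measure M (record_event n \<inter> tail_event n (trunc k)) \<le> real (Suc n) * measure M (record_event n)"
      by (rule mult_left_mono) simp
    with record_le_1[of n] show ?thesis by linarith
  qed
  then show "\<exists>n0. \<forall>n\<ge>n0. real (Suc n) * measure M (record_event n \<inter> tail_event n (trunc k)) \<le> 1" by blast
qed

lemma Phi0_measurable [measurable]: "Phi0 \<in> borel_measurable borel"
  by (rule borel_measurable_LIMSEQ_real[OF Phi_trunc_tendsto Phi_measurable])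

text \<open>Fatou's lemma: the truncated integrals are limits of rescaled record probabilities,
  which never exceed 1. Integrability is not a formality, because it provides the dominating
  function in \<open>denominator\<close>, and the integral of a nonintegrable function would be 0 by
  convention.\<close>

lemma Phi0_integrable: "integrable N (\<lambda>\<omega>. Phi0 (\<theta> \<omega>))"
proof (rule integrableI_bounded)
  have "(\<integral>\<^sup>+\<omega>. ennreal (Phi0 (\<theta> \<omega>)) \<partial>N) = (\<integral>\<^sup>+\<omega>. liminf (\<lambda>k. ennreal (Phi (trunc k) (\<theta> \<omega>))) \<partial>N)"
    by (intro nn_integral_cong lim_imp_Liminf[symmetric] tendsto_ennrealI Phi_trunc_tendsto) simp
  also have "\<dots> \<le> liminf (\<lambda>k. \<integral>\<^sup>+\<omega>. ennreal (Phi (trunc k) (\<theta> \<omega>)) \<partial>N)"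
    by (rule nn_integral_liminf) measurable
  also have "\<dots> \<le> liminf (\<lambda>k. 1)"
  proof (rule Liminf_mono, rule always_eventually, rule allI)
    fix k
    have "(\<integral>\<^sup>+\<omega>. ennreal (Phi (trunc k) (\<theta> \<omega>)) \<partial>N) = ennreal (\<integral>\<omega>. Phi (trunc k) (\<theta> \<omega>) \<partial>N)"
      using Phi_nonneg Phi_le[OF trunc_Efun trunc_pos]
      by (intro nn_integral_eq_integral N.integrable_const_bound[where B="wt (trunc k) (dseq 0)"]) auto
    also have "\<dots> \<le> 1" using Phi_trunc_le_1 by (simp add: ennreal_le_1)
    finally show "(\<integral>\<^sup>+\<omega>. ennreal (Phi (trunc k) (\<theta> \<omega>)) \<partial>N) \<le> 1" .
  qed
  also have "\<dots> = (1::ennreal)" by (simp add: Liminf_const)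
  finally show "(\<integral>\<^sup>+\<omega>. ennreal (norm (Phi0 (\<theta> \<omega>))) \<partial>N) < \<infinity>"
    using Phi0_nonneg by (simp add: order.strict_trans1[of _ 1])
qed measurable

text \<open>An interchange of limits. For a fixed level \<open>k\<close> the truncated quantities
  converge by \<open>numerator\<close>; removing the level costs at most the probability that the
  maximum lies in \<open>low k\<close>, which is small for all large \<open>n\<close> at once. The
  errors are \<open>r/4\<close> for each of the two limits and \<open>r/2\<close> for the
  truncation.\<close>

lemma denominator:
  "(\<lambda>n. real (Suc n) * measure M (record_event n)) \<longlonglongrightarrow> (\<integral>\<omega>. Phi0 (\<theta> \<omega>) \<partial>N)"
proof -
  let ?J = "\<lambda>k. \<integral>\<omega>. Phi (trunc k) (\<theta> \<omega>) \<partial>N" and ?L = "\<integral>\<omega>. Phi0 (\<theta> \<omega>) \<partial>N"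
  have J: "?J \<longlonglongrightarrow> ?L"
    by (rule integral_dominated_convergence[OF _ _ Phi0_integrable])
      (use Phi_trunc_tendsto Phi_nonneg Phi_le_Phi0[OF trunc_Efun] in auto)
  show ?thesis
  proof (rule metric_LIMSEQ_I)
    fix r :: real assume r: "r > 0"
    have "\<forall>\<^sub>F k in sequentially. dist (?J k) ?L < r/4"
      using J r by (intro tendstoD) auto
    moreover have "\<forall>\<^sub>F k in sequentially. measure N {\<omega>\<in>space N. \<theta> \<omega> \<in> low k} < r/4"
      using low_tendsto_0 r by (intro order_tendstoD(2)) auto
    ultimately have "\<forall>\<^sub>F k in sequentially. dist (?J k) ?L < r/4 \<and> measure N {\<omega>\<in>space N. \<theta> \<omega> \<in> low k} < r/4"
      by (rule eventually_conj)
    then obtain k where k: "dist (?J k) ?L < r/4" "measure N {\<omega>\<in>space N. \<theta> \<omega> \<in> low k} < r/4"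
      by (auto simp: eventually_sequentially)
    let ?D = "\<lambda>n. real (Suc n) * measure M (record_event n)"
    let ?T = "\<lambda>n. real (Suc n) * measure M (record_event n \<inter> tail_event n (trunc k))"
    have "\<forall>\<^sub>F n in sequentially. dist (?T n) (?J k) < r/4"
      using numerator(2)[OF trunc_Efun trunc_pos] r by (intro tendstoD) auto
    moreover have "\<forall>\<^sub>F n in sequentially. measure M {\<omega>\<in>space M. Mn (Suc n) (Suc n) \<omega> \<in> low k} <
        measure N {\<omega>\<in>space N. \<theta> \<omega> \<in> low k} + r/4"
      by (rule eventually_compose_filterlim[OF Mn_closed[OF low_closed] filterlim_Suc]) (use r in simp)
    ultimately have "\<forall>\<^sub>F n in sequentially. dist (?D n) ?L < r"
    proof eventually_elim
      case (elim n)
      have "measure M {\<omega>\<in>space M. \<not> (\<forall>s. trunc k s < Mn (Suc n) (Suc n) \<omega> s)} \<le>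
          measure M {\<omega>\<in>space M. Mn (Suc n) (Suc n) \<omega> \<in> low k}"
      proof (rule M.finite_measure_mono)
        show "{\<omega>\<in>space M. Mn (Suc n) (Suc n) \<omega> \<in> low k} \<in> sets M"
          by (rule Mn_vimage_sets[OF _ _ borel_closed[OF low_closed]]) auto
      qed (use not_trunc_low in blast)
      then have "?D n - ?T n < r/2"
        using record_not_tail[OF trunc_Efun, of n k] elim(2) k(2) by linarith
      moreover have "?T n \<le> ?D n"
        by (intro mult_left_mono M.finite_measure_mono) (auto simp: record_event_sets)
      ultimately show ?case using elim(1) k(1) unfolding dist_real_def by linarith
    qed
    then show "\<exists>n0. \<forall>n\<ge>n0. dist (?D n) ?L < r" by (simp add: eventually_sequentially)
  qed
qed

text \<open>Almost surely all weights are at least some \<open>e > 0\<close>, and a strictly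
  positive path of the generator has a positive minimum \<open>z\<close> on the compact S. So the
  infimum of the products is at least \<open>e * z\<close> on an event of positive
  probability.\<close>

lemma denominator_pos:
  assumes Z: "measure K {\<omega>\<in>space K. \<forall>s. Z \<omega> s > 0} > 0"
  shows "(\<integral>\<omega>. Phi0 (\<theta> \<omega>) \<partial>N) > 0"
proof -
  have pos: "AE \<omega> in N. Phi0 (\<theta> \<omega>) > 0"
    using AE_eta_less AE_good
  proof eventually_elim
    case (elim \<omega>)
    then obtain e where e: "e > 0" "\<And>s. log_margin G (\<theta> \<omega>) s \<le> - e" by blast
    have wt: "wt (\<theta> \<omega>) s \<ge> e" for s using e(2)[of s] unfolding wt_def log_margin_def by linarith
    have Dpos: "winf (\<theta> \<omega>) \<kappa> > 0" if "\<forall>s. Z \<kappa> s > 0" for \<kappa>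
    proof -
      have "\<exists>z>0. \<forall>s\<in>UNIV. Z \<kappa> s \<ge> 0 + z"
        using that by (intro bcontfun_eventually_gt[OF cpt] continuous_on_const) blast
      then obtain z where z: "z > 0" "\<And>s. Z \<kappa> s \<ge> z" by auto
      have "e * z \<le> winf (\<theta> \<omega>) \<kappa>"
      proof (rule winf_ge)
        fix s show "e * z \<le> wt (\<theta> \<omega>) s * Z \<kappa> s"
          using z e(1) wt[of s] wt_nonneg by (intro mult_mono) auto
      qed
      moreover have "e * z > 0" using e z by simp
      ultimately show ?thesis by linarith
    qed
    have "dualw (\<theta> \<omega>) \<noteq> 0"
    proof
      assume "dualw (\<theta> \<omega>) = 0"
      then have "AE \<kappa> in K. winf (\<theta> \<omega>) \<kappa> = 0"
        unfolding dualw_def using elim(2)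
        by (subst (asm) integral_nonneg_eq_0_iff_AE) (auto intro: winf_integrable good_adm winf_nonneg)
      then have "AE \<kappa> in K. \<kappa> \<notin> {\<omega>\<in>space K. \<forall>s. Z \<omega> s > 0}"
        by eventually_elim (use Dpos in force)
      \<comment> \<open>Positive \<open>measure\<close> already implies measurability, as
        nonmeasurable sets get 0.\<close>
      moreover have "{\<omega>\<in>space K. \<forall>s. Z \<omega> s > 0} \<in> sets K"
        by (rule ccontr) (use Z measure_notin_sets in force)
      ultimately have "measure K {\<omega>\<in>space K. \<forall>s. Z \<omega> s > 0} = 0"
        by (subst K.prob_eq_0) auto
      with Z show False by simp
    qed
    then show ?case using dualw_nonneg[of "\<theta> \<omega>"] elim(2) by (simp add: Phi0_def)
  qed
  have "(\<integral>\<omega>. Phi0 (\<theta> \<omega>) \<partial>N) \<noteq> 0"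
  proof
    assume "(\<integral>\<omega>. Phi0 (\<theta> \<omega>) \<partial>N) = 0"
    then have "AE \<omega> in N. Phi0 (\<theta> \<omega>) = 0"
      by (subst (asm) integral_nonneg_eq_0_iff_AE) (auto intro: Phi0_integrable Phi0_nonneg)
    with pos have "AE \<omega> in N. False" by eventually_elim simp
    then show False by simp
  qed
  moreover have "(\<integral>\<omega>. Phi0 (\<theta> \<omega>) \<partial>N) \<ge> 0" by (rule integral_nonneg_AE) (simp add: Phi0_nonneg)
  ultimately show ?thesis by linarith
qed

section \<open>Identification of the limit with \<open>H_bar\<close>\<close>

lemma dual_D_norm_eq_0:
  assumes "v s = 0"
  shows "dual_D_norm K Z v = 0"
proof -
  have "(INF s. \<bar>v s\<bar> * Z \<omega> s) = 0" if "\<omega> \<in> space K" for \<omega>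
  proof (rule antisym)
    have "bdd_below (range (\<lambda>s. \<bar>v s\<bar> * Z \<omega> s))"
      using Z_nonneg[OF that] by (intro bdd_belowI2[of _ 0]) simp
    from cINF_lower[OF this, of s] show "(INF s. \<bar>v s\<bar> * Z \<omega> s) \<le> 0" using assms by simp
    show "0 \<le> (INF s. \<bar>v s\<bar> * Z \<omega> s)" using Z_nonneg[OF that] by (intro cINF_greatest) auto
  qed
  then have "dual_D_norm K Z v = (\<integral>\<omega>. 0 \<partial>K)"
    unfolding dual_D_norm_def by (intro Bochner_Integration.integral_cong) auto
  then show ?thesis by simp
qed

lemma not_good: "\<not> good h \<Longrightarrow> \<exists>s. G s (h s) = 0"
  using G_nonneg by (auto simp: good_def not_less intro: antisym)

text \<open>On a path meeting a zero of \<open>G\<close> the convention \<open>ln 0 = 0\<close>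
  produces a zero weight, which annihilates the infimum and matches the value 0 of
  \<open>Phi0\<close>.\<close>

lemma dual_D_norm_Phi0: "dual_D_norm K Z (log_margin G (\<theta> \<omega>)) = Phi0 (\<theta> \<omega>)"
proof (cases "good (\<theta> \<omega>)")
  case False
  then obtain s where "G s (\<theta> \<omega> s) = 0" using not_good by blast
  then have "dual_D_norm K Z (log_margin G (\<theta> \<omega>)) = 0"
    by (intro dual_D_norm_eq_0[where s = s]) (simp add: log_margin_def)
  with False show ?thesis by (simp add: Phi0_def)
qed (simp add: Phi0_def dual_D_norm_log_margin)

text \<open>On good paths \<open>\<psi>\<close> is increasing and commutes with the maximum. At a
  zero of \<open>G\<close> the conventional value 0 wins against the nonpositive
  \<open>\<psi>(f)\<close>, so the weight is again 0.\<close>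

lemma dual_D_norm_Phi:
  assumes "\<And>s. G s (f s) > 0"
  shows "dual_D_norm K Z (\<lambda>s. max (log_margin G (\<theta> \<omega>) s) (log_margin G f s)) = Phi f (\<theta> \<omega>)"
proof (cases "good (\<theta> \<omega>)")
  case True
  have "max (log_margin G (\<theta> \<omega>) s) (log_margin G f s) = log_margin G (\<lambda>s. max (\<theta> \<omega> s) (f s)) s" for s
  proof -
    have pos: "G s (\<theta> \<omega> s) > 0" "G s (f s) > 0" using True assms by (auto simp: good_def)
    show ?thesis
      using pos G_mono[of "\<theta> \<omega> s" "f s" s] G_mono[of "f s" "\<theta> \<omega> s" s]
      by (cases "\<theta> \<omega> s \<le> f s") (auto simp: log_margin_def max_def)
  qed
  then show ?thesis using True by (simp add: Phi_def dual_D_norm_log_margin)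
next
  case False
  then obtain s where s: "G s (\<theta> \<omega> s) = 0" using not_good by blast
  have "max (log_margin G (\<theta> \<omega>) s) (log_margin G f s) = 0"
    using s assms[of s] G_le_1[of s "f s"] by (simp add: log_margin_def max_def)
  then show ?thesis using False dual_D_norm_eq_0 by (simp add: Phi_def)
qed

lemma conditional_record_limit:
  assumes f: "f \<in> Efun" "\<And>s. G s (f s) > 0"
    and Z: "measure K {\<omega>\<in>space K. \<forall>s. Z \<omega> s > 0} > 0"
  shows "(\<lambda>n. measure M (record_event n \<inter> tail_event n f) / measure M (record_event n)) \<longlonglongrightarrow>
    H_bar K Z N (\<lambda>\<omega>. log_margin G (\<theta> \<omega>)) (log_margin G f)"
proof -
  \<comment> \<open>The probabilities themselves tend to 0; the cancelling factor
    \<open>Suc n\<close> gives numerator and denominator finite limits, with a positive one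
    below.\<close>
  have "(\<lambda>n. (real (Suc n) * measure M (record_event n \<inter> tail_event n f)) / (real (Suc n) * measure M (record_event n)))
      \<longlonglongrightarrow> (\<integral>\<omega>. Phi f (\<theta> \<omega>) \<partial>N) / (\<integral>\<omega>. Phi0 (\<theta> \<omega>) \<partial>N)"
    using denominator_pos[OF Z] by (intro tendsto_divide numerator(2)[OF f(1) f(2)] denominator) auto
  then show ?thesis
    by (simp add: H_bar_def dual_D_norm_Phi[OF f(2)] dual_D_norm_Phi0 del: of_nat_Suc)
qed

end

theorem corollary3p10:
  fixes N :: "'b measure" and \<theta> :: "'b \<Rightarrow> 's::metric_space \<Rightarrow>\<^sub>C real"
    and M\<^sub>0 :: "'c measure" and X :: "'c \<Rightarrow> 's \<Rightarrow>\<^sub>C real"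
    and M :: "'a measure" and Xs :: "nat \<Rightarrow> 'a \<Rightarrow> 's \<Rightarrow>\<^sub>C real"
    and K :: "'k measure" and Z :: "'k \<Rightarrow> 's \<Rightarrow>\<^sub>C real"
    and c d :: "nat \<Rightarrow> 's \<Rightarrow>\<^sub>C real"
    and F G :: "'s \<Rightarrow> real \<Rightarrow> real"
    and \<eta> :: "'b \<Rightarrow> 's \<Rightarrow> real"
    and f :: "'s \<Rightarrow> real"
  assumes "compact (UNIV :: 's set)"
    and "max_stable_process N \<theta>"
    and "G = margin_cdf N \<theta>"
    and "path_process M\<^sub>0 X"
    and "in_max_domain M\<^sub>0 X N \<theta> c d"
    and "F = margin_cdf M\<^sub>0 X"
    and "prob_space M"
    and "prob_space.indep_vars M (\<lambda>_. borel) Xs {1..}"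
    and "\<And>i. i \<ge> 1 \<Longrightarrow> distr M borel (Xs i) = distr M\<^sub>0 borel X"
    and "\<And>s. continuous_on UNIV (F s)"
    and "\<And>s. strict_mono_on (distribution_support (distr M\<^sub>0 borel (\<lambda>\<omega>. X \<omega> s))) (F s)"
    and "\<And>C. compact C \<Longrightarrow>
           uniform_limit (UNIV \<times> C) (\<lambda>n (s, x). F s (c n s * x + d n s) ^ n) (\<lambda>(s, x). G s x)
             sequentially"
    and "\<eta> = (\<lambda>\<omega>. log_margin G (\<theta> \<omega>))"
    and "generator_of K Z N \<eta>"
    and "\<P>(\<omega> in K. \<forall>s. Z \<omega> s > 0) > 0"
    and "f \<in> Efun"
    and "(INF s. G s (f s)) > 0"
  shows "(\<lambda>n. \<P>(\<omega> in M. (\<forall>s. (Xs n \<omega> s - d n s) / c n s > f s)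
              \<bar> complete_record (\<lambda>i. Xs i \<omega>) n))
           \<longlonglongrightarrow> H_bar K Z N \<eta> (log_margin G f)"
proof -
  interpret record_setting N \<theta> M Xs "distr M\<^sub>0 borel X" K Z c d G
  proof (rule record_setting.intro)
    show "path_process N \<theta>" using assms(2) by (simp add: max_stable_process_def)
    show "\<And>n. n \<ge> 1 \<Longrightarrow> c n \<in> Cpos" using assms(5) by (simp add: in_max_domain_def)
    show "weakly_convergent_to (\<lambda>n. normalized_max_law (distr M\<^sub>0 borel X) n (c n) (d n)) (distr N borel \<theta>)"
      using assms(5) by (simp add: in_max_domain_def)
    show "generator_of K Z N (\<lambda>\<omega>. log_margin G (\<theta> \<omega>))" using assms(13,14) by simp
  qed (fact assms)+
  have pos: "G s (f s) > 0" for s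
  proof -
    have "bdd_below (range (\<lambda>s. G s (f s)))" using G_nonneg by (intro bdd_belowI2)
    then have "(INF s. G s (f s)) \<le> G s (f s)" by (rule cINF_lower) simp
    with assms(17) show ?thesis by linarith
  qed
  have rec: "complete_record (\<lambda>i. Xs i \<omega>) (Suc n) \<longleftrightarrow> (\<forall>j\<in>{1..n}. \<forall>s. Xs j \<omega> s < Xs (Suc n) \<omega> s)" for n \<omega>
    by (auto simp: complete_record_def less_Suc_eq_le)
  have "\<P>(\<omega> in M. (\<forall>s. (Xs (Suc n) \<omega> s - d (Suc n) s) / c (Suc n) s > f s)
          \<bar> complete_record (\<lambda>i. Xs i \<omega>) (Suc n)) =
      measure M (record_event n \<inter> tail_event n f) / measure M (record_event n)" for n
    unfolding cond_prob_def rec record_event_def tail_event_def nrm_def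
    by (intro arg_cong2[where f="(/)"] arg_cong[where f="measure M"]) auto
  then have "(\<lambda>n. \<P>(\<omega> in M. (\<forall>s. (Xs (Suc n) \<omega> s - d (Suc n) s) / c (Suc n) s > f s)
          \<bar> complete_record (\<lambda>i. Xs i \<omega>) (Suc n))) \<longlonglongrightarrow> H_bar K Z N \<eta> (log_margin G f)"
    using conditional_record_limit[OF assms(16) pos assms(15)] by (simp only: assms(13))
  then show ?thesis by (rule LIMSEQ_imp_Suc)
qed

end
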